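(* Let $n\geq 1$, let $\mathcal{S}_n$ be the space of real symmetric $n\times n$ matrices, on which the orthogonal group $\mathcal{O}_n$ acts by $P\cdot S=PSP^{\top}$, and let $\mathcal{W}$ be the set of vector fields on $\mathcal{S}_n/\mathcal{O}_n$ induced by $\mathcal{O}_n$-equivariant $C^\infty$ vector fields on $\mathcal{S}_n$. For any integer $k\geq 2$ there exists a residual set of $k$-tuples $(X_1,\ldots,X_k)\in\mathcal{W}^k$ for which the following property holds: for any $S,S'\in\mathcal{S}_n/\mathcal{O}_n$ whose ordered multiplicities coincide, there exist $m\in\mathbb{N}$, $t_1,\ldots,t_m\in\mathbb{R}$ and $i_1,\ldots,i_m\in\{1,\ldots,k\}$ (not necessarily distinct) such that $S'=e^{t_1X_{i_1}}\circ\cdots\circ e^{t_mX_{i_m}}S$.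
   Context: A vector field $X$ on $\mathcal{S}_n$ is $\mathcal{O}_n$-equivariant if $(A_P)_*X=X$ for every $P\in\mathcal{O}_n$, where $A_P(S)=PSP^\top$. Its flow commutes with the action, hence it induces a vector field (and a flow) on the orbit space $\mathcal{S}_n/\mathcal{O}_n$. For $X\in\mathcal{W}$, $e^{tX}$ denotes the flow at time $t$ on $\mathcal{S}_n/\mathcal{O}_n$, i.e. the map induced by the flow of any equivariant vector field inducing $X$. By diagonalization, an element of $\mathcal{S}_n/\mathcal{O}_n$ is identified with the empirical measure $\frac1n\sum_{j=1}^n\delta_{x_j}$ of the eigenvalues (with multiplicity) of any representative, so $\mathcal{S}_n/\mathcal{O}_n\simeq\mathbb{R}^n/\mathfrak{S}_n\simeq\mathcal{M}_n(\mathbb{R})$, the set of probability measures on $\mathbb{R}$ of the form $\frac1n\sum_{j=1}^n\delta_{x_j}$. Ordered multiplicities: for $S\in\mathcal{S}_n/\mathcal{O}_n$, let $\lambda_1<\cdots<\lambda_{n(S)}$ be the distinct eigenvalues of any representative and $m_1,\ldots,m_{n(S)}$ their respective multiplicities; the tuple $(m_1,\ldots,m_{n(S)})$ is the tuple of ordered multiplicities of $S$. The ordered multiplicities of $S$ and $S'$ coincide if $n(S)=n(S')$ and $m_i(S)=m_i(S')$ for all $1\le i\le n(S)$. Topology: the set of $C^\infty$ equivariant vector fields on $\mathcal{S}_n$ carries the $C^\infty$ topology on compact sets (uniform convergence of all derivatives on compact sets), and $\mathcal{W}$ carries the quotient topology. A set is residual if it contains a countable intersection of open dense sets. *)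

theory Defs
  imports "HOL-Analysis.Analysis"
begin

section \<open>The Euclidean space of symmetric matrices\<close>

typedef 'n sym_mat = "{A :: real^'n^'n. transpose A = A}"
  morphisms mat_of Abs_sym_mat
  by (rule exI[of _ "mat 1"]) (simp add: transpose_mat)

setup_lifting type_definition_sym_mat

instantiation sym_mat :: (finite) real_vector
begin

lift_definition zero_sym_mat :: "'a sym_mat" is 0
  by (simp add: transpose_def vec_eq_iff)
lift_definition plus_sym_mat :: "'a sym_mat \<Rightarrow> 'a sym_mat \<Rightarrow> 'a sym_mat" is "(+)"
  by (simp add: transpose_def vec_eq_iff)
lift_definition minus_sym_mat :: "'a sym_mat \<Rightarrow> 'a sym_mat \<Rightarrow> 'a sym_mat" is "(-)"
  by (simp add: transpose_def vec_eq_iff)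
lift_definition uminus_sym_mat :: "'a sym_mat \<Rightarrow> 'a sym_mat" is uminus
  by (simp add: transpose_def vec_eq_iff)
lift_definition scaleR_sym_mat :: "real \<Rightarrow> 'a sym_mat \<Rightarrow> 'a sym_mat" is "(*\<^sub>R)"
  by (simp add: transpose_def vec_eq_iff)

instance
  by standard (transfer, simp add: algebra_simps)+

end

instantiation sym_mat :: (finite) real_inner
begin

lift_definition inner_sym_mat :: "'a sym_mat \<Rightarrow> 'a sym_mat \<Rightarrow> real" is "inner" .
lift_definition norm_sym_mat :: "'a sym_mat \<Rightarrow> real" is norm .
definition "sgn (x :: 'a sym_mat) = x /\<^sub>R norm x"
definition "dist (x :: 'a sym_mat) y = norm (x - y)"
definition "(uniformity :: ('a sym_mat \<times> 'a sym_mat) filter) =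
  (INF e\<in>{0<..}. principal {(x, y). dist x y < e})"
definition "open (U :: 'a sym_mat set) \<longleftrightarrow>
  (\<forall>x\<in>U. eventually (\<lambda>(x', y). x' = x \<longrightarrow> y \<in> U) uniformity)"

instance
proof
  fix x y z :: "'a sym_mat" and r :: real and U :: "'a sym_mat set"
  show "dist x y = norm (x - y)" by (rule dist_sym_mat_def)
  show "sgn x = x /\<^sub>R norm x" by (rule sgn_sym_mat_def)
  show "(uniformity :: ('a sym_mat \<times> 'a sym_mat) filter) =
    (INF e\<in>{0<..}. principal {(x, y). dist x y < e})"
    by (rule uniformity_sym_mat_def)
  show "open U \<longleftrightarrow> (\<forall>x\<in>U. eventually (\<lambda>(x', y). x' = x \<longrightarrow> y \<in> U) uniformity)"
    by (rule open_sym_mat_def)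
  show "inner x y = inner y x" by transfer (rule inner_commute)
  show "inner (x + y) z = inner x z + inner y z" by transfer (rule inner_add_left)
  show "inner (r *\<^sub>R x) y = r * inner x y" by transfer simp
  show "0 \<le> inner x x" by transfer simp
  show "inner x x = 0 \<longleftrightarrow> x = 0" by transfer simp
  show "norm x = sqrt (inner x x)" by transfer (rule norm_eq_sqrt_inner)
qed

end

lemma subspace_symmetric: "subspace {A :: real^'n^'n. transpose A = A}"
  by (auto simp: subspace_def transpose_def vec_eq_iff)

lemma ex_orthonormal_basis_symmetric:
  "\<exists>B :: 'n::finite sym_mat set. B \<noteq> {} \<and> finite B
     \<and> (\<forall>u\<in>B. \<forall>v\<in>B. inner u v = (if u = v then 1 else 0))
     \<and> (\<forall>x. (\<forall>u\<in>B. inner x u = 0) \<longleftrightarrow> x = 0)"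
proof -
  let ?S = "{A :: real^'n^'n. transpose A = A}"
  obtain C where C: "C \<subseteq> ?S" "pairwise orthogonal C" "\<And>x. x \<in> C \<Longrightarrow> norm x = 1"
      "independent C" "card C = dim ?S" "span C = ?S"
    by (rule orthonormal_basis_subspace[OF subspace_symmetric[where 'n='n]]) (rule that; blast)
  have fin: "finite C" using C(4) independent_imp_finite by blast
  define B where "B = Abs_sym_mat ` C"
  have rep: "mat_of (Abs_sym_mat u) = u" if "u \<in> C" for u
    using Abs_sym_mat_inverse C(1) that by blast
  have orth: "inner u v = (if u = v then 1 else 0)" if "u \<in> C" "v \<in> C" for u v
    using that C(2,3) by (cases "u = v") (simp_all add: pairwise_def orthogonal_def norm_eq_1)
  have on: "\<forall>u\<in>B. \<forall>v\<in>B. inner u v = (if u = v then 1 else 0)"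
  proof (intro ballI)
    fix u v
    assume "u \<in> B" "v \<in> B"
    then obtain a b where ab: "a \<in> C" "b \<in> C" "u = Abs_sym_mat a" "v = Abs_sym_mat b"
      unfolding B_def by blast
    then have "u = v \<longleftrightarrow> a = b" using rep by metis
    then show "inner u v = (if u = v then 1 else 0)"
      using ab orth by (simp add: inner_sym_mat.rep_eq rep)
  qed
  have z: "x = 0" if "\<forall>u\<in>B. inner x u = 0" for x :: "'n sym_mat"
  proof -
    have "\<And>u. u \<in> C \<Longrightarrow> orthogonal (mat_of x) u"
      using that rep unfolding B_def orthogonal_def by (auto simp: inner_sym_mat.rep_eq)
    moreover have "mat_of x \<in> span C" using C(6) mat_of by blast
    ultimately have "orthogonal (mat_of x) (mat_of x)"
      using orthogonal_to_span by blast
    then show ?thesis by (simp add: orthogonal_def flip: inner_sym_mat.rep_eq)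
  qed
  have "B \<noteq> {}"
  proof
    assume "B = {}"
    then have "C = {}" by (simp add: B_def)
    then have "?S = {0}" using C(6) by simp
    moreover have "mat 1 \<in> ?S" by (simp add: transpose_mat)
    ultimately have "(mat 1 :: real^'n^'n) = 0" by blast
    then show False by (simp add: vec_eq_iff mat_def) (metis zero_neq_one)
  qed
  moreover have "finite B" using fin by (simp add: B_def)
  ultimately show ?thesis using on z by (intro exI[of _ B] conjI) (assumption, assumption, assumption, metis inner_zero_left)
qed

instantiation sym_mat :: (finite) euclidean_space
begin

definition "Basis = (SOME B :: 'a sym_mat set. B \<noteq> {} \<and> finite B
     \<and> (\<forall>u\<in>B. \<forall>v\<in>B. inner u v = (if u = v then 1 else 0))
     \<and> (\<forall>x. (\<forall>u\<in>B. inner x u = 0) \<longleftrightarrow> x = 0))"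

instance
  using someI_ex[OF ex_orthonormal_basis_symmetric[where 'n='a]]
  unfolding Basis_sym_mat_def[symmetric]
  by intro_classes auto

end


section \<open>The orthogonal action and its orbit space\<close>

lift_definition act :: "real^'n^'n \<Rightarrow> 'n::finite sym_mat \<Rightarrow> 'n sym_mat"
  is "\<lambda>P S. P ** S ** transpose P"
  by (simp add: matrix_transpose_mul matrix_mul_assoc transpose_transpose)

definition orbit :: "'n::finite sym_mat \<Rightarrow> 'n sym_mat set" where
  "orbit S = {act P S | P. orthogonal_matrix P}"

definition orbit_space :: "'n::finite sym_mat set set" where
  "orbit_space = range orbit"


section \<open>Ordered multiplicities\<close>

definition eigenspace :: "'n::finite sym_mat \<Rightarrow> real \<Rightarrow> (real^'n) set" where
  "eigenspace S l = {v. mat_of S *v v = l *\<^sub>R v}"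

definition eigenvalues :: "'n::finite sym_mat \<Rightarrow> real set" where
  "eigenvalues S = {l. \<exists>v\<in>eigenspace S l. v \<noteq> 0}"

text \<open>Geometric and algebraic multiplicities agree for symmetric matrices. Equality of the
  lists below includes equality of the numbers of distinct eigenvalues.\<close>

definition ordered_multiplicities_of :: "'n::finite sym_mat \<Rightarrow> nat list" where
  "ordered_multiplicities_of S =
     map (\<lambda>l. dim (eigenspace S l)) (sorted_list_of_set (eigenvalues S))"

definition ordered_multiplicities :: "'n::finite sym_mat set \<Rightarrow> nat list" where
  "ordered_multiplicities Q = the_elem (ordered_multiplicities_of ` Q)"

lemma finite_eigenvalues: "finite (eigenvalues S)"
proof -
  have "\<exists>f. \<forall>l\<in>eigenvalues S. f l \<in> eigenspace S l \<and> f l \<noteq> 0"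
    unfolding eigenvalues_def by (intro bchoice) auto
  then obtain f where f: "\<And>l. l \<in> eigenvalues S \<Longrightarrow> f l \<in> eigenspace S l"
      "\<And>l. l \<in> eigenvalues S \<Longrightarrow> f l \<noteq> 0"
    by blast
  have sym: "transpose (mat_of S) = mat_of S" using mat_of by blast
  have orth: "inner (f l) (f m) = 0" if lm: "l \<in> eigenvalues S" "m \<in> eigenvalues S" "l \<noteq> m" for l m
  proof -
    have "l * inner (f l) (f m) = inner (mat_of S *v f l) (f m)"
      using f(1)[OF lm(1)] by (simp add: eigenspace_def)
    also have "\<dots> = inner (f l) (mat_of S *v f m)"
      by (metis dot_lmul_matrix sym transpose_matrix_vector)
    also have "\<dots> = m * inner (f l) (f m)"
      using f(1)[OF lm(2)] by (simp add: eigenspace_def)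
    finally show ?thesis using lm(3) by simp
  qed
  have inj: "inj_on f (eigenvalues S)"
    by (rule inj_onI) (metis orth f(2) inner_eq_zero_iff)
  have "pairwise orthogonal (f ` eigenvalues S)"
    unfolding pairwise_def orthogonal_def using orth by auto
  then have "independent (f ` eigenvalues S)"
    by (rule pairwise_orthogonal_independent) (use f(2) in auto)
  then show ?thesis
    using independent_imp_finite inj finite_imageD by blast
qed


section \<open>Equivariant smooth vector fields\<close>

text \<open>Iterated directional derivatives: \<open>iter_deriv f [v\<^sub>1, \<dots>, v\<^sub>r]\<close> is
  \<open>\<partial>\<^bsub>v\<^sub>1\<^esub> \<dots> \<partial>\<^bsub>v\<^sub>r\<^esub> f\<close>. They are the values of the multilinear higher
  derivatives of \<open>f\<close>.\<close>

primrec iter_deriv ::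
    "('a::real_normed_vector \<Rightarrow> 'b::real_normed_vector) \<Rightarrow> 'a list \<Rightarrow> 'a \<Rightarrow> 'b" where
  "iter_deriv f [] = f"
| "iter_deriv f (v # vs) = (\<lambda>x. frechet_derivative (iter_deriv f vs) (at x) v)"

definition smooth :: "('a::euclidean_space \<Rightarrow> 'b::euclidean_space) \<Rightarrow> bool" where
  "smooth f \<longleftrightarrow> (\<forall>vs x. iter_deriv f vs differentiable (at x))"

definition pushforward ::
    "('a::real_normed_vector \<Rightarrow> 'b::real_normed_vector) \<Rightarrow> ('a \<Rightarrow> 'a) \<Rightarrow> 'b \<Rightarrow> 'b" where
  "pushforward \<phi> V y = frechet_derivative \<phi> (at (inv \<phi> y)) (V (inv \<phi> y))"

definition equivariant :: "('n::finite sym_mat \<Rightarrow> 'n sym_mat) \<Rightarrow> bool" where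
  "equivariant V \<longleftrightarrow> (\<forall>P. orthogonal_matrix P \<longrightarrow> pushforward (act P) V = V)"

definition equivariant_fields :: "('n::finite sym_mat \<Rightarrow> 'n sym_mat) set" where
  "equivariant_fields = {V. smooth V \<and> equivariant V}"

text \<open>The topology of uniform convergence of all derivatives on compact sets is generated by
  the balls of the seminorms \<open>sup\<^bsub>x \<in> K\<^esub> \<parallel>\<partial>\<^bsub>vs\<^esub> V x\<parallel>\<close>, with \<open>K\<close> compact and \<open>vs\<close> a list
  of directions.\<close>

definition smooth_topology :: "('n::finite sym_mat \<Rightarrow> 'n sym_mat) topology" where
  "smooth_topology = topology_generated_by
     {{V \<in> equivariant_fields. \<forall>x\<in>K. norm (iter_deriv V vs x - iter_deriv U vs x) < e}
      | U K vs e. U \<in> equivariant_fields \<and> compact K \<and> e > (0::real)}"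

lemma topspace_smooth_topology:
  "topspace (smooth_topology :: ('n::finite sym_mat \<Rightarrow> 'n sym_mat) topology) = equivariant_fields"
proof -
  have "V \<in> topspace smooth_topology" if V: "V \<in> equivariant_fields" for V :: "'n sym_mat \<Rightarrow> 'n sym_mat"
  proof -
    have "openin smooth_topology {V' \<in> equivariant_fields.
        \<forall>x\<in>{}. norm (iter_deriv V' [] x - iter_deriv V [] x) < 1}"
      unfolding smooth_topology_def using V
      by (intro topology_generated_by_Basis CollectI)
        (rule exI[of _ V], rule exI[of _ "{}"], rule exI[of _ "[]"], rule exI[of _ 1], simp)
    then show ?thesis using V openin_subset by blast
  qed
  moreover have "topspace smooth_topology \<subseteq> (equivariant_fields :: ('n sym_mat \<Rightarrow> 'n sym_mat) set)"
    unfolding smooth_topology_def topology_generated_by_topspace by blast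
  ultimately show ?thesis by blast
qed


section \<open>Vector fields on the orbit space\<close>

text \<open>A function on the orbit space is smooth if it pulls back to a smooth (invariant)
  function on the symmetric matrices. A vector field on the orbit space is a derivation of
  these functions; the one induced by an equivariant field \<open>V\<close> sends \<open>f\<close> to the
  derivative of \<open>f\<close> along \<open>V\<close>, which is the same at all representatives.\<close>

definition smooth_orbit_functions :: "('n::finite sym_mat set \<Rightarrow> real) set" where
  "smooth_orbit_functions = {f \<in> extensional orbit_space. smooth (f \<circ> orbit)}"

type_synonym 'n orbit_field = "('n sym_mat set \<Rightarrow> real) \<Rightarrow> 'n sym_mat set \<Rightarrow> real"

definition induced_field :: "('n::finite sym_mat \<Rightarrow> 'n sym_mat) \<Rightarrow> 'n orbit_field" where
  "induced_field V = (\<lambda>f\<in>smooth_orbit_functions. \<lambda>Q\<in>orbit_space.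
     the_elem ((\<lambda>S. frechet_derivative (f \<circ> orbit) (at S) (V S)) ` Q))"

definition induced_fields :: "'n::finite orbit_field set" where
  "induced_fields = induced_field ` equivariant_fields"

definition quotient_topology :: "'a topology \<Rightarrow> ('a \<Rightarrow> 'b) \<Rightarrow> 'b topology" where
  "quotient_topology T f =
     topology (\<lambda>U. U \<subseteq> f ` topspace T \<and> openin T {x \<in> topspace T. f x \<in> U})"

lemma openin_quotient_topology:
  "openin (quotient_topology T f) U \<longleftrightarrow>
     U \<subseteq> f ` topspace T \<and> openin T {x \<in> topspace T. f x \<in> U}"
proof -
  have "istopology (\<lambda>U. U \<subseteq> f ` topspace T \<and> openin T {x \<in> topspace T. f x \<in> U})"
    unfolding istopology_def
  proof (intro conjI allI impI)
    fix U U'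
    assume *: "U \<subseteq> f ` topspace T \<and> openin T {x \<in> topspace T. f x \<in> U}"
      "U' \<subseteq> f ` topspace T \<and> openin T {x \<in> topspace T. f x \<in> U'}"
    have "{x \<in> topspace T. f x \<in> U \<inter> U'} = {x \<in> topspace T. f x \<in> U} \<inter> {x \<in> topspace T. f x \<in> U'}"
      by auto
    with * show "openin T {x \<in> topspace T. f x \<in> U \<inter> U'}" by (simp add: openin_Int)
  next
    fix \<U>
    assume *: "\<forall>U\<in>\<U>. U \<subseteq> f ` topspace T \<and> openin T {x \<in> topspace T. f x \<in> U}"
    have "{x \<in> topspace T. f x \<in> \<Union>\<U>} = (\<Union>U\<in>\<U>. {x \<in> topspace T. f x \<in> U})" by auto
    with * show "openin T {x \<in> topspace T. f x \<in> \<Union>\<U>}" by auto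
  qed auto
  then show ?thesis by (simp add: quotient_topology_def topology_inverse')
qed

lemma topspace_quotient_topology: "topspace (quotient_topology T f) = f ` topspace T"
proof (rule subset_antisym)
  show "topspace (quotient_topology T f) \<subseteq> f ` topspace T"
    by (metis openin_quotient_topology openin_topspace)
  have "{x \<in> topspace T. f x \<in> f ` topspace T} = topspace T" by auto
  then show "f ` topspace T \<subseteq> topspace (quotient_topology T f)"
    by (intro openin_subset) (simp add: openin_quotient_topology)
qed

lemma quotient_map_quotient_topology: "quotient_map T (quotient_topology T f) f"
  by (auto simp: quotient_map_def topspace_quotient_topology openin_quotient_topology)

definition induced_fields_topology :: "'n::finite orbit_field topology" where
  "induced_fields_topology = quotient_topology smooth_topology induced_field"

lemma topspace_induced_fields_topology: "topspace induced_fields_topology = induced_fields"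
  by (simp add: induced_fields_topology_def topspace_quotient_topology
      topspace_smooth_topology induced_fields_def)

definition residual_in :: "'a topology \<Rightarrow> 'a set \<Rightarrow> bool" where
  "residual_in T R \<longleftrightarrow> R \<subseteq> topspace T \<and>
     (\<exists>\<U>. countable \<U> \<and> (\<forall>U\<in>\<U>. openin T U \<and> T closure_of U = topspace T) \<and>
          topspace T \<inter> \<Inter>\<U> \<subseteq> R)"


section \<open>Flows\<close>

text \<open>Vector fields need not be complete, so flows are partial maps. Negative times are
  covered by \<^const>\<open>closed_segment\<close>.\<close>

definition integral_curve ::
    "('a::real_normed_vector \<Rightarrow> 'a) \<Rightarrow> real \<Rightarrow> (real \<Rightarrow> 'a) \<Rightarrow> bool" where
  "integral_curve V t \<gamma> \<longleftrightarrow> (\<forall>s\<in>closed_segment 0 t.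
     (\<gamma> has_vector_derivative V (\<gamma> s)) (at s within closed_segment 0 t))"

definition flow :: "('a::real_normed_vector \<Rightarrow> 'a) \<Rightarrow> real \<Rightarrow> 'a \<rightharpoonup> 'a" where
  "flow V t x =
     (if \<exists>\<gamma>. integral_curve V t \<gamma> \<and> \<gamma> 0 = x
      then Some (the_elem {\<gamma> t | \<gamma>. integral_curve V t \<gamma> \<and> \<gamma> 0 = x})
      else None)"

text \<open>The value below depends neither on the equivariant field \<open>V\<close> inducing \<open>X\<close> nor on the
  representative \<open>S\<close> of the orbit \<open>Q\<close>.\<close>

definition orbit_flow ::
    "'n::finite orbit_field \<Rightarrow> real \<Rightarrow> 'n sym_mat set \<rightharpoonup> 'n sym_mat set" where
  "orbit_flow X t Q = the_elem {map_option orbit (flow V t S) | V S.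
     V \<in> equivariant_fields \<and> induced_field V = X \<and> S \<in> Q}"

end

(* An equivariant field maps diagonal matrices to diagonal matrices, so on a stratum with prescribed
   blocks of equal eigenvalues it becomes a field u on a convex open set of eigenvalue vectors.
   Let u and v come from the first two fields.  If the iterated brackets [u,[u,...,[u,v]]] span at a
   point a, then so do the vectors obtained by transporting v back to a along the trajectory of u;
   composing the corresponding conjugated flows gives a map whose derivative at 0 is onto, so a
   neighbourhood of a is reachable, and connectedness of the stratum does the rest.

   Generically u and v have no common zero, the brackets span wherever u is nonzero, and they span
   with the roles of u and v exchanged wherever v is nonzero.  On compact pieces of a stratum these
   conditions are open.  They are dense because, inside a suitable finite-dimensional family of
   perturbations, the bad parameters form a smooth image of a space of smaller dimension: for the
   bracket condition the perturbing fields are f^b Z with f(a) = 0 and u f(a) nonzero, whose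
   brackets at a form an invertible triangular matrix. *)

theory Submission
  imports Defs "HOL-Computational_Algebra.Polynomial"
begin

section \<open>Calculus of smooth maps\<close>

text \<open>For fixed u, the pairing of a covector p with the j-th iterated bracket of v at y is
  linear in v, so only v is perturbed. The orders j = 0, ..., 2n and equally many perturbing fields
  give a square linear system for the parameters q. Where its determinant is nonzero, Cramer's rule
  makes q a differentiable function of (y, p), which ranges over a space of dimension 2n; hence the
  bad q are negligible in dimension 2n + 1. The neighbourhood on which this works depends on u but
  not on v, so finitely many of them cover a compact piece. The argument needs u f nonzero and says
  nothing at zeros of u; this is why the roles are exchanged there and common zeros are excluded
  separately. Traces of powers determine an equivariant field, so passing to induced fields is a
  homeomorphism and all genericity can be proved for equivariant fields. Fields may be incomplete,
  so only short flows are used. The map assembled from them is known to be continuous with a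
  derivative at 0, which is the setting of Sussmann's open mapping theorem.\<close>

definition dir_deriv ::
    "'a::real_normed_vector \<Rightarrow> ('a \<Rightarrow> 'b::real_normed_vector) \<Rightarrow> 'a \<Rightarrow> 'b" where
  "dir_deriv v f = (\<lambda>x. frechet_derivative f (at x) v)"

text \<open>The head of the list is the outermost derivative, so a direction appended at the end is
  differentiated first. Inductions can then lower the order by replacing the function with its
  directional derivative.\<close>

lemma iter_deriv_snoc: "iter_deriv f (vs @ [v]) = iter_deriv (dir_deriv v f) vs"
  by (induction vs) (auto simp: dir_deriv_def)

text \<open>The Leibniz rule returns the factors together with their derivatives, so closure under
  products does not follow by induction on a list of directions. The order bound serves as the
  induction parameter instead.\<close>

definition smooth_upto :: "nat \<Rightarrow> ('a::euclidean_space \<Rightarrow> 'b::euclidean_space) \<Rightarrow> bool" where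
  "smooth_upto n f \<longleftrightarrow> (\<forall>vs x. length vs \<le> n \<longrightarrow> iter_deriv f vs differentiable (at x))"

lemma smooth_upto_0: "smooth_upto 0 f \<longleftrightarrow> (\<forall>x. f differentiable (at x))"
  by (auto simp: smooth_upto_def)

lemma smooth_upto_Suc:
  "smooth_upto (Suc n) f \<longleftrightarrow>
     (\<forall>x. f differentiable (at x)) \<and> (\<forall>v. smooth_upto n (dir_deriv v f))"
proof
  assume L: "smooth_upto (Suc n) f"
  have "f differentiable (at x)" for x
    using L[unfolded smooth_upto_def, rule_format, of "[]"] by simp
  moreover have "iter_deriv (dir_deriv v f) vs differentiable (at x)" if "length vs \<le> n" for v vs x
    using L[unfolded smooth_upto_def, rule_format, of "vs @ [v]"] that by (simp add: iter_deriv_snoc)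
  ultimately show "(\<forall>x. f differentiable (at x)) \<and> (\<forall>v. smooth_upto n (dir_deriv v f))"
    by (simp add: smooth_upto_def)
next
  assume R: "(\<forall>x. f differentiable (at x)) \<and> (\<forall>v. smooth_upto n (dir_deriv v f))"
  have "iter_deriv f vs differentiable (at x)" if "length vs \<le> Suc n" for vs x
  proof (cases vs rule: rev_cases)
    case Nil
    then show ?thesis using R by simp
  next
    case (snoc ws v)
    then show ?thesis using R that by (simp add: iter_deriv_snoc smooth_upto_def)
  qed
  then show "smooth_upto (Suc n) f" by (simp add: smooth_upto_def)
qed

lemma smooth_iff_upto: "smooth f \<longleftrightarrow> (\<forall>n. smooth_upto n f)"
  by (auto simp: smooth_def smooth_upto_def)

lemma smooth_upto_mono: "smooth_upto n f \<Longrightarrow> m \<le> n \<Longrightarrow> smooth_upto m f"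
  by (auto simp: smooth_upto_def)

lemma smooth_upto_differentiable: "smooth_upto n f \<Longrightarrow> f differentiable (at x)"
  by (metis smooth_upto_0 smooth_upto_mono zero_le)

lemma smooth_differentiable: "smooth f \<Longrightarrow> f differentiable (at x)"
  by (simp add: smooth_iff_upto smooth_upto_differentiable[of 0])

lemma smooth_has_derivative: "smooth f \<Longrightarrow> (f has_derivative frechet_derivative f (at x)) (at x)"
  using smooth_differentiable frechet_derivative_works by blast

lemma smooth_dir_deriv: "smooth f \<Longrightarrow> smooth (dir_deriv v f)"
  by (metis smooth_iff_upto smooth_upto_Suc)

lemma smooth_continuous_on: "smooth f \<Longrightarrow> continuous_on S f"
  by (intro continuous_at_imp_continuous_on ballI differentiable_imp_continuous_within
      smooth_differentiable)

lemma smooth_iter_deriv: "smooth f \<Longrightarrow> smooth (iter_deriv f vs)"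
proof (induction vs)
  case (Cons v vs)
  then show ?case using smooth_dir_deriv[of "iter_deriv f vs" v] by (simp add: dir_deriv_def)
qed simp

lemma smooth_const:
  fixes c :: "'b::euclidean_space"
  shows "smooth (\<lambda>x::'a::euclidean_space. c)"
proof -
  have "iter_deriv (\<lambda>x::'a. c) vs = (\<lambda>x. if vs = [] then c else 0)" for vs
    by (induction vs) auto
  then show ?thesis by (simp add: smooth_def)
qed

lemma dir_deriv_linear: "linear l \<Longrightarrow> dir_deriv v l = (\<lambda>x. l v)"
  for l :: "'a::euclidean_space \<Rightarrow> 'b::real_normed_vector"
  unfolding dir_deriv_def using frechet_derivative_at[OF linear_imp_has_derivative] by metis

lemma smooth_linear:
  fixes l :: "'a::euclidean_space \<Rightarrow> 'b::euclidean_space"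
  assumes "linear l"
  shows "smooth l"
proof -
  have d: "l differentiable (at x)" for x
    using assms linear_imp_differentiable by blast
  have "smooth_upto n l" for n
    by (cases n) (use assms smooth_const in \<open>auto simp: smooth_upto_0 smooth_upto_Suc
        dir_deriv_linear smooth_iff_upto d\<close>)
  then show ?thesis by (simp add: smooth_iff_upto)
qed

lemma dir_deriv_add:
  assumes "\<And>x. f differentiable (at x)" "\<And>x. g differentiable (at x)"
  shows "dir_deriv v (\<lambda>x. f x + g x) = (\<lambda>x. dir_deriv v f x + dir_deriv v g x)"
proof
  fix x
  have "((\<lambda>x. f x + g x) has_derivative
      (\<lambda>h. frechet_derivative f (at x) h + frechet_derivative g (at x) h)) (at x)"
    using assms by (intro has_derivative_add) (simp_all add: frechet_derivative_works[symmetric])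
  then show "dir_deriv v (\<lambda>x. f x + g x) x = dir_deriv v f x + dir_deriv v g x"
    unfolding dir_deriv_def by (metis frechet_derivative_at)
qed

lemma smooth_upto_add:
  "smooth_upto n f \<Longrightarrow> smooth_upto n g \<Longrightarrow> smooth_upto n (\<lambda>x. f x + g x)"
proof (induction n arbitrary: f g)
  case (Suc n)
  have "\<And>x. f differentiable (at x)" "\<And>x. g differentiable (at x)"
    using Suc.prems by (auto simp: smooth_upto_Suc)
  then show ?case using Suc by (auto simp: smooth_upto_Suc dir_deriv_add)
qed (auto simp: smooth_upto_0)

lemma smooth_add: "smooth f \<Longrightarrow> smooth g \<Longrightarrow> smooth (\<lambda>x. f x + g x)"
  by (simp add: smooth_iff_upto smooth_upto_add)

lemma smooth_sum: "(\<And>i. i \<in> I \<Longrightarrow> smooth (f i)) \<Longrightarrow> smooth (\<lambda>x. \<Sum>i\<in>I. f i x)"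
  by (induction I rule: infinite_finite_induct) (simp_all add: smooth_const smooth_add)

lemma dir_deriv_bilinear:
  assumes "bounded_bilinear b" "\<And>x. f differentiable (at x)" "\<And>x. g differentiable (at x)"
  shows "dir_deriv v (\<lambda>x. b (f x) (g x)) = (\<lambda>x. b (f x) (dir_deriv v g x) + b (dir_deriv v f x) (g x))"
proof
  fix x
  have "((\<lambda>x. b (f x) (g x)) has_derivative
      (\<lambda>h. b (f x) (frechet_derivative g (at x) h) + b (frechet_derivative f (at x) h) (g x))) (at x)"
    using assms by (intro bounded_bilinear.FDERIV) (simp_all add: frechet_derivative_works[symmetric])
  then show "dir_deriv v (\<lambda>x. b (f x) (g x)) x = b (f x) (dir_deriv v g x) + b (dir_deriv v f x) (g x)"
    unfolding dir_deriv_def by (metis frechet_derivative_at)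
qed

lemma differentiable_bilinear:
  assumes "bounded_bilinear b" "f differentiable (at x)" "g differentiable (at x)"
  shows "(\<lambda>x. b (f x) (g x)) differentiable (at x)"
  using bounded_bilinear.FDERIV[OF assms(1)] assms(2,3) unfolding differentiable_def by blast

lemma smooth_upto_bilinear:
  assumes "bounded_bilinear b"
  shows "smooth_upto n f \<Longrightarrow> smooth_upto n g \<Longrightarrow> smooth_upto n (\<lambda>x. b (f x) (g x))"
proof (induction n arbitrary: f g)
  case 0
  then show ?case using assms by (auto simp: smooth_upto_0 intro: differentiable_bilinear)
next
  case (Suc n)
  have d: "\<And>x. f differentiable (at x)" "\<And>x. g differentiable (at x)"
    using Suc.prems by (auto simp: smooth_upto_Suc)
  have m: "smooth_upto n f" "smooth_upto n g"
    using Suc.prems smooth_upto_mono le_Suc_eq by blast+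
  have "smooth_upto n (dir_deriv v (\<lambda>x. b (f x) (g x)))" for v
    unfolding dir_deriv_bilinear[OF assms d]
    using Suc.prems m by (intro smooth_upto_add Suc.IH) (auto simp: smooth_upto_Suc)
  then show ?case using d assms by (auto simp: smooth_upto_Suc intro: differentiable_bilinear)
qed

lemma smooth_bilinear:
  assumes "bounded_bilinear b" "smooth f" "smooth g"
  shows "smooth (\<lambda>x. b (f x) (g x))"
  using assms by (simp add: smooth_iff_upto smooth_upto_bilinear)

text \<open>A linear inner map only transports the directions, so the chain rule has a closed form
  at every order.\<close>

lemma iter_deriv_linear_comp:
  fixes f :: "'a::euclidean_space \<Rightarrow> 'b::euclidean_space"
    and m :: "'c::euclidean_space \<Rightarrow> 'a" and l :: "'b \<Rightarrow> 'd::euclidean_space"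
  assumes "linear l" "linear m" "smooth f"
  shows "iter_deriv (\<lambda>x. l (f (m x))) vs = (\<lambda>x. l (iter_deriv f (map m vs) (m x)))"
proof (induction vs)
  case (Cons v vs)
  let ?g = "iter_deriv f (map m vs)"
  show ?case
  proof
    fix x
    have "(?g has_derivative frechet_derivative ?g (at (m x))) (at (m x))"
      using smooth_iter_deriv[OF assms(3)] smooth_has_derivative by blast
    then have "((\<lambda>x. ?g (m x)) has_derivative (\<lambda>h. frechet_derivative ?g (at (m x)) (m h))) (at x)"
      using has_derivative_compose[OF linear_imp_has_derivative[OF assms(2), of "at x"]]
      by blast
    then have "((\<lambda>x. l (?g (m x))) has_derivative (\<lambda>h. l (frechet_derivative ?g (at (m x)) (m h)))) (at x)"
      using assms(1) by (metis linear_linear bounded_linear.has_derivative)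
    then show "iter_deriv (\<lambda>x. l (f (m x))) (v # vs) x = l (iter_deriv f (map m (v # vs)) (m x))"
      using Cons.IH by (simp add: frechet_derivative_at[symmetric])
  qed
qed simp

lemma smooth_linear_comp:
  fixes f :: "'a::euclidean_space \<Rightarrow> 'b::euclidean_space"
    and m :: "'c::euclidean_space \<Rightarrow> 'a" and l :: "'b \<Rightarrow> 'd::euclidean_space"
  assumes "linear l" "linear m" "smooth f"
  shows "smooth (\<lambda>x. l (f (m x)))"
  unfolding smooth_def
proof (intro allI)
  fix vs x
  have "iter_deriv f (map m vs) differentiable (at (m x))"
    using assms(3) smooth_def by blast
  then have "(\<lambda>x. iter_deriv f (map m vs) (m x)) differentiable (at x)"
    using differentiable_compose[of "iter_deriv f (map m vs)" m x UNIV]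
      linear_imp_differentiable[OF assms(2)] by simp
  then have "(\<lambda>x. l (iter_deriv f (map m vs) (m x))) differentiable (at x)"
    using differentiable_compose[of l _ x UNIV] linear_imp_differentiable[OF assms(1)] by simp
  then show "iter_deriv (\<lambda>x. l (f (m x))) vs differentiable (at x)"
    by (simp add: iter_deriv_linear_comp[OF assms])
qed

lemma smooth_linear_post: "linear l \<Longrightarrow> smooth f \<Longrightarrow> smooth (\<lambda>x. l (f x))"
  for l :: "'b::euclidean_space \<Rightarrow> 'd::euclidean_space"
  using smooth_linear_comp[of l "\<lambda>x. x" f] by (simp add: linear_id[unfolded id_def])

lemma smooth_linear_pre: "linear m \<Longrightarrow> smooth f \<Longrightarrow> smooth (\<lambda>x. f (m x))"
  for m :: "'b::euclidean_space \<Rightarrow> 'd::euclidean_space"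
  using smooth_linear_comp[of "\<lambda>x. x" m f] by (simp add: linear_id[unfolded id_def])

lemma smooth_minus: "smooth f \<Longrightarrow> smooth (\<lambda>x. - f x)"
  by (rule smooth_linear_post) (auto simp: linear_iff)

lemma smooth_diff: "smooth f \<Longrightarrow> smooth g \<Longrightarrow> smooth (\<lambda>x. f x - g x)"
  using smooth_add[of f "\<lambda>x. - g x"] by (simp add: smooth_minus)

lemma smooth_scaleR: "smooth f \<Longrightarrow> smooth g \<Longrightarrow> smooth (\<lambda>x. f x *\<^sub>R g x)"
  by (rule smooth_bilinear[OF bounded_bilinear_scaleR])

lemma smooth_mult: "smooth f \<Longrightarrow> smooth g \<Longrightarrow> smooth (\<lambda>x. f x * g x :: real)"
  by (rule smooth_bilinear[OF bounded_bilinear_mult])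

lemma smooth_inner: "smooth f \<Longrightarrow> smooth g \<Longrightarrow> smooth (\<lambda>x. f x \<bullet> g x)"
  by (rule smooth_bilinear[OF bounded_bilinear_inner])

lemma smooth_power: "smooth f \<Longrightarrow> smooth (\<lambda>x. f x ^ n :: real)"
  by (induction n) (simp_all add: smooth_const smooth_mult)

lemma smooth_Pair:
  fixes f :: "'a::euclidean_space \<Rightarrow> 'b::euclidean_space" and g :: "'a \<Rightarrow> 'c::euclidean_space"
  assumes "smooth f" "smooth g"
  shows "smooth (\<lambda>x. (f x, g x))"
proof -
  have "smooth (\<lambda>x. (f x, 0::'c))" "smooth (\<lambda>x. (0::'b, g x))"
    by (rule smooth_linear_post[OF _ assms(1)], simp add: linear_iff,
        rule smooth_linear_post[OF _ assms(2)], simp add: linear_iff)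
  from smooth_add[OF this] show ?thesis by simp
qed

subsection \<open>Derivatives along vector fields and Lie brackets\<close>

definition deriv_along ::
    "('a::real_normed_vector \<Rightarrow> 'a) \<Rightarrow> ('a \<Rightarrow> 'b::real_normed_vector) \<Rightarrow> 'a \<Rightarrow> 'b" where
  "deriv_along X f = (\<lambda>x. frechet_derivative f (at x) (X x))"

text \<open>In a basis the derivative along a varying field is a sum of products; smoothness and
  convergence are then inherited from the closure rules.\<close>

lemma deriv_along_Basis:
  fixes f :: "'a::euclidean_space \<Rightarrow> 'b::euclidean_space"
  assumes "smooth f"
  shows "deriv_along X f = (\<lambda>x. \<Sum>b\<in>Basis. (X x \<bullet> b) *\<^sub>R dir_deriv b f x)"
proof
  fix x
  have l: "linear (frechet_derivative f (at x))"
    using smooth_has_derivative[OF assms] has_derivative_linear by blast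
  have "deriv_along X f x = frechet_derivative f (at x) (\<Sum>b\<in>Basis. (X x \<bullet> b) *\<^sub>R b)"
    by (simp add: deriv_along_def euclidean_representation)
  also have "\<dots> = (\<Sum>b\<in>Basis. (X x \<bullet> b) *\<^sub>R dir_deriv b f x)"
    by (simp add: linear_sum[OF l] linear_scale[OF l] dir_deriv_def)
  finally show "deriv_along X f x = \<dots>" .
qed

lemma smooth_deriv_along: "smooth f \<Longrightarrow> smooth X \<Longrightarrow> smooth (deriv_along X f)"
  by (auto simp: deriv_along_Basis intro!: smooth_sum smooth_scaleR smooth_inner smooth_const
      smooth_dir_deriv)

definition lie_bracket :: "('a::real_normed_vector \<Rightarrow> 'a) \<Rightarrow> ('a \<Rightarrow> 'a) \<Rightarrow> 'a \<Rightarrow> 'a" where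
  "lie_bracket X Y = (\<lambda>x. deriv_along X Y x - deriv_along Y X x)"

text \<open>The iterated adjoint action of \<open>X\<close> on \<open>Y\<close>. As \<open>Y\<close>
  enters once, the result is linear in \<open>Y\<close> for fixed \<open>X\<close>, which makes the
  later perturbation problem linear.\<close>

primrec iter_bracket ::
    "('a::real_normed_vector \<Rightarrow> 'a) \<Rightarrow> ('a \<Rightarrow> 'a) \<Rightarrow> nat \<Rightarrow> 'a \<Rightarrow> 'a" where
  "iter_bracket X Y 0 = Y"
| "iter_bracket X Y (Suc n) = lie_bracket X (iter_bracket X Y n)"

lemma smooth_lie_bracket: "smooth X \<Longrightarrow> smooth Y \<Longrightarrow> smooth (lie_bracket X Y)"
  unfolding lie_bracket_def by (intro smooth_diff smooth_deriv_along)

lemma smooth_iter_bracket: "smooth X \<Longrightarrow> smooth Y \<Longrightarrow> smooth (iter_bracket X Y n)"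
  by (induction n) (simp_all add: smooth_lie_bracket)

lemma deriv_along_add:
  assumes "smooth f" "smooth g"
  shows "deriv_along X (\<lambda>x. f x + g x) = (\<lambda>x. deriv_along X f x + deriv_along X g x)"
proof
  fix x
  show "deriv_along X (\<lambda>x. f x + g x) x = deriv_along X f x + deriv_along X g x"
    using fun_cong[OF dir_deriv_add[of f g "X x"], of x] assms
    by (simp add: deriv_along_def dir_deriv_def smooth_differentiable)
qed

lemma deriv_along_scaleR:
  assumes "smooth f" "smooth g"
  shows "deriv_along X (\<lambda>x. f x *\<^sub>R g x) = (\<lambda>x. f x *\<^sub>R deriv_along X g x + deriv_along X f x *\<^sub>R g x)"
proof
  fix x
  show "deriv_along X (\<lambda>x. f x *\<^sub>R g x) x = f x *\<^sub>R deriv_along X g x + deriv_along X f x *\<^sub>R g x"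
    using fun_cong[OF dir_deriv_bilinear[OF bounded_bilinear_scaleR, of f g "X x"], of x] assms
    by (simp add: deriv_along_def dir_deriv_def smooth_differentiable)
qed

lemma deriv_along_field_scaleR:
  assumes "smooth f"
  shows "deriv_along (\<lambda>x. c x *\<^sub>R Y x) f = (\<lambda>x. c x *\<^sub>R deriv_along Y f x)"
    "deriv_along (\<lambda>x. Y x + Z x) f = (\<lambda>x. deriv_along Y f x + deriv_along Z f x)"
  using smooth_has_derivative[OF assms, THEN has_derivative_linear]
  by (auto simp: deriv_along_def linear_scale linear_add)

lemma lie_bracket_scaleR:
  assumes "smooth f" "smooth X" "smooth Y"
  shows "lie_bracket X (\<lambda>x. f x *\<^sub>R Y x) =
    (\<lambda>x. f x *\<^sub>R lie_bracket X Y x + deriv_along X f x *\<^sub>R Y x)"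
  using assms
  by (auto simp: lie_bracket_def deriv_along_scaleR deriv_along_field_scaleR algebra_simps)

lemma lie_bracket_add:
  assumes "smooth X" "smooth Y" "smooth Z"
  shows "lie_bracket X (\<lambda>x. Y x + Z x) = (\<lambda>x. lie_bracket X Y x + lie_bracket X Z x)"
  using assms by (auto simp: lie_bracket_def deriv_along_add deriv_along_field_scaleR algebra_simps)

lemma lie_bracket_cmult:
  assumes "smooth X" "smooth Y"
  shows "lie_bracket X (\<lambda>x. c *\<^sub>R Y x) = (\<lambda>x. c *\<^sub>R lie_bracket X Y x)"
  using lie_bracket_scaleR[OF smooth_const assms, of c]
  by (simp add: deriv_along_def)

lemma lie_bracket_zero: "smooth X \<Longrightarrow> lie_bracket X (\<lambda>x. 0) = (\<lambda>x. 0)"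
  using smooth_has_derivative[THEN has_derivative_linear, of X]
  by (auto simp: lie_bracket_def deriv_along_def linear_0)

lemma iter_bracket_add:
  assumes "smooth X" "smooth Y" "smooth Z"
  shows "iter_bracket X (\<lambda>x. Y x + Z x) n = (\<lambda>x. iter_bracket X Y n x + iter_bracket X Z n x)"
  by (induction n) (use assms in \<open>simp_all add: lie_bracket_add smooth_iter_bracket\<close>)

lemma iter_bracket_cmult:
  assumes "smooth X" "smooth Y"
  shows "iter_bracket X (\<lambda>x. c *\<^sub>R Y x) n = (\<lambda>x. c *\<^sub>R iter_bracket X Y n x)"
  by (induction n) (use assms in \<open>simp_all add: lie_bracket_cmult smooth_iter_bracket\<close>)

lemma iter_bracket_zero: "smooth X \<Longrightarrow> iter_bracket X (\<lambda>x. 0) n = (\<lambda>x. 0)"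
  by (induction n) (simp_all add: lie_bracket_zero)

lemma iter_bracket_sum:
  assumes "smooth X" "\<And>i. i \<in> I \<Longrightarrow> smooth (Y i)"
  shows "iter_bracket X (\<lambda>x. \<Sum>i\<in>I. c i *\<^sub>R Y i x) n = (\<lambda>x. \<Sum>i\<in>I. c i *\<^sub>R iter_bracket X (Y i) n x)"
  using assms(2)
  by (induction I rule: infinite_finite_induct)
    (simp_all add: assms(1) iter_bracket_zero iter_bracket_add iter_bracket_cmult
      smooth_sum smooth_scaleR smooth_const)

lemma deriv_along_power:
  assumes "smooth f"
  shows "deriv_along X (\<lambda>x. f x ^ Suc d :: real) = (\<lambda>x. real (Suc d) * f x ^ d * deriv_along X f x)"
proof
  fix x
  have "((\<lambda>x. f x ^ Suc d) has_derivative
      (\<lambda>y. real (Suc d) * frechet_derivative f (at x) y * f x ^ d)) (at x)"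
    using has_derivative_power[OF smooth_has_derivative[OF assms, of x], where n="Suc d"]
    by (simp add: mult_ac)
  then show "deriv_along X (\<lambda>x. f x ^ Suc d) x = real (Suc d) * f x ^ d * deriv_along X f x"
    unfolding deriv_along_def by (subst frechet_derivative_at[symmetric]) (simp_all add: mult_ac)
qed

text \<open>Only the terms in which every factor of \<open>f ^ b\<close> is differentiated survive at a zero of \<open>f\<close>.\<close>

lemma iter_bracket_power_scaleR:
  assumes "smooth f" "smooth X" "smooth Y"
  shows "\<exists>h c. smooth h \<and> c > 0 \<and> (\<forall>x. f x = 0 \<longrightarrow> h x = (c * deriv_along X f x ^ j) *\<^sub>R Y x) \<and>
     iter_bracket X (\<lambda>x. f x ^ (j + d) *\<^sub>R Y x) j = (\<lambda>x. f x ^ d *\<^sub>R h x)"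
proof (induction j arbitrary: d)
  case 0
  show ?case using assms by (intro exI[of _ Y] exI[of _ 1]) simp
next
  case (Suc j)
  \<comment> \<open>One more spare power of \<open>f\<close> is carried along, because the outer
    bracket uses one up.\<close>
  obtain h c where h: "smooth h" "c > 0"
    "\<And>x. f x = 0 \<Longrightarrow> h x = (c * deriv_along X f x ^ j) *\<^sub>R Y x"
    "iter_bracket X (\<lambda>x. f x ^ (j + Suc d) *\<^sub>R Y x) j = (\<lambda>x. f x ^ Suc d *\<^sub>R h x)"
    using Suc.IH[of "Suc d"] by blast
  let ?g = "\<lambda>x. f x *\<^sub>R lie_bracket X h x + (real (Suc d) * deriv_along X f x) *\<^sub>R h x"
  have "smooth ?g"
    using assms h(1)
    by (intro smooth_add smooth_scaleR smooth_lie_bracket smooth_mult smooth_const smooth_deriv_along)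
  moreover have "?g x = ((real (Suc d) * c) * deriv_along X f x ^ Suc j) *\<^sub>R Y x" if "f x = 0" for x
    using that h(3)[OF that] by simp
  moreover have "iter_bracket X (\<lambda>x. f x ^ (Suc j + d) *\<^sub>R Y x) (Suc j) = (\<lambda>x. f x ^ d *\<^sub>R ?g x)"
  proof -
    have "iter_bracket X (\<lambda>x. f x ^ (Suc j + d) *\<^sub>R Y x) (Suc j) =
        lie_bracket X (\<lambda>x. f x ^ Suc d *\<^sub>R h x)"
      using h(4) by simp
    also have "\<dots> = (\<lambda>x. f x ^ Suc d *\<^sub>R lie_bracket X h x +
        (real (Suc d) * f x ^ d * deriv_along X f x) *\<^sub>R h x)"
      by (subst lie_bracket_scaleR[OF smooth_power[OF assms(1)] assms(2) h(1)],
          subst deriv_along_power[OF assms(1)]) simp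
    also have "\<dots> = (\<lambda>x. f x ^ d *\<^sub>R ?g x)"
      by (auto simp: algebra_simps)
    finally show ?thesis .
  qed
  moreover have "real (Suc d) * c > 0" using h(2) by simp
  ultimately show ?case by blast
qed

section \<open>Locally uniform convergence of all derivatives\<close>

text \<open>With an arbitrary filter, the neighbourhood filter of a field or of a pair of fields can
  serve as the index. Smoothness of \<open>f i\<close> is asked only eventually, since membership in
  a neighbourhood is an eventual property.\<close>

definition smooth_lim_upto ::
    "nat \<Rightarrow> 'i filter \<Rightarrow> ('i \<Rightarrow> 'a::euclidean_space \<Rightarrow> 'b::euclidean_space) \<Rightarrow> ('a \<Rightarrow> 'b) \<Rightarrow> bool" where
  "smooth_lim_upto n F f g \<longleftrightarrow> smooth g \<and> (\<forall>\<^sub>F i in F. smooth (f i)) \<and>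
     (\<forall>vs K. length vs \<le> n \<longrightarrow> compact K \<longrightarrow>
       uniform_limit K (\<lambda>i. iter_deriv (f i) vs) (iter_deriv g vs) F)"

definition smooth_lim ::
    "'i filter \<Rightarrow> ('i \<Rightarrow> 'a::euclidean_space \<Rightarrow> 'b::euclidean_space) \<Rightarrow> ('a \<Rightarrow> 'b) \<Rightarrow> bool" where
  "smooth_lim F f g \<longleftrightarrow> (\<forall>n. smooth_lim_upto n F f g)"

lemma smooth_lim_uptoD:
  assumes "smooth_lim_upto n F f g"
  shows "smooth g" "\<forall>\<^sub>F i in F. smooth (f i)" "compact K \<Longrightarrow> uniform_limit K f g F"
proof -
  show "smooth g" "\<forall>\<^sub>F i in F. smooth (f i)"
    using assms by (simp_all add: smooth_lim_upto_def)
  show "uniform_limit K f g F" if "compact K"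
    using assms[unfolded smooth_lim_upto_def, THEN conjunct2, THEN conjunct2, rule_format, of "[]" K] that
    by simp
qed

lemma smooth_lim_upto_Suc:
  "smooth_lim_upto (Suc n) F f g \<longleftrightarrow> smooth_lim_upto 0 F f g \<and>
     (\<forall>v. smooth_lim_upto n F (\<lambda>i. dir_deriv v (f i)) (dir_deriv v g))"
proof
  assume L: "smooth_lim_upto (Suc n) F f g"
  have "uniform_limit K (\<lambda>i. iter_deriv (dir_deriv v (f i)) vs) (iter_deriv (dir_deriv v g) vs) F"
    if "length vs \<le> n" "compact K" for v vs K
    using L[unfolded smooth_lim_upto_def, THEN conjunct2, THEN conjunct2, rule_format, of "vs @ [v]" K] that
    by (simp add: iter_deriv_snoc)
  then show "smooth_lim_upto 0 F f g \<and>
     (\<forall>v. smooth_lim_upto n F (\<lambda>i. dir_deriv v (f i)) (dir_deriv v g))"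
    using L smooth_lim_uptoD(3)[OF L]
    by (auto simp: smooth_lim_upto_def smooth_dir_deriv elim: eventually_mono)
next
  assume R: "smooth_lim_upto 0 F f g \<and>
     (\<forall>v. smooth_lim_upto n F (\<lambda>i. dir_deriv v (f i)) (dir_deriv v g))"
  have "uniform_limit K (\<lambda>i. iter_deriv (f i) vs) (iter_deriv g vs) F"
    if "length vs \<le> Suc n" "compact K" for vs K
  proof (cases vs rule: rev_cases)
    case Nil
    then show ?thesis using smooth_lim_uptoD(3)[OF R[THEN conjunct1] that(2)] by simp
  next
    case (snoc ws v)
    then show ?thesis using R that by (simp add: iter_deriv_snoc smooth_lim_upto_def)
  qed
  then show "smooth_lim_upto (Suc n) F f g" using R by (simp add: smooth_lim_upto_def)
qed

lemma smooth_lim_upto_0I: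
  assumes "smooth g" "\<forall>\<^sub>F i in F. smooth (f i)" "\<And>K. compact K \<Longrightarrow> uniform_limit K f g F"
  shows "smooth_lim_upto 0 F f g"
  using assms by (simp add: smooth_lim_upto_def)

lemma smooth_lim_upto_SucD:
  assumes "smooth_lim_upto (Suc n) F f g"
  shows "smooth_lim_upto n F f g" "smooth_lim_upto n F (\<lambda>i. dir_deriv v (f i)) (dir_deriv v g)"
proof -
  show "smooth_lim_upto n F f g" using assms by (auto simp: smooth_lim_upto_def)
  show "smooth_lim_upto n F (\<lambda>i. dir_deriv v (f i)) (dir_deriv v g)"
    using assms smooth_lim_upto_Suc by blast
qed

lemma smooth_lim_upto_cong:
  assumes "smooth_lim_upto n F f g" "\<forall>\<^sub>F i in F. f i = f' i" "g = g'"
  shows "smooth_lim_upto n F f' g'"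
proof -
  have "uniform_limit K (\<lambda>i. iter_deriv (f i) vs) (iter_deriv g vs) F \<longleftrightarrow>
      uniform_limit K (\<lambda>i. iter_deriv (f' i) vs) (iter_deriv g' vs) F" for K vs
    using assms(2,3) by (intro uniform_limit_cong) (auto elim: eventually_mono)
  moreover have "\<forall>\<^sub>F i in F. smooth (f' i)"
    using smooth_lim_uptoD(2)[OF assms(1)] assms(2) by eventually_elim simp
  ultimately show ?thesis using assms by (simp add: smooth_lim_upto_def)
qed

lemma smooth_limD:
  assumes "smooth_lim F f g"
  shows "smooth g" "\<forall>\<^sub>F i in F. smooth (f i)" "compact K \<Longrightarrow> uniform_limit K f g F"
  using smooth_lim_uptoD[OF assms[unfolded smooth_lim_def, rule_format, of 0]] by simp_all

lemma smooth_lim_const: "smooth g \<Longrightarrow> smooth_lim F (\<lambda>i. g) g"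
  by (auto simp: smooth_lim_def smooth_lim_upto_def uniform_limit_const)

lemma smooth_lim_dir_deriv: "smooth_lim F f g \<Longrightarrow> smooth_lim F (\<lambda>i. dir_deriv v (f i)) (dir_deriv v g)"
  unfolding smooth_lim_def using smooth_lim_upto_SucD(2) by blast

lemma smooth_lim_upto_add:
  "smooth_lim_upto n F f g \<Longrightarrow> smooth_lim_upto n F f' g' \<Longrightarrow>
    smooth_lim_upto n F (\<lambda>i x. f i x + f' i x) (\<lambda>x. g x + g' x)"
proof (induction n arbitrary: f g f' g')
  case 0
  note D = smooth_lim_uptoD[OF 0(1)] smooth_lim_uptoD[OF 0(2)]
  show ?case
  proof (rule smooth_lim_upto_0I)
    show "\<forall>\<^sub>F i in F. smooth (\<lambda>x. f i x + f' i x)"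
      using D(2,5) by eventually_elim (rule smooth_add)
  qed (use D in \<open>auto intro: smooth_add uniform_limit_add\<close>)
next
  case (Suc n)
  note D = smooth_lim_uptoD[OF Suc.prems(1)] smooth_lim_uptoD[OF Suc.prems(2)]
  have "smooth_lim_upto 0 F (\<lambda>i x. f i x + f' i x) (\<lambda>x. g x + g' x)"
  proof (rule smooth_lim_upto_0I)
    show "\<forall>\<^sub>F i in F. smooth (\<lambda>x. f i x + f' i x)"
      using D(2,5) by eventually_elim (rule smooth_add)
  qed (use D in \<open>auto intro: smooth_add uniform_limit_add\<close>)
  moreover have "smooth_lim_upto n F (\<lambda>i. dir_deriv v (\<lambda>x. f i x + f' i x)) (dir_deriv v (\<lambda>x. g x + g' x))" for v
  proof (rule smooth_lim_upto_cong[OF Suc.IH[OF Suc.prems[THEN smooth_lim_upto_SucD(2), of v]]])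
    show "\<forall>\<^sub>F i in F. (\<lambda>x. dir_deriv v (f i) x + dir_deriv v (f' i) x) = dir_deriv v (\<lambda>x. f i x + f' i x)"
      using D(2,5) by eventually_elim (simp add: dir_deriv_add smooth_differentiable)
  qed (use D in \<open>simp add: dir_deriv_add smooth_differentiable\<close>)
  ultimately show ?case by (simp add: smooth_lim_upto_Suc)
qed

lemma smooth_lim_add:
  assumes "smooth_lim F f g" "smooth_lim F f' g'"
  shows "smooth_lim F (\<lambda>i x. f i x + f' i x) (\<lambda>x. g x + g' x)"
  using assms by (simp add: smooth_lim_def smooth_lim_upto_add)

lemma smooth_lim_sum:
  assumes "\<And>j. j \<in> I \<Longrightarrow> smooth_lim F (f j) (g j)"
  shows "smooth_lim F (\<lambda>i x. \<Sum>j\<in>I. f j i x) (\<lambda>x. \<Sum>j\<in>I. g j x)"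
  using assms
  by (induction I rule: infinite_finite_induct)
    (simp_all add: smooth_lim_const smooth_const smooth_lim_add)

lemma uniform_limit_bilinear_compact:
  assumes "bounded_bilinear b" "compact K" "smooth g" "smooth g'"
    "uniform_limit K f g F" "uniform_limit K f' g' F"
  shows "uniform_limit K (\<lambda>i x. b (f i x) (f' i x)) (\<lambda>x. b (g x) (g' x)) F"
proof -
  have "bounded (g ` K)" "bounded (g' ` K)"
    using assms by (simp_all add: compact_imp_bounded compact_continuous_image smooth_continuous_on)
  then show ?thesis
    using assms by (intro bounded_bilinear.bounded_uniform_limit[OF assms(1)]) auto
qed

lemma smooth_lim_upto_bilinear:
  assumes b: "bounded_bilinear b"
  shows "smooth_lim_upto n F f g \<Longrightarrow> smooth_lim_upto n F f' g' \<Longrightarrow>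
    smooth_lim_upto n F (\<lambda>i x. b (f i x) (f' i x)) (\<lambda>x. b (g x) (g' x))"
proof (induction n arbitrary: f g f' g')
  case 0
  note D = smooth_lim_uptoD[OF 0(1)] smooth_lim_uptoD[OF 0(2)]
  show ?case
  proof (rule smooth_lim_upto_0I)
    show "\<forall>\<^sub>F i in F. smooth (\<lambda>x. b (f i x) (f' i x))"
      using D(2,5) by eventually_elim (rule smooth_bilinear[OF b])
  qed (use D b in \<open>auto intro: smooth_bilinear uniform_limit_bilinear_compact\<close>)
next
  case (Suc n)
  note D = smooth_lim_uptoD[OF Suc.prems(1)] smooth_lim_uptoD[OF Suc.prems(2)]
  have "smooth_lim_upto 0 F (\<lambda>i x. b (f i x) (f' i x)) (\<lambda>x. b (g x) (g' x))"
  proof (rule smooth_lim_upto_0I)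
    show "\<forall>\<^sub>F i in F. smooth (\<lambda>x. b (f i x) (f' i x))"
      using D(2,5) by eventually_elim (rule smooth_bilinear[OF b])
  qed (use D b in \<open>auto intro: smooth_bilinear uniform_limit_bilinear_compact\<close>)
  moreover have "smooth_lim_upto n F (\<lambda>i. dir_deriv v (\<lambda>x. b (f i x) (f' i x)))
      (dir_deriv v (\<lambda>x. b (g x) (g' x)))" for v
  proof (rule smooth_lim_upto_cong[OF smooth_lim_upto_add[OF
        Suc.IH[OF Suc.prems(1)[THEN smooth_lim_upto_SucD(1)] Suc.prems(2)[THEN smooth_lim_upto_SucD(2)[where v=v]]]
        Suc.IH[OF Suc.prems(1)[THEN smooth_lim_upto_SucD(2)[where v=v]] Suc.prems(2)[THEN smooth_lim_upto_SucD(1)]]]])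
    show "\<forall>\<^sub>F i in F. (\<lambda>x. b (f i x) (dir_deriv v (f' i) x) + b (dir_deriv v (f i) x) (f' i x)) =
        dir_deriv v (\<lambda>x. b (f i x) (f' i x))"
      using D(2,5) by eventually_elim (simp add: dir_deriv_bilinear[OF b] smooth_differentiable)
  qed (use D in \<open>simp add: dir_deriv_bilinear[OF b] smooth_differentiable\<close>)
  ultimately show ?case by (simp add: smooth_lim_upto_Suc)
qed

lemma smooth_lim_bilinear:
  assumes "bounded_bilinear b" "smooth_lim F f g" "smooth_lim F f' g'"
  shows "smooth_lim F (\<lambda>i x. b (f i x) (f' i x)) (\<lambda>x. b (g x) (g' x))"
  using assms by (simp add: smooth_lim_def smooth_lim_upto_bilinear)

lemma smooth_lim_linear_comp:
  fixes f :: "'i \<Rightarrow> 'a::euclidean_space \<Rightarrow> 'b::euclidean_space"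
    and m :: "'c::euclidean_space \<Rightarrow> 'a" and l :: "'b \<Rightarrow> 'd::euclidean_space"
  assumes lm: "linear l" "linear m" and f: "smooth_lim F f g"
  shows "smooth_lim F (\<lambda>i x. l (f i (m x))) (\<lambda>x. l (g (m x)))"
  unfolding smooth_lim_def smooth_lim_upto_def
proof (intro allI conjI impI)
  show "smooth (\<lambda>x. l (g (m x)))"
    using smooth_linear_comp[OF lm] smooth_limD(1)[OF f] by blast
  show "\<forall>\<^sub>F i in F. smooth (\<lambda>x. l (f i (m x)))"
    using smooth_limD(2)[OF f] by eventually_elim (rule smooth_linear_comp[OF lm])
  fix vs :: "'c list" and K :: "'c set"
  assume K: "compact K"
  have "uniform_limit (m ` K) (\<lambda>i. iter_deriv (f i) (map m vs)) (iter_deriv g (map m vs)) F"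
    using f K lm(2) unfolding smooth_lim_def smooth_lim_upto_def
    by (metis compact_continuous_image linear_continuous_on linear_linear order_refl)
  then have "uniform_limit K (\<lambda>i x. iter_deriv (f i) (map m vs) (m x)) (\<lambda>x. iter_deriv g (map m vs) (m x)) F"
    by (rule uniform_limit_compose') auto
  then have lim: "uniform_limit K (\<lambda>i x. l (iter_deriv (f i) (map m vs) (m x)))
      (\<lambda>x. l (iter_deriv g (map m vs) (m x))) F"
    using lm(1) bounded_linear.uniform_limit linear_linear by blast
  have ev: "\<forall>\<^sub>F i in F. \<forall>x\<in>K. l (iter_deriv (f i) (map m vs) (m x)) = iter_deriv (\<lambda>x. l (f i (m x))) vs x"
    using smooth_limD(2)[OF f] by eventually_elim (simp add: iter_deriv_linear_comp[OF lm])
  show "uniform_limit K (\<lambda>i. iter_deriv (\<lambda>x. l (f i (m x))) vs) (iter_deriv (\<lambda>x. l (g (m x))) vs) F"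
    using lim uniform_limit_cong[OF ev] iter_deriv_linear_comp[OF lm smooth_limD(1)[OF f]]
    by (metis (mono_tags, lifting))
qed

lemma smooth_lim_deriv_along:
  assumes "smooth_lim F f g" "smooth_lim F X Y"
  shows "smooth_lim F (\<lambda>i. deriv_along (X i) (f i)) (deriv_along Y g)"
proof -
  have "smooth_lim F (\<lambda>i x. \<Sum>b\<in>Basis. (X i x \<bullet> b) *\<^sub>R dir_deriv b (f i) x)
      (\<lambda>x. \<Sum>b\<in>Basis. (Y x \<bullet> b) *\<^sub>R dir_deriv b g x)"
    using assms
    by (intro smooth_lim_sum smooth_lim_bilinear[OF bounded_bilinear_scaleR]
        smooth_lim_bilinear[OF bounded_bilinear_inner] smooth_lim_dir_deriv
        smooth_lim_const smooth_const)
  moreover have "\<forall>\<^sub>F i in F. (\<lambda>x. \<Sum>b\<in>Basis. (X i x \<bullet> b) *\<^sub>R dir_deriv b (f i) x) =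
      deriv_along (X i) (f i)"
    using smooth_limD(2)[OF assms(1)] by eventually_elim (simp add: deriv_along_Basis)
  ultimately show ?thesis
    using smooth_limD(1)[OF assms(1)]
    unfolding smooth_lim_def by (auto simp: deriv_along_Basis elim: smooth_lim_upto_cong)
qed

lemma smooth_lim_diff:
  assumes "smooth_lim F f g" "smooth_lim F f' g'"
  shows "smooth_lim F (\<lambda>i x. f i x - f' i x) (\<lambda>x. g x - g' x)"
proof -
  have "linear (uminus :: 'c \<Rightarrow> 'c)" "linear (\<lambda>x::'b. x)"
    by (auto simp: linear_iff)
  from smooth_lim_linear_comp[OF this assms(2)] have "smooth_lim F (\<lambda>i x. - f' i x) (\<lambda>x. - g' x)" .
  from smooth_lim_add[OF assms(1) this] show ?thesis by simp
qed

lemma smooth_lim_iter_bracket: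
  assumes "smooth_lim F X X'" "smooth_lim F Y Y'"
  shows "smooth_lim F (\<lambda>i. iter_bracket (X i) (Y i) n) (iter_bracket X' Y' n)"
  by (induction n)
    (use assms in \<open>simp_all add: lie_bracket_def smooth_lim_diff smooth_lim_deriv_along\<close>)

text \<open>The compact image of \<open>K\<close> under \<open>g\<close> keeps a positive distance
  from the closed complement of \<open>U\<close>, so uniformly close functions stay in
  \<open>U\<close>. The openness of all regions of good fields comes from this.\<close>

lemma uniform_limit_compact_open:
  fixes g :: "'a::topological_space \<Rightarrow> 'b::heine_borel"
  assumes "compact K" "continuous_on K g" "uniform_limit K f g F" "open U" "\<And>x. x \<in> K \<Longrightarrow> g x \<in> U"
  shows "\<forall>\<^sub>F i in F. \<forall>x\<in>K. f i x \<in> U"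
proof -
  obtain d where d: "d > 0" "\<And>x y. x \<in> g ` K \<Longrightarrow> y \<in> - U \<Longrightarrow> d \<le> dist x y"
    using separate_compact_closed[of "g ` K" "- U"] assms
    by (metis compact_continuous_image closed_Compl disjoint_eq_subset_Compl double_complement image_subsetI)
  have "\<forall>\<^sub>F i in F. \<forall>x\<in>K. dist (f i x) (g x) < d"
    using assms(3) d(1) uniform_limitD by blast
  then show ?thesis
    by eventually_elim (metis ComplI d(2) dist_commute imageI not_less)
qed

subsection \<open>The topology of equivariant fields\<close>

text \<open>A subbasic set centred at \<open>V\<close> is what uniform closeness of one derivative
  on one compact set asks for.\<close>

lemma smooth_lim_nhdsin:
  fixes V :: "'n::finite sym_mat \<Rightarrow> 'n sym_mat"
  assumes V: "V \<in> equivariant_fields"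
  shows "smooth_lim (nhdsin smooth_topology V) (\<lambda>W. W) V"
  unfolding smooth_lim_def smooth_lim_upto_def
proof (intro allI conjI impI)
  show "smooth V" using V by (simp add: equivariant_fields_def)
  have "openin smooth_topology (topspace smooth_topology :: ('n sym_mat \<Rightarrow> 'n sym_mat) set)" by blast
  then show "\<forall>\<^sub>F W in nhdsin smooth_topology V. smooth W"
    unfolding eventually_nhdsin
    using V by (auto simp: topspace_smooth_topology equivariant_fields_def)
  fix vs :: "'n sym_mat list" and K :: "'n sym_mat set"
  assume K: "compact K"
  show "uniform_limit K (\<lambda>W. iter_deriv W vs) (iter_deriv V vs) (nhdsin smooth_topology V)"
  proof (rule uniform_limitI)
    fix e :: real
    assume e: "e > 0"
    let ?U = "{W \<in> equivariant_fields. \<forall>x\<in>K. norm (iter_deriv W vs x - iter_deriv V vs x) < e}"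
    have "openin smooth_topology ?U"
      unfolding smooth_topology_def using V K e
      by (intro topology_generated_by_Basis) blast
    moreover have "V \<in> ?U" using V e by simp
    ultimately show "\<forall>\<^sub>F W in nhdsin smooth_topology V. \<forall>x\<in>K. dist (iter_deriv W vs x) (iter_deriv V vs x) < e"
      unfolding eventually_nhdsin dist_norm by blast
  qed
qed

lemma iter_deriv_add:
  assumes "smooth f" "smooth g"
  shows "iter_deriv (\<lambda>x. f x + g x) vs = (\<lambda>x. iter_deriv f vs x + iter_deriv g vs x)"
  using assms
proof (induction vs arbitrary: f g rule: rev_induct)
  case (snoc v vs)
  then show ?case
    by (simp add: iter_deriv_snoc dir_deriv_add smooth_differentiable smooth_dir_deriv)
qed simp

lemma iter_deriv_lincomb:
  fixes f :: "'i \<Rightarrow> 'a::euclidean_space \<Rightarrow> 'c::euclidean_space"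
  assumes "finite I" "\<And>i. i \<in> I \<Longrightarrow> smooth (f i)"
  shows "iter_deriv (\<lambda>x. \<Sum>i\<in>I. c i *\<^sub>R f i x) vs = (\<lambda>x. \<Sum>i\<in>I. c i *\<^sub>R iter_deriv (f i) vs x)"
  using assms
proof (induction I rule: finite_induct)
  case empty
  have "iter_deriv (\<lambda>x :: 'a. 0 :: 'c) vs = (\<lambda>x. 0)" by (induction vs) auto
  then show ?case by simp
next
  case (insert i I)
  have "iter_deriv (\<lambda>x. c i *\<^sub>R f i x) vs = (\<lambda>x. c i *\<^sub>R iter_deriv (f i) vs x)"
    using iter_deriv_linear_comp[of "\<lambda>y. c i *\<^sub>R y" "\<lambda>x. x" "f i" vs] insert.prems
    by (simp add: linear_iff algebra_simps)
  then show ?case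
    using insert
    by (simp add: iter_deriv_add smooth_scaleR smooth_const smooth_sum)
qed

text \<open>The field depends continuously on its parameters, so generic parameters near 0 can be
  used inside any open set of fields. On a subbasic set, the complement of the preimage is the
  projection along the compact \<open>K\<close> of a closed set, hence closed.\<close>

lemma openin_lincomb_parameters:
  fixes W :: "'m::finite \<Rightarrow> 'n::finite sym_mat \<Rightarrow> 'n sym_mat"
  assumes U: "openin smooth_topology U" and V: "V \<in> equivariant_fields"
    and W: "\<And>b. W b \<in> equivariant_fields"
    and comb: "\<And>q :: real^'m. (\<lambda>x. V x + (\<Sum>b\<in>UNIV. (q $ b) *\<^sub>R W b x)) \<in> equivariant_fields"
  shows "open {q :: real^'m. (\<lambda>x. V x + (\<Sum>b\<in>UNIV. (q $ b) *\<^sub>R W b x)) \<in> U}"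
proof -
  let ?f = "\<lambda>q :: real^'m. (\<lambda>x. V x + (\<Sum>b\<in>UNIV. (q $ b) *\<^sub>R W b x))"
  have sm: "smooth V" "\<And>b. smooth (W b)" using V W by (auto simp: equivariant_fields_def)
  have "continuous_map euclidean smooth_topology ?f"
    unfolding smooth_topology_def
  proof (rule continuous_on_generated_topo)
    have "?f ` topspace euclidean \<subseteq> topspace smooth_topology"
      using comb by (auto simp: topspace_smooth_topology)
    then show "?f ` topspace euclidean \<subseteq> \<Union> {{V \<in> equivariant_fields. \<forall>x\<in>K. norm (iter_deriv V vs x - iter_deriv U vs x) < e}
      | U K vs e. U \<in> equivariant_fields \<and> compact K \<and> e > (0::real)}"
      unfolding smooth_topology_def topology_generated_by_topspace .
    fix B :: "('n sym_mat \<Rightarrow> 'n sym_mat) set"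
    assume "B \<in> {{V \<in> equivariant_fields. \<forall>x\<in>K. norm (iter_deriv V vs x - iter_deriv U vs x) < e}
      | U K vs e. U \<in> equivariant_fields \<and> compact K \<and> e > (0::real)}"
    then obtain U' K vs e where B:
      "B = {V \<in> equivariant_fields. \<forall>x\<in>K. norm (iter_deriv V vs x - iter_deriv U' vs x) < e}"
      and U': "U' \<in> equivariant_fields" and K: "compact K" and e: "e > 0"
      by blast
    let ?g = "\<lambda>(x, q :: real^'m). norm (iter_deriv V vs x + (\<Sum>b\<in>UNIV. (q $ b) *\<^sub>R iter_deriv (W b) vs x) - iter_deriv U' vs x)"
    have c: "continuous_on UNIV (iter_deriv f vs)" if "smooth f" for f :: "'n sym_mat \<Rightarrow> 'n sym_mat"
      using that smooth_continuous_on smooth_iter_deriv by blast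
    have cf: "continuous_on UNIV (\<lambda>z::'n sym_mat \<times> (real^'m). iter_deriv f vs (fst z))" if "smooth f" for f :: "'n sym_mat \<Rightarrow> 'n sym_mat"
      using continuous_on_compose2[OF c[OF that] continuous_on_fst[OF continuous_on_id]] by simp
    have "continuous_on UNIV ?g"
      unfolding case_prod_beta using sm U' unfolding equivariant_fields_def
      by (intro continuous_intros cf) auto
    then have "closed {z. ?g z \<ge> e}"
      by (intro closed_Collect_le continuous_on_const)
    then have "closed {q. \<exists>x. x \<in> K \<and> (x, q) \<in> {z. ?g z \<ge> e}}"
      using K closed_compact_projection by blast
    moreover have "?f -` B = - {q. \<exists>x. x \<in> K \<and> (x, q) \<in> {z. ?g z \<ge> e}}"
      using comb sm
      by (auto simp: B iter_deriv_add iter_deriv_lincomb smooth_sum smooth_scaleR smooth_const not_le)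
    ultimately show "openin euclidean (?f -` B \<inter> topspace euclidean)" by (simp add: open_Compl)
  qed
  then show ?thesis using openin_continuous_map_preimage[OF _ U] by fastforce
qed

section \<open>Ordinary differential equations\<close>

lemma integral_curve_nonneg:
  "0 \<le> T \<Longrightarrow> integral_curve u T \<gamma> \<longleftrightarrow>
     (\<forall>t\<in>{0..T}. (\<gamma> has_vector_derivative u (\<gamma> t)) (at t within {0..T}))"
  by (simp add: integral_curve_def closed_segment_eq_real_ivl)

lemma smooth_dir_bound:
  fixes f :: "'a::euclidean_space \<Rightarrow> 'b::euclidean_space"
  assumes "smooth f" "compact K"
  shows "\<exists>B>0. \<forall>x\<in>K. \<forall>h. norm (frechet_derivative f (at x) h) \<le> B * norm h"
proof -
  let ?N = "\<lambda>x. \<Sum>b\<in>Basis. norm (dir_deriv b f x)"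
  have "continuous_on K ?N"
    using assms(1) by (intro continuous_intros smooth_continuous_on smooth_dir_deriv)
  then have "bounded (?N ` K)" using assms(2) compact_continuous_image compact_imp_bounded by blast
  then obtain B where B: "B > 0" "\<And>x. x \<in> K \<Longrightarrow> norm (?N x) \<le> B"
    unfolding bounded_pos by auto
  have "norm (frechet_derivative f (at x) h) \<le> B * norm h" if "x \<in> K" for x h
  proof -
    have "frechet_derivative f (at x) h = (\<Sum>b\<in>Basis. (h \<bullet> b) *\<^sub>R dir_deriv b f x)"
      using fun_cong[OF deriv_along_Basis[OF assms(1), of "\<lambda>_. h"], of x] by (simp add: deriv_along_def)
    also have "norm \<dots> \<le> (\<Sum>b\<in>Basis. norm h * norm (dir_deriv b f x))"
      by (rule order_trans[OF norm_sum]) (auto intro!: sum_mono mult_right_mono Basis_le_norm)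
    also have "\<dots> = ?N x * norm h" by (simp add: sum_distrib_left mult.commute)
    also have "\<dots> \<le> B * norm h"
      using B(2)[OF that] by (intro mult_right_mono) auto
    finally show ?thesis .
  qed
  then show ?thesis using B(1) by blast
qed

lemma smooth_lipschitz_cball:
  fixes f :: "'a::euclidean_space \<Rightarrow> 'b::euclidean_space"
  assumes "smooth f"
  shows "\<exists>L>0. \<forall>x\<in>cball a R. \<forall>y\<in>cball a R. norm (f x - f y) \<le> L * norm (x - y)"
proof -
  obtain B where B: "B > 0" "\<And>x h. x \<in> cball a R \<Longrightarrow> norm (frechet_derivative f (at x) h) \<le> B * norm h"
    using smooth_dir_bound[OF assms compact_cball[of a R]] by blast
  have "norm (f x - f y) \<le> B * norm (x - y)" if "x \<in> cball a R" "y \<in> cball a R" for x y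
    by (rule differentiable_bound[OF convex_cball
          has_derivative_at_withinI[OF smooth_has_derivative[OF assms]]])
      (use that B in \<open>auto intro!: onorm_le\<close>)
  then show ?thesis using B(1) by blast
qed

text \<open>Since \<open>Df\<close> is Lipschitz, \<open>y \<mapsto> f y - Df(x) y\<close> is Lipschitz with a constant of order
  \<open>norm (y - x)\<close> on a ball about \<open>x\<close> of that radius.\<close>

lemma smooth_quadratic_remainder:
  fixes f :: "'a::euclidean_space \<Rightarrow> 'b::euclidean_space"
  assumes "smooth f"
  shows "\<exists>Q>0. \<forall>x\<in>cball a R. \<forall>y\<in>cball a R.
    norm (f y - f x - frechet_derivative f (at x) (y - x)) \<le> Q * (norm (y - x))\<^sup>2"
proof -
  have "\<forall>b\<in>Basis. \<exists>L>0. \<forall>x\<in>cball a R. \<forall>y\<in>cball a R.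
      norm (dir_deriv b f x - dir_deriv b f y) \<le> L * norm (x - y)"
    using smooth_lipschitz_cball smooth_dir_deriv[OF assms] by blast
  then obtain L where L: "\<And>b. b \<in> Basis \<Longrightarrow> L b > 0"
    "\<And>b x y. b \<in> Basis \<Longrightarrow> x \<in> cball a R \<Longrightarrow> y \<in> cball a R \<Longrightarrow>
      norm (dir_deriv b f x - dir_deriv b f y) \<le> L b * norm (x - y)"
    by metis
  define Q where "Q = (\<Sum>b\<in>Basis. L b)"
  have Q: "Q > 0" unfolding Q_def by (intro sum_pos) (auto simp: L)
  let ?D = "\<lambda>x. frechet_derivative f (at x)"
  have D: "norm (?D z h - ?D x h) \<le> Q * norm (z - x) * norm h"
    if "x \<in> cball a R" "z \<in> cball a R" for x z h
  proof -
    have rep: "?D x h = (\<Sum>b\<in>Basis. (h \<bullet> b) *\<^sub>R dir_deriv b f x)" for x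
      using fun_cong[OF deriv_along_Basis[OF assms(1), of "\<lambda>_. h"], of x] by (simp add: deriv_along_def)
    have "?D z h - ?D x h = (\<Sum>b\<in>Basis. (h \<bullet> b) *\<^sub>R (dir_deriv b f z - dir_deriv b f x))"
      by (simp add: rep sum_subtractf algebra_simps)
    also have "norm \<dots> \<le> (\<Sum>b\<in>Basis. norm h * (L b * norm (z - x)))"
      by (rule order_trans[OF norm_sum]) (auto intro!: sum_mono mult_mono Basis_le_norm L that)
    also have "\<dots> = Q * norm (z - x) * norm h"
      by (simp add: Q_def sum_distrib_left sum_distrib_right mult_ac)
    finally show ?thesis .
  qed
  have "norm (f y - f x - ?D x (y - x)) \<le> Q * (norm (y - x))\<^sup>2"
    if xy: "x \<in> cball a R" "y \<in> cball a R" for x y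
  proof -
    have l: "linear (?D x)" using smooth_has_derivative[OF assms] has_derivative_linear by blast
    have "norm ((f y - ?D x y) - (f x - ?D x x)) \<le> (Q * norm (y - x)) * norm (y - x)"
    proof (rule differentiable_bound[of "closed_segment x y"])
      fix z assume z: "z \<in> closed_segment x y"
      show "((\<lambda>y. f y - ?D x y) has_derivative (\<lambda>h. ?D z h - ?D x h)) (at z within closed_segment x y)"
        using smooth_has_derivative[OF assms] l
        by (intro has_derivative_diff linear_imp_has_derivative) (auto intro: has_derivative_at_withinI)
      have "z \<in> cball a R"
        using z xy convex_cball closed_segment_subset by blast
      moreover have "norm (z - x) \<le> norm (y - x)" using z segment_bound1 by blast
      ultimately have "norm (?D z h - ?D x h) \<le> (Q * norm (y - x)) * norm h" for h
        using D[OF xy(1), of z h] Q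
        by (meson mult_left_mono mult_right_mono norm_ge_zero order_less_imp_le order_trans)
      then show "onorm (\<lambda>h. ?D z h - ?D x h) \<le> Q * norm (y - x)"
        by (rule onorm_le)
    qed auto
    then show ?thesis by (simp add: linear_diff[OF l] power2_eq_square algebra_simps)
  qed
  then show ?thesis using Q by blast
qed

subsection \<open>Existence\<close>

text \<open>The Picard integral operator contracts the supremum distance by the factor
  \<open>\<tau> * L\<close>.\<close>

lemma picard_fixed_point:
  fixes g :: "'a::euclidean_space \<Rightarrow> 'a"
  assumes lip: "\<And>x y. norm (g x - g y) \<le> L * norm (x - y)" and L: "0 \<le> L"
    and \<tau>: "0 \<le> \<tau>" "\<tau> * L < 1"
  shows "\<exists>\<gamma>. \<gamma> 0 = x \<and> (\<forall>t\<in>{0..\<tau>}. (\<gamma> has_vector_derivative g (\<gamma> t)) (at t within {0..\<tau>}))"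
proof -
  have gc: "continuous_on UNIV g"
    by (rule lipschitz_on_continuous_on[of L]) (use lip L in \<open>auto simp: lipschitz_on_def dist_norm\<close>)
  have cont: "continuous_on A (\<lambda>s. g (apply_bcontfun \<phi> s))" for A and \<phi> :: "real \<Rightarrow>\<^sub>C 'a"
    using continuous_on_compose2[OF gc, of A "apply_bcontfun \<phi>"] by simp
  \<comment> \<open>Clamping the time to the interval makes the Picard integral a bounded continuous
    function on the whole line, and the contraction theorem is applied in that complete
    space.\<close>
  define c where "c = (\<lambda>t. max 0 (min \<tau> t))"
  have c: "c t \<in> {0..\<tau>}" "continuous_on A c" for t A
    using \<tau> by (auto simp: c_def intro!: continuous_intros)
  have cid: "c t = t" if "t \<in> {0..\<tau>}" for t using that by (auto simp: c_def)
  let ?P = "\<lambda>\<phi> t. x + integral {0..c t} (\<lambda>s. g (apply_bcontfun \<phi> s))"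
  have P: "?P \<phi> \<in> bcontfun" for \<phi>
  proof -
    let ?F = "\<lambda>t. integral {0..t} (\<lambda>s. g (apply_bcontfun \<phi> s))"
    have F: "continuous_on {0..\<tau>} ?F"
      by (intro indefinite_integral_continuous_1 integrable_continuous_real cont)
    have "continuous_on UNIV (\<lambda>t. ?F (c t))"
      by (rule continuous_on_compose2[OF F c(2)]) (use c(1) in auto)
    moreover have "bounded (?F ` {0..\<tau>})"
      by (intro compact_imp_bounded compact_continuous_image F compact_Icc)
    then have "bounded (range (\<lambda>t. ?F (c t)))"
      by (rule bounded_subset) (use c(1) in auto)
    then have "bounded ((+) x ` range (\<lambda>t. ?F (c t)))" by (rule bounded_translation)
    ultimately show ?thesis
      unfolding bcontfun_def by (auto simp: image_image intro!: continuous_intros)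
  qed
  define T where "T = (\<lambda>\<phi>. Bcontfun (?P \<phi>))"
  have T: "apply_bcontfun (T \<phi>) t = ?P \<phi> t" for \<phi> t
    unfolding T_def using Bcontfun_inverse[OF P] by simp
  have "dist (T \<phi>) (T \<psi>) \<le> (\<tau> * L) * dist \<phi> \<psi>" for \<phi> \<psi>
  proof (rule dist_bound)
    fix t
    have int: "(\<lambda>s. g (apply_bcontfun \<phi> s)) integrable_on {0..c t}" for \<phi>
      by (intro integrable_continuous_real cont)
    have "dist (apply_bcontfun (T \<phi>) t) (apply_bcontfun (T \<psi>) t) =
        norm (integral {0..c t} (\<lambda>s. g (apply_bcontfun \<phi> s) - g (apply_bcontfun \<psi> s)))"
      by (simp add: T dist_norm Henstock_Kurzweil_Integration.integral_diff[OF int int])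
    also have "\<dots> \<le> (L * dist \<phi> \<psi>) * (c t - 0)"
    proof (rule integral_bound)
      fix s
      have "norm (g (apply_bcontfun \<phi> s) - g (apply_bcontfun \<psi> s)) \<le> L * dist (apply_bcontfun \<phi> s) (apply_bcontfun \<psi> s)"
        using lip by (simp add: dist_norm)
      also have "\<dots> \<le> L * dist \<phi> \<psi>" using L dist_bounded mult_left_mono by blast
      finally show "norm (g (apply_bcontfun \<phi> s) - g (apply_bcontfun \<psi> s)) \<le> L * dist \<phi> \<psi>" .
    qed (use c(1) in \<open>auto intro!: continuous_intros cont\<close>)
    also have "\<dots> \<le> (L * dist \<phi> \<psi>) * \<tau>"
      using c(1)[of t] L by (intro mult_left_mono) auto
    finally show "dist (apply_bcontfun (T \<phi>) t) (apply_bcontfun (T \<psi>) t) \<le> (\<tau> * L) * dist \<phi> \<psi>"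
      by (simp add: mult_ac)
  qed
  then obtain \<phi> where \<phi>: "T \<phi> = \<phi>"
    using banach_fix_type[of "\<tau> * L" T] \<tau> L by auto
  have eq: "apply_bcontfun \<phi> t = x + integral {0..t} (\<lambda>s. g (apply_bcontfun \<phi> s))" if "t \<in> {0..\<tau>}" for t
    using T[of \<phi> t] \<phi> cid[OF that] by simp
  have "(apply_bcontfun \<phi> has_vector_derivative g (apply_bcontfun \<phi> t)) (at t within {0..\<tau>})"
    if t: "t \<in> {0..\<tau>}" for t
  proof -
    have "((\<lambda>t. x + integral {0..t} (\<lambda>s. g (apply_bcontfun \<phi> s))) has_vector_derivative
        0 + g (apply_bcontfun \<phi> t)) (at t within {0..\<tau>})"
      by (intro has_vector_derivative_add has_vector_derivative_const
          integral_has_vector_derivative[OF cont t])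
    then have d: "((\<lambda>t. x + integral {0..t} (\<lambda>s. g (apply_bcontfun \<phi> s))) has_vector_derivative
        g (apply_bcontfun \<phi> t)) (at t within {0..\<tau>})" by simp
    show ?thesis by (rule has_vector_derivative_transform[OF t eq d])
  qed
  moreover have "apply_bcontfun \<phi> 0 = x" using eq[of 0] \<tau> by simp
  ultimately show ?thesis by blast
qed

lemma vector_derivative_curve_continuous:
  assumes "\<And>t. t \<in> S \<Longrightarrow> (\<gamma> has_vector_derivative \<gamma>' t) (at t within S)"
  shows "continuous_on S \<gamma>"
  using assms has_vector_derivative_continuous continuous_on_eq_continuous_within by blast

lemma curve_bound:
  fixes \<gamma> :: "real \<Rightarrow> 'a::real_normed_vector"
  assumes "\<And>t. t \<in> {0..T} \<Longrightarrow> (\<gamma> has_vector_derivative \<gamma>' t) (at t within {0..T})"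
    "\<And>t. t \<in> {0..T} \<Longrightarrow> norm (\<gamma>' t) \<le> B" "s \<in> {0..T}" "t \<in> {0..T}"
  shows "norm (\<gamma> t - \<gamma> s) \<le> B * \<bar>t - s\<bar>"
proof -
  have "norm (\<gamma> t - \<gamma> s) \<le> B * norm (t - s)"
  proof (rule differentiable_bound[of "{0..T}" \<gamma> "\<lambda>t h. h *\<^sub>R \<gamma>' t"])
    show "onorm (\<lambda>h. h *\<^sub>R \<gamma>' t) \<le> B" if "t \<in> {0..T}" for t
      by (rule onorm_le) (use assms(2)[OF that] in \<open>simp add: mult.commute[of B] mult_left_mono\<close>)
  qed (use assms in \<open>auto simp: has_vector_derivative_def\<close>)
  then show ?thesis by simp
qed

text \<open>Composing the field with the projection onto a ball makes it globally Lipschitz.\<close>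

lemma local_existence:
  fixes u :: "'a::euclidean_space \<Rightarrow> 'a"
  assumes u: "smooth u" and R: "R > 0"
  shows "\<exists>\<tau>>0. \<forall>x\<in>cball a (R/2). \<exists>\<gamma>. \<gamma> 0 = x \<and> integral_curve u \<tau> \<gamma> \<and> (\<forall>t\<in>{0..\<tau>}. \<gamma> t \<in> cball a R)"
proof -
  obtain L where L: "L > 0" "\<And>x y. x \<in> cball a R \<Longrightarrow> y \<in> cball a R \<Longrightarrow> norm (u x - u y) \<le> L * norm (x - y)"
    using smooth_lipschitz_cball[OF u] by blast
  have "bounded (u ` cball a R)"
    by (intro compact_imp_bounded compact_continuous_image smooth_continuous_on u compact_cball)
  then obtain M where M: "M > 0" "\<And>x. x \<in> cball a R \<Longrightarrow> norm (u x) \<le> M"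
    unfolding bounded_pos by auto
  \<comment> \<open>The first bound gives the contraction factor 1/2. The second lets a curve of
    speed at most \<open>M\<close> travel no further than \<open>R / 2\<close>, so starts in the
    half ball stay in the ball.\<close>
  define \<tau> where "\<tau> = min (1 / (2 * L)) (R / (2 * M))"
  have \<tau>: "\<tau> > 0" using L(1) M(1) R by (simp add: \<tau>_def)
  have "\<tau> * L \<le> 1 / (2 * L) * L" using L(1) by (intro mult_right_mono) (auto simp: \<tau>_def)
  then have \<tau>L: "\<tau> * L < 1" using L(1) by simp
  have "M * \<tau> \<le> M * (R / (2 * M))" using M(1) by (intro mult_left_mono) (auto simp: \<tau>_def)
  then have \<tau>M: "M * \<tau> \<le> R / 2" using M(1) by simp
  let ?p = "closest_point (cball a R)"
  have p: "?p x \<in> cball a R" for x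
    using R by (intro closest_point_in_set) auto
  have plip: "norm (?p x - ?p y) \<le> norm (x - y)" for x y
    using closest_point_lipschitz[of "cball a R" x y] R by (simp add: dist_norm)
  have lip: "norm (u (?p x) - u (?p y)) \<le> L * norm (x - y)" for x y
    using L(2)[OF p p, of x y] plip[of x y] L(1) by (meson mult_left_mono order_less_imp_le order_trans)
  have "\<exists>\<gamma>. \<gamma> 0 = x \<and> integral_curve u \<tau> \<gamma> \<and> (\<forall>t\<in>{0..\<tau>}. \<gamma> t \<in> cball a R)"
    if x: "x \<in> cball a (R/2)" for x
  proof -
    obtain \<gamma> where \<gamma>: "\<gamma> 0 = x"
      "\<And>t. t \<in> {0..\<tau>} \<Longrightarrow> (\<gamma> has_vector_derivative u (?p (\<gamma> t))) (at t within {0..\<tau>})"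
      using picard_fixed_point[of "\<lambda>x. u (?p x)" L \<tau> x] lip L(1) \<tau> \<tau>L by auto
    have inb: "\<gamma> t \<in> cball a R" if t: "t \<in> {0..\<tau>}" for t
    proof -
      have "norm (\<gamma> t - \<gamma> 0) \<le> M * \<bar>t - 0\<bar>"
        by (rule curve_bound[OF \<gamma>(2)]) (use M(2) p t \<tau> in auto)
      also have "\<dots> \<le> M * \<tau>" using t M(1) by (intro mult_left_mono) auto
      finally have "norm (\<gamma> t - x) \<le> R / 2" unfolding \<gamma>(1) using \<tau>M by linarith
      moreover have "dist a (\<gamma> t) \<le> dist a x + dist x (\<gamma> t)" by (rule dist_triangle)
      ultimately show ?thesis using x by (simp add: dist_norm norm_minus_commute)
    qed
    have "?p (\<gamma> t) = \<gamma> t" if "t \<in> {0..\<tau>}" for t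
      using inb[OF that] by (rule closest_point_self)
    then have "integral_curve u \<tau> \<gamma>"
      using \<gamma>(2) \<tau> by (simp add: integral_curve_nonneg)
    then show ?thesis using \<gamma>(1) inb by blast
  qed
  then show ?thesis using \<tau> by blast
qed

subsection \<open>Uniqueness and dependence on the initial point\<close>

text \<open>By the Cauchy-Schwarz inequality the squared distance times \<open>exp (- 2 L t)\<close>
  is nonincreasing. The Lipschitz bound is asked only along the two curves, which suits fields that
  are Lipschitz on balls.\<close>

lemma gronwall:
  fixes \<gamma> \<delta> :: "real \<Rightarrow> 'a::real_inner"
  assumes T: "0 \<le> T"
    and \<gamma>: "\<And>t. t \<in> {0..T} \<Longrightarrow> (\<gamma> has_vector_derivative u (\<gamma> t)) (at t within {0..T})"
    and \<delta>: "\<And>t. t \<in> {0..T} \<Longrightarrow> (\<delta> has_vector_derivative u (\<delta> t)) (at t within {0..T})"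
    and lip: "\<And>t. t \<in> {0..T} \<Longrightarrow> norm (u (\<gamma> t) - u (\<delta> t)) \<le> L * norm (\<gamma> t - \<delta> t)"
  shows "norm (\<gamma> T - \<delta> T) \<le> exp (L * T) * norm (\<gamma> 0 - \<delta> 0)"
proof -
  let ?z = "\<lambda>t. \<gamma> t - \<delta> t"
  let ?w = "\<lambda>t. (?z t \<bullet> ?z t) * exp (- (2 * L) * t)"
  have c: "continuous_on {0..T} \<gamma>" "continuous_on {0..T} \<delta>"
    by (rule vector_derivative_curve_continuous, erule \<gamma>, rule vector_derivative_curve_continuous, erule \<delta>)
  have "?w T \<le> ?w 0"
  proof (rule DERIV_nonpos_imp_decreasing_open[OF T])
    fix t assume t: "0 < t" "t < T"
    then have at: "at t within {0..T} = at t" by (rule at_within_Icc_at)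
    have z: "(?z has_vector_derivative u (\<gamma> t) - u (\<delta> t)) (at t)"
      using \<gamma>[of t] \<delta>[of t] t by (auto simp: at intro!: has_vector_derivative_diff)
    have "((\<lambda>t. ?z t \<bullet> ?z t) has_vector_derivative
        ?z t \<bullet> (u (\<gamma> t) - u (\<delta> t)) + (u (\<gamma> t) - u (\<delta> t)) \<bullet> ?z t) (at t)"
      by (rule bounded_bilinear.has_vector_derivative[OF bounded_bilinear_inner z z])
    then have "((\<lambda>t. ?z t \<bullet> ?z t) has_real_derivative 2 * (?z t \<bullet> (u (\<gamma> t) - u (\<delta> t)))) (at t)"
      by (simp add: has_real_derivative_iff_has_vector_derivative inner_commute)
    moreover have "((\<lambda>t. exp (- (2 * L) * t)) has_real_derivative exp (- (2 * L) * t) * (- (2 * L))) (at t)"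
      by (auto intro!: derivative_eq_intros)
    ultimately have d: "(?w has_real_derivative 2 * (?z t \<bullet> (u (\<gamma> t) - u (\<delta> t))) * exp (- (2 * L) * t) +
        exp (- (2 * L) * t) * (- (2 * L)) * (?z t \<bullet> ?z t)) (at t)"
      by (rule DERIV_mult)
    have "?z t \<bullet> (u (\<gamma> t) - u (\<delta> t)) \<le> norm (?z t) * norm (u (\<gamma> t) - u (\<delta> t))"
      by (rule norm_cauchy_schwarz)
    also have "\<dots> \<le> norm (?z t) * (L * norm (?z t))"
      using lip[of t] t by (intro mult_left_mono) auto
    also have "\<dots> = L * (?z t \<bullet> ?z t)" by (simp add: dot_square_norm power2_eq_square)
    finally have "2 * (?z t \<bullet> (u (\<gamma> t) - u (\<delta> t))) + - (2 * L) * (?z t \<bullet> ?z t) \<le> 0" by simp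
    then have "exp (- (2 * L) * t) * (2 * (?z t \<bullet> (u (\<gamma> t) - u (\<delta> t))) + - (2 * L) * (?z t \<bullet> ?z t)) \<le> 0"
      by (intro mult_nonneg_nonpos) auto
    then have "2 * (?z t \<bullet> (u (\<gamma> t) - u (\<delta> t))) * exp (- (2 * L) * t) +
        exp (- (2 * L) * t) * (- (2 * L)) * (?z t \<bullet> ?z t) \<le> 0"
      by (simp add: algebra_simps)
    then show "\<exists>y. (?w has_real_derivative y) (at t) \<and> y \<le> 0" using d by blast
  qed (use c in \<open>auto intro!: continuous_intros\<close>)
  then have "(norm (?z T))\<^sup>2 * exp (- (2 * L) * T) \<le> (norm (?z 0))\<^sup>2"
    by (simp add: dot_square_norm)
  then have "(norm (?z T))\<^sup>2 * exp (- (2 * L) * T) * (exp (L * T))\<^sup>2 \<le> (norm (?z 0))\<^sup>2 * (exp (L * T))\<^sup>2"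
    by (rule mult_right_mono) simp
  moreover have "exp (- (2 * L) * T) * (exp (L * T))\<^sup>2 = 1"
    by (simp only: exp_double[symmetric] mult_exp_exp) simp
  ultimately have "(norm (?z T))\<^sup>2 \<le> (exp (L * T) * norm (?z 0))\<^sup>2"
    by (simp only: mult.assoc mult_1_right power_mult_distrib mult.commute[of "(exp (L * T))\<^sup>2"])
  then show ?thesis by (rule power2_le_imp_le) simp
qed

text \<open>Negating both field and time reduces negative times to forward ones.\<close>

lemma integral_curve_uminus:
  assumes "integral_curve u t \<gamma>"
  shows "integral_curve (\<lambda>x. - u x) (- t) (\<lambda>s. \<gamma> (- s))"
  unfolding integral_curve_def
proof
  fix s assume s: "s \<in> closed_segment 0 (- t)"
  have img: "uminus ` closed_segment 0 (- t) = closed_segment 0 t"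
    using closed_segment_linear_image[of "uminus :: real \<Rightarrow> real" 0 "- t"] by (simp add: linear_uminus)
  then have "- s \<in> closed_segment 0 t" using s by blast
  then have "(\<gamma> has_vector_derivative u (\<gamma> (- s))) (at (- s) within closed_segment 0 t)"
    using assms by (auto simp: integral_curve_def)
  then have "(\<gamma> \<circ> uminus has_vector_derivative (-1) *\<^sub>R u (\<gamma> (- s))) (at s within closed_segment 0 (- t))"
    by (intro vector_diff_chain_within)
      (auto simp: img has_vector_derivative_def intro!: derivative_eq_intros)
  then show "((\<lambda>s. \<gamma> (- s)) has_vector_derivative - u (\<gamma> (- s))) (at s within closed_segment 0 (- t))"
    by (simp add: o_def)
qed

text \<open>Smooth fields are Lipschitz only on bounded sets, so the estimate is run on a ball
  containing both compact trajectories.\<close>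

lemma integral_curve_unique:
  fixes u :: "'a::euclidean_space \<Rightarrow> 'a"
  assumes u: "smooth u" and \<gamma>: "integral_curve u t \<gamma>" and \<delta>: "integral_curve u t \<delta>" and 0: "\<gamma> 0 = \<delta> 0"
  shows "\<gamma> t = \<delta> t"
proof -
  have pos: "\<gamma> t = \<delta> t" if u: "smooth u" and \<gamma>: "integral_curve u t \<gamma>" and \<delta>: "integral_curve u t \<delta>"
    and 0: "\<gamma> 0 = \<delta> 0" and t: "0 \<le> t" for u :: "'a \<Rightarrow> 'a" and \<gamma> \<delta> :: "real \<Rightarrow> 'a" and t
  proof -
    have d: "\<And>s. s \<in> {0..t} \<Longrightarrow> (\<gamma> has_vector_derivative u (\<gamma> s)) (at s within {0..t})"
      "\<And>s. s \<in> {0..t} \<Longrightarrow> (\<delta> has_vector_derivative u (\<delta> s)) (at s within {0..t})"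
      using \<gamma> \<delta> t by (auto simp: integral_curve_nonneg)
    have "continuous_on {0..t} \<gamma>" "continuous_on {0..t} \<delta>"
      by (rule vector_derivative_curve_continuous, erule d)+
    then have "bounded (\<gamma> ` {0..t} \<union> \<delta> ` {0..t})"
      by (simp add: compact_imp_bounded compact_continuous_image)
    then obtain R where "\<forall>x\<in>\<gamma> ` {0..t} \<union> \<delta> ` {0..t}. dist 0 x \<le> R"
      unfolding bounded_any_center[of _ 0] by (elim exE)
    then have R: "\<And>s. s \<in> {0..t} \<Longrightarrow> \<gamma> s \<in> cball 0 R" "\<And>s. s \<in> {0..t} \<Longrightarrow> \<delta> s \<in> cball 0 R"
      by auto
    obtain L where "\<And>x y. x \<in> cball 0 R \<Longrightarrow> y \<in> cball 0 R \<Longrightarrow> norm (u x - u y) \<le> L * norm (x - y)"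
      using smooth_lipschitz_cball[OF u] by blast
    then have "norm (\<gamma> t - \<delta> t) \<le> exp (L * t) * norm (\<gamma> 0 - \<delta> 0)"
      using R by (intro gronwall[OF t d]) blast+
    then show ?thesis using 0 by simp
  qed
  show ?thesis
  proof (cases "0 \<le> t")
    case True
    then show ?thesis using pos assms by blast
  next
    case False
    then show ?thesis
      using pos[OF smooth_minus[OF u] integral_curve_uminus[OF \<gamma>] integral_curve_uminus[OF \<delta>]] 0 by simp
  qed
qed

text \<open>Uniqueness makes the set under \<open>the_elem\<close> in \<open>flow\<close> a
  singleton.\<close>

lemma flow_eq:
  fixes u :: "'a::euclidean_space \<Rightarrow> 'a"
  assumes "smooth u" "integral_curve u t \<gamma>"
  shows "flow u t (\<gamma> 0) = Some (\<gamma> t)"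
proof -
  have "{\<delta> t |\<delta>. integral_curve u t \<delta> \<and> \<delta> 0 = \<gamma> 0} = {\<gamma> t}"
    using assms integral_curve_unique by blast
  then show ?thesis using assms(2) by (auto simp: flow_def)
qed

lemma flowE:
  assumes "smooth u" "flow u t x = Some y"
  obtains \<gamma> where "integral_curve u t \<gamma>" "\<gamma> 0 = x" "\<gamma> t = y"
proof -
  obtain \<gamma> where "integral_curve u t \<gamma>" "\<gamma> 0 = x"
    using assms(2) unfolding flow_def by (auto split: if_splits)
  then show thesis using that flow_eq[OF assms(1), of t \<gamma>] assms(2) by auto
qed

lemma flow_uminus:
  assumes "smooth u"
  shows "flow (\<lambda>x. - u x) t x = Some y \<longleftrightarrow> flow u (- t) x = Some y"
proof -
  have *: "flow (\<lambda>x. - u x) (- t) x = Some y" if c: "smooth u" "flow u t x = Some y" for u :: "'a \<Rightarrow> 'a" and t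
  proof -
    obtain \<gamma> where "integral_curve u t \<gamma>" "\<gamma> 0 = x" "\<gamma> t = y" by (rule flowE[OF c])
    then show ?thesis
      using flow_eq[OF smooth_minus[OF c(1)] integral_curve_uminus] by fastforce
  qed
  show ?thesis using *[of u "-t"] *[of "\<lambda>x. - u x" t] assms smooth_minus by auto
qed

text \<open>Moving the time origin to the end point turns the same curve into a backward trajectory.
  Reachability is symmetric for this reason.\<close>

lemma flow_reverse:
  fixes u :: "'a::euclidean_space \<Rightarrow> 'a"
  assumes u: "smooth u" and f: "flow u t x = Some y"
  shows "flow u (- t) y = Some x"
proof -
  obtain \<gamma> where \<gamma>: "integral_curve u t \<gamma>" "\<gamma> 0 = x" "\<gamma> t = y" by (rule flowE[OF u f])
  let ?\<delta> = "\<lambda>s. \<gamma> (t + s)"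
  have "integral_curve u (- t) ?\<delta>"
    unfolding integral_curve_def
  proof
    fix s assume s: "s \<in> closed_segment 0 (- t)"
    have img: "(\<lambda>s. t + s) ` closed_segment 0 (- t) = closed_segment 0 t"
      using closed_segment_translation[of t 0 "- t"] by (simp add: closed_segment_commute)
    then have "t + s \<in> closed_segment 0 t" using s by blast
    then have "(\<gamma> has_vector_derivative u (\<gamma> (t + s))) (at (t + s) within closed_segment 0 t)"
      using \<gamma>(1) by (auto simp: integral_curve_def)
    then have "(\<gamma> \<circ> (\<lambda>s. t + s) has_vector_derivative 1 *\<^sub>R u (\<gamma> (t + s))) (at s within closed_segment 0 (- t))"
      by (intro vector_diff_chain_within)
        (auto simp: img has_vector_derivative_def intro!: derivative_eq_intros)
    then show "(?\<delta> has_vector_derivative u (?\<delta> s)) (at s within closed_segment 0 (- t))"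
      by (simp add: o_def)
  qed
  from flow_eq[OF u this] show ?thesis using \<gamma> by simp
qed

subsection \<open>Local flows\<close>

definition flow_map :: "('a::euclidean_space \<Rightarrow> 'a) \<Rightarrow> real \<Rightarrow> 'a \<Rightarrow> 'a" where
  "flow_map u t x = the (flow u t x)"

lemma integral_curve_subinterval:
  assumes "integral_curve u T \<gamma>" "0 \<le> t" "t \<le> T"
  shows "integral_curve u t \<gamma>"
proof -
  have "(\<gamma> has_vector_derivative u (\<gamma> s)) (at s within {0..t})" if "s \<in> {0..t}" for s
    by (rule has_vector_derivative_within_subset[of _ _ _ "{0..T}"])
      (use that assms in \<open>auto simp: integral_curve_nonneg\<close>)
  then show ?thesis using assms by (simp add: integral_curve_nonneg)
qed

lemma flow_0:
  fixes u :: "'a::euclidean_space \<Rightarrow> 'a"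
  assumes "smooth u"
  shows "flow u 0 x = Some x" "flow_map u 0 x = x"
proof -
  have "integral_curve u 0 (\<lambda>_. x)"
    by (auto simp: integral_curve_def has_vector_derivative_def has_derivative_within_singleton_iff
        bounded_linear_scaleR_left)
  then show "flow u 0 x = Some x" using flow_eq[OF assms] by metis
  then show "flow_map u 0 x = x" by (simp add: flow_map_def)
qed

lemma flow_map_uminus:
  fixes u :: "'a::euclidean_space \<Rightarrow> 'a"
  assumes "smooth u" "flow (\<lambda>x. - u x) t x = Some y"
  shows "flow_map u (- t) x = y" "flow u (- t) x = Some y"
  using flow_uminus[OF assms(1)] assms(2) by (simp_all add: flow_map_def)

text \<open>These uniform short-time estimates are Lipschitz dependence on the start and on time,
  and a first-order expansion in time with quadratic remainder. They yield the derivative of a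
  composite of flows at one point without differentiating the flow in its initial point
  everywhere.\<close>

definition good_flow ::
    "('a::euclidean_space \<Rightarrow> 'a) \<Rightarrow> 'a \<Rightarrow> real \<Rightarrow> real set \<Rightarrow> real \<Rightarrow> bool" where
  "good_flow u a R I C \<longleftrightarrow> (\<forall>t\<in>I. \<forall>x\<in>cball a (R/2).
     flow u t x = Some (flow_map u t x) \<and> flow_map u t x \<in> cball a R \<and>
     (\<forall>y\<in>cball a (R/2). norm (flow_map u t x - flow_map u t y) \<le> C * norm (x - y)) \<and>
     (\<forall>s\<in>I. norm (flow_map u t x - flow_map u s x) \<le> C * \<bar>t - s\<bar>) \<and>
     norm (flow_map u t x - x - t *\<^sub>R u x) \<le> C * t\<^sup>2)"

lemma good_flowD:
  assumes "good_flow u a R I C" "t \<in> I" "x \<in> cball a (R/2)"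
  shows "flow u t x = Some (flow_map u t x)" "flow_map u t x \<in> cball a R"
    "y \<in> cball a (R/2) \<Longrightarrow> norm (flow_map u t x - flow_map u t y) \<le> C * norm (x - y)"
    "s \<in> I \<Longrightarrow> norm (flow_map u t x - flow_map u s x) \<le> C * \<bar>t - s\<bar>"
    "norm (flow_map u t x - x - t *\<^sub>R u x) \<le> C * t\<^sup>2"
  using assms unfolding good_flow_def by blast+

lemma local_flow_nonneg:
  fixes u :: "'a::euclidean_space \<Rightarrow> 'a"
  assumes u: "smooth u" and R: "R > 0"
  shows "\<exists>\<tau>>0. \<exists>C>0. good_flow u a R {0..\<tau>} C"
proof -
  obtain \<tau> where \<tau>: "\<tau> > 0" and ex: "\<And>x. x \<in> cball a (R/2) \<Longrightarrow>
      \<exists>\<gamma>. \<gamma> 0 = x \<and> integral_curve u \<tau> \<gamma> \<and> (\<forall>t\<in>{0..\<tau>}. \<gamma> t \<in> cball a R)"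
    using local_existence[OF u R] by blast
  obtain L where L: "L > 0" "\<And>x y. x \<in> cball a R \<Longrightarrow> y \<in> cball a R \<Longrightarrow> norm (u x - u y) \<le> L * norm (x - y)"
    using smooth_lipschitz_cball[OF u] by blast
  have "bounded (u ` cball a R)"
    by (intro compact_imp_bounded compact_continuous_image smooth_continuous_on u compact_cball)
  then obtain M where M: "M > 0" "\<And>x. x \<in> cball a R \<Longrightarrow> norm (u x) \<le> M"
    unfolding bounded_pos by auto
  \<comment> \<open>The summands are Gronwall's constant, the maximal speed, and a bound for the
    change of velocity per unit time.\<close>
  define C where "C = exp (L * \<tau>) + M + L * M"
  have C: "C > 0" "exp (L * \<tau>) \<le> C" "M \<le> C" "L * M \<le> C"
    using L(1) M(1) by (auto simp: C_def add_pos_pos)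
  have *: "flow u t x = Some (flow_map u t x) \<and> flow_map u t x \<in> cball a R \<and>
     (\<forall>y\<in>cball a (R/2). norm (flow_map u t x - flow_map u t y) \<le> C * norm (x - y)) \<and>
     (\<forall>s\<in>{0..\<tau>}. norm (flow_map u t x - flow_map u s x) \<le> C * \<bar>t - s\<bar>) \<and>
     norm (flow_map u t x - x - t *\<^sub>R u x) \<le> C * t\<^sup>2"
    if t: "t \<in> {0..\<tau>}" and x: "x \<in> cball a (R/2)" for t x
  proof -
    obtain \<gamma> where \<gamma>: "\<gamma> 0 = x" "integral_curve u \<tau> \<gamma>" "\<And>t. t \<in> {0..\<tau>} \<Longrightarrow> \<gamma> t \<in> cball a R"
      using ex[OF x] by blast
    have fl: "flow u s x = Some (\<gamma> s)" if "s \<in> {0..\<tau>}" for s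
      using flow_eq[OF u integral_curve_subinterval[OF \<gamma>(2)], of s] that \<gamma>(1) by auto
    then have fm: "flow_map u s x = \<gamma> s" if "s \<in> {0..\<tau>}" for s
      using that by (simp add: flow_map_def)
    have d: "(\<gamma> has_vector_derivative u (\<gamma> s)) (at s within {0..r})"
      if "s \<in> {0..r}" "r \<le> \<tau>" for s r
      using integral_curve_subinterval[OF \<gamma>(2), of r] that by (auto simp: integral_curve_nonneg)
    have speed: "norm (\<gamma> r - \<gamma> s) \<le> M * \<bar>r - s\<bar>" if "r \<in> {0..\<tau>}" "s \<in> {0..\<tau>}" for r s
      by (rule curve_bound[where T=\<tau>, OF d]) (use that M(2) \<gamma>(3) in auto)
    have "norm (flow_map u t x - flow_map u t y) \<le> C * norm (x - y)" if y: "y \<in> cball a (R/2)" for y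
    proof -
      obtain \<delta> where \<delta>: "\<delta> 0 = y" "integral_curve u \<tau> \<delta>" "\<And>t. t \<in> {0..\<tau>} \<Longrightarrow> \<delta> t \<in> cball a R"
        using ex[OF y] by blast
      have dt: "integral_curve u t \<delta>" using integral_curve_subinterval[OF \<delta>(2)] t by auto
      have "flow_map u t y = \<delta> t"
        using flow_eq[OF u dt] \<delta>(1) by (simp add: flow_map_def)
      moreover have "norm (\<gamma> t - \<delta> t) \<le> exp (L * t) * norm (\<gamma> 0 - \<delta> 0)"
      proof (rule gronwall[where u=u])
        show "\<And>s. s \<in> {0..t} \<Longrightarrow> (\<delta> has_vector_derivative u (\<delta> s)) (at s within {0..t})"
          using dt t by (simp add: integral_curve_nonneg)
      qed (use t d L(2) \<gamma>(3) \<delta>(3) in auto)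
      moreover have "exp (L * t) * norm (\<gamma> 0 - \<delta> 0) \<le> C * norm (\<gamma> 0 - \<delta> 0)"
      proof (rule mult_right_mono)
        have "exp (L * t) \<le> exp (L * \<tau>)" using L(1) t by simp
        then show "exp (L * t) \<le> C" using C(2) by linarith
      qed simp
      ultimately show ?thesis using fm[OF t] \<gamma>(1) \<delta>(1) by simp
    qed
    moreover have "norm (flow_map u t x - flow_map u s x) \<le> C * \<bar>t - s\<bar>" if s: "s \<in> {0..\<tau>}" for s
    proof -
      have "M * \<bar>t - s\<bar> \<le> C * \<bar>t - s\<bar>" using C(3) by (intro mult_right_mono) auto
      then show ?thesis using speed[OF t s] fm[OF t] fm[OF s] by simp
    qed
    moreover have "norm (flow_map u t x - x - t *\<^sub>R u x) \<le> C * t\<^sup>2"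
    proof -
      \<comment> \<open>The curve with its initial linear motion removed has velocity
        \<open>u (\<gamma> s) - u x\<close>, which is at most \<open>L * M * t\<close> up to time
        \<open>t\<close>; a further factor \<open>t\<close> comes from integration.\<close>
      have "norm ((\<gamma> t - t *\<^sub>R u x) - (\<gamma> 0 - 0 *\<^sub>R u x)) \<le> (L * M * t) * \<bar>t - 0\<bar>"
      proof (rule curve_bound[where T=t])
        fix s assume s: "s \<in> {0..t}"
        show "((\<lambda>s. \<gamma> s - s *\<^sub>R u x) has_vector_derivative u (\<gamma> s) - u x) (at s within {0..t})"
          by (rule has_vector_derivative_diff[OF d[OF s]])
            (use t in \<open>auto simp: has_vector_derivative_def intro!: derivative_eq_intros\<close>)
        have s': "s \<in> {0..\<tau>}" using s t by auto
        have "norm (u (\<gamma> s) - u x) \<le> L * norm (\<gamma> s - x)"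
          using L(2)[OF \<gamma>(3)[OF s'] \<gamma>(3)[of 0]] \<tau> \<gamma>(1) by auto
        also have "\<dots> \<le> L * (M * s)"
          using speed[OF s', of 0] \<tau> s \<gamma>(1) L(1) by (intro mult_left_mono) auto
        also have "\<dots> \<le> L * (M * t)" using s L(1) M(1) by (intro mult_left_mono) auto
        finally show "norm (u (\<gamma> s) - u x) \<le> L * M * t" by simp
      qed (use t in auto)
      also have "\<dots> = (L * M) * t\<^sup>2" using t by (simp add: power2_eq_square)
      also have "\<dots> \<le> C * t\<^sup>2" using C(4) by (intro mult_right_mono) auto
      finally show ?thesis using fm[OF t] \<gamma>(1) by (simp add: algebra_simps)
    qed
    ultimately show ?thesis using fl[OF t] fm[OF t] \<gamma>(3)[OF t] by simp
  qed
  have "good_flow u a R {0..\<tau>} C"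
    unfolding good_flow_def by (intro ballI) (rule *)
  then show ?thesis using \<tau> C(1) by blast
qed

lemma good_flow_mono:
  assumes "good_flow u a R I C" "J \<subseteq> I" "C \<le> C'"
  shows "good_flow u a R J C'"
  unfolding good_flow_def
proof (intro ballI conjI)
  fix t x assume t: "t \<in> J" and x: "x \<in> cball a (R/2)"
  have m: "C * r \<le> C' * r" if "0 \<le> r" for r using assms(3) that by (rule mult_right_mono)
  note g = assms(1)[unfolded good_flow_def, rule_format, OF subsetD[OF assms(2) t] x]
  show "flow u t x = Some (flow_map u t x)" "flow_map u t x \<in> cball a R" using g by blast+
  show "norm (flow_map u t x - flow_map u t y) \<le> C' * norm (x - y)" if "y \<in> cball a (R/2)" for y
    using g that m[of "norm (x - y)"] order_trans by (metis norm_ge_zero)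
  show "norm (flow_map u t x - flow_map u s x) \<le> C' * \<bar>t - s\<bar>" if "s \<in> J" for s
    using g that m[of "\<bar>t - s\<bar>"] order_trans assms(2) by (metis abs_ge_zero subsetD)
  show "norm (flow_map u t x - x - t *\<^sub>R u x) \<le> C' * t\<^sup>2"
    using g m[of "t\<^sup>2"] order_trans by (metis zero_le_power2)
qed

text \<open>The forward flows of \<open>u\<close> and of its negative are glued. Only the Lipschitz
  estimate in time mixes signs; times of opposite sign are compared through time 0, where their
  absolute values add up to the difference.\<close>

lemma local_flow:
  fixes u :: "'a::euclidean_space \<Rightarrow> 'a"
  assumes u: "smooth u" and R: "R > 0"
  shows "\<exists>\<tau>>0. \<exists>C>0. good_flow u a R {-\<tau>..\<tau>} C"
proof -
  obtain \<tau>1 C1 where 1: "\<tau>1 > 0" "C1 > 0" "good_flow u a R {0..\<tau>1} C1"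
    using local_flow_nonneg[OF u R] by blast
  obtain \<tau>2 C2 where 2: "\<tau>2 > 0" "C2 > 0" "good_flow (\<lambda>x. - u x) a R {0..\<tau>2} C2"
    using local_flow_nonneg[OF smooth_minus[OF u] R] by blast
  define \<tau> where "\<tau> = min \<tau>1 \<tau>2"
  define C where "C = max C1 C2"
  have P: "good_flow u a R {0..\<tau>} C"
    by (rule good_flow_mono[OF 1(3)]) (auto simp: \<tau>_def C_def)
  have N: "good_flow (\<lambda>x. - u x) a R {0..\<tau>} C"
    by (rule good_flow_mono[OF 2(3)]) (auto simp: \<tau>_def C_def)
  have \<tau>: "\<tau> > 0" "C > 0" using 1 2 by (auto simp: \<tau>_def C_def)
  have neg: "flow_map u (- t) x = flow_map (\<lambda>x. - u x) t x" "flow u (- t) x = Some (flow_map u (- t) x)"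
    if "t \<in> {0..\<tau>}" "x \<in> cball a (R/2)" for t x
    using flow_map_uminus[OF u, of t x] N[unfolded good_flow_def, rule_format, OF that] by auto
  have "good_flow u a R {-\<tau>..\<tau>} C"
    unfolding good_flow_def
  proof (intro ballI)
    fix t x assume t: "t \<in> {-\<tau>..\<tau>}" and x: "x \<in> cball a (R/2)"
    note P' = P[unfolded good_flow_def, rule_format, OF _ x]
    note N' = N[unfolded good_flow_def, rule_format, OF _ x]
    have speed: "norm (flow_map u t x - flow_map u s x) \<le> C * \<bar>t - s\<bar>" if s: "s \<in> {-\<tau>..\<tau>}" for s
    proof -
      have z: "norm (flow_map u r x - x) \<le> C * \<bar>r\<bar>" if r: "r \<in> {-\<tau>..\<tau>}" for r
      proof (cases "0 \<le> r")
        case True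
        then have "norm (flow_map u r x - flow_map u 0 x) \<le> C * \<bar>r - 0\<bar>"
          using r \<tau> True by (intro good_flowD(4)[OF P _ x]) auto
        then show ?thesis by (simp add: flow_0[OF u])
      next
        case False
        then have "norm (flow_map (\<lambda>x. - u x) (- r) x - flow_map (\<lambda>x. - u x) 0 x) \<le> C * \<bar>- r - 0\<bar>"
          using r \<tau> False by (intro good_flowD(4)[OF N _ x]) auto
        then show ?thesis using neg(1)[of "- r" x] False r x by (simp add: flow_0[OF smooth_minus[OF u]])
      qed
      have opp: "norm (flow_map u t x - flow_map u s x) \<le> C * \<bar>t - s\<bar>" if "t * s \<le> 0" 
      proof -
        have "norm (flow_map u t x - flow_map u s x) \<le> norm (flow_map u t x - x) + norm (flow_map u s x - x)"
          using norm_triangle_ineq4[of "flow_map u t x - x" "flow_map u s x - x"] by simp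
        also have "\<dots> \<le> C * \<bar>t\<bar> + C * \<bar>s\<bar>" using z t s by (intro add_mono) auto
        also have "\<dots> = C * (\<bar>t\<bar> + \<bar>s\<bar>)" by (simp add: algebra_simps)
        also have "\<bar>t\<bar> + \<bar>s\<bar> = \<bar>t - s\<bar>" using that by (auto simp: mult_le_0_iff)
        finally show ?thesis .
      qed
      consider "0 \<le> t" "0 \<le> s" | "t \<le> 0" "s \<le> 0" | "t * s \<le> 0"
        by (meson linear mult_nonneg_nonpos mult_nonpos_nonneg)
      then show ?thesis
      proof cases
        case 1
        then show ?thesis using good_flowD(4)[OF P _ x] t s by auto
      next
        case 2
        then have "norm (flow_map (\<lambda>x. - u x) (- t) x - flow_map (\<lambda>x. - u x) (- s) x) \<le> C * \<bar>- t - - s\<bar>"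
          using t s by (intro good_flowD(4)[OF N _ x]) auto
        then show ?thesis using neg(1)[of "- t" x] neg(1)[of "- s" x] 2 t s x
          by (auto simp: abs_minus_commute[of t s])
      qed (rule opp)
    qed
    show "flow u t x = Some (flow_map u t x) \<and> flow_map u t x \<in> cball a R \<and>
     (\<forall>y\<in>cball a (R/2). norm (flow_map u t x - flow_map u t y) \<le> C * norm (x - y)) \<and>
     (\<forall>s\<in>{-\<tau>..\<tau>}. norm (flow_map u t x - flow_map u s x) \<le> C * \<bar>t - s\<bar>) \<and>
     norm (flow_map u t x - x - t *\<^sub>R u x) \<le> C * t\<^sup>2"
    proof (cases "0 \<le> t")
      case True
      then show ?thesis using P'[of t] t speed by auto
    next
      case False
      then have m: "- t \<in> {0..\<tau>}" using t by auto
      have eq: "flow_map u t y = flow_map (\<lambda>x. - u x) (- t) y" if "y \<in> cball a (R/2)" for y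
        using neg(1)[OF m that] by simp
      show ?thesis using N'[OF m] neg(2)[OF m x] speed eq x by auto
    qed
  qed
  then show ?thesis using \<tau> by blast
qed

subsection \<open>Linearization along a trajectory\<close>

lemma bounded_bilinear_matrix_mul:
  "bounded_bilinear ((**) :: real^'n^'m \<Rightarrow> real^'p^'n \<Rightarrow> real^'p^'m)"
  unfolding bilinear_conv_bounded_bilinear[symmetric] bilinear_def linear_iff
  by (auto simp: matrix_matrix_mult_def vec_eq_iff sum.distrib algebra_simps sum_distrib_left)

lemma bounded_bilinear_matrix_vector:
  "bounded_bilinear ((*v) :: real^'n^'m \<Rightarrow> real^'n \<Rightarrow> real^'m)"
  unfolding bilinear_conv_bounded_bilinear[symmetric] bilinear_def linear_iff
  by (auto simp: matrix_vector_mult_def vec_eq_iff sum.distrib algebra_simps sum_distrib_left)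

definition jac_matrix :: "(real^'n \<Rightarrow> real^'n) \<Rightarrow> real^'n \<Rightarrow> real^'n^'n" where
  "jac_matrix u x = matrix (frechet_derivative u (at x))"

lemma jac_matrix_mult: "smooth u \<Longrightarrow> jac_matrix u x *v h = frechet_derivative u (at x) h"
  unfolding jac_matrix_def
  using fun_cong[OF matrix_vector_mul(2)[OF smooth_has_derivative[THEN has_derivative_linear]]] .

lemma smooth_jac_matrix:
  fixes u :: "real^'n \<Rightarrow> real^'n"
  assumes "smooth u"
  shows "smooth (jac_matrix u)"
proof -
  let ?l = "\<lambda>j v. (\<chi> i k. if k = j then v $ i else 0) :: real^'n^'n"
  have l: "linear (?l j)" for j by (auto simp: linear_iff vec_eq_iff)
  have "jac_matrix u = (\<lambda>x. \<Sum>j\<in>UNIV. ?l j (dir_deriv (axis j 1) u x))"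
    by (auto simp: jac_matrix_def matrix_def dir_deriv_def vec_eq_iff)
  then show ?thesis
    using smooth_sum[of UNIV "\<lambda>j x. ?l j (dir_deriv (axis j 1) u x)"]
      smooth_linear_post[OF l smooth_dir_deriv[OF assms]] by simp
qed

text \<open>\<open>M t\<close> is the derivative at \<open>\<xi> t\<close> of the backward flow.\<close>

lemma flow_linearization:
  fixes u :: "real^'n \<Rightarrow> real^'n"
  assumes u: "smooth u"
  shows "\<exists>\<tau>>0. \<exists>r>0. \<exists>C>0. \<exists>\<xi> M. \<xi> 0 = a \<and> M 0 = mat 1 \<and>
    (\<forall>t\<in>{0..\<tau>}. (\<xi> has_vector_derivative u (\<xi> t)) (at t within {0..\<tau>}) \<and>
      (M has_vector_derivative - (M t ** jac_matrix u (\<xi> t))) (at t within {0..\<tau>}) \<and>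
      flow_map u t a = \<xi> t \<and>
      (\<forall>w. norm (w - \<xi> t) \<le> r \<longrightarrow>
        norm (flow_map u (- t) w - a - M t *v (w - \<xi> t)) \<le> C * (norm (w - \<xi> t))\<^sup>2))"
proof -
  \<comment> \<open>Trajectory and matrix are solved together as one autonomous smooth system, so
    the local existence result supplies both. The second component is the adjoint variational
    equation.\<close>
  let ?P = "\<lambda>z::(real^'n) \<times> (real^'n^'n). (u (fst z), - (snd z ** jac_matrix u (fst z)))"
  have lin: "linear (fst :: (real^'n) \<times> (real^'n^'n) \<Rightarrow> _)" "linear (snd :: (real^'n) \<times> (real^'n^'n) \<Rightarrow> _)"
    by (simp_all add: linear_fst linear_snd)
  have "smooth ?P"
    by (intro smooth_Pair smooth_minus smooth_bilinear[OF bounded_bilinear_matrix_mul]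
        smooth_linear_pre[OF lin(1)] u smooth_jac_matrix smooth_linear lin)
  from local_existence[OF this zero_less_one, of "(a, mat 1)"] obtain \<tau>0 \<Gamma> where
    \<tau>0: "\<tau>0 > 0" and \<Gamma>: "\<Gamma> 0 = (a, mat 1)" "integral_curve ?P \<tau>0 \<Gamma>"
      "\<And>t. t \<in> {0..\<tau>0} \<Longrightarrow> \<Gamma> t \<in> cball (a, mat 1) 1"
    by (force simp del: split_paired_All split_paired_Ex)
  define \<xi> where "\<xi> = (\<lambda>t. fst (\<Gamma> t))"
  define M where "M = (\<lambda>t. snd (\<Gamma> t))"
  have \<Gamma>d: "(\<Gamma> has_vector_derivative ?P (\<Gamma> t)) (at t within {0..\<tau>0})" if "t \<in> {0..\<tau>0}" for t
    using \<Gamma>(2) \<tau>0 that by (simp add: integral_curve_nonneg)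
  have \<xi>d: "(\<xi> has_vector_derivative u (\<xi> t)) (at t within {0..\<tau>0})" if "t \<in> {0..\<tau>0}" for t
    using bounded_linear.has_vector_derivative[OF bounded_linear_fst \<Gamma>d[OF that]] by (simp add: \<xi>_def)
  have Md: "(M has_vector_derivative - (M t ** jac_matrix u (\<xi> t))) (at t within {0..\<tau>0})" if "t \<in> {0..\<tau>0}" for t
    using bounded_linear.has_vector_derivative[OF bounded_linear_snd \<Gamma>d[OF that]] by (simp add: M_def \<xi>_def)
  obtain L where L: "L > 0" "\<And>x y. x \<in> cball a 2 \<Longrightarrow> y \<in> cball a 2 \<Longrightarrow> norm (u x - u y) \<le> L * norm (x - y)"
    using smooth_lipschitz_cball[OF u] by blast
  obtain Q where Q: "Q > 0" "\<And>x y. x \<in> cball a 2 \<Longrightarrow> y \<in> cball a 2 \<Longrightarrow>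
      norm (u y - u x - frechet_derivative u (at x) (y - x)) \<le> Q * (norm (y - x))\<^sup>2"
    using smooth_quadratic_remainder[OF u] by blast
  obtain K where K: "\<And>(A::real^'n^'n) v. norm (A *v v) \<le> norm A * norm v * K" "K > 0"
    using bounded_bilinear.pos_bounded[OF bounded_bilinear_matrix_vector] by blast
  define B where "B = norm (mat 1 :: real^'n^'n) + 1"
  have MB: "norm (M t) \<le> B" if "t \<in> {0..\<tau>0}" for t
  proof -
    have "dist (mat 1) (M t) \<le> 1"
      using \<Gamma>(3)[OF that] order_trans[OF dist_snd_le] unfolding M_def by (metis mem_cball snd_conv)
    then show ?thesis
      unfolding B_def using norm_triangle_ineq2[of "M t" "mat 1"] by (simp add: dist_norm norm_minus_commute)
  qed
  have \<xi>B: "\<xi> t \<in> cball a 1" if "t \<in> {0..\<tau>0}" for t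
    using \<Gamma>(3)[OF that] order_trans[OF dist_fst_le] unfolding \<xi>_def by (metis mem_cball fst_conv)
  obtain \<tau>1 where \<tau>1: "\<tau>1 > 0" and ex: "\<And>w. w \<in> cball a (2/2) \<Longrightarrow>
      \<exists>\<gamma>. \<gamma> 0 = w \<and> integral_curve (\<lambda>x. - u x) \<tau>1 \<gamma> \<and> (\<forall>t\<in>{0..\<tau>1}. \<gamma> t \<in> cball a 2)"
    using local_existence[OF smooth_minus[OF u], of 2 a] by auto
  have "continuous_on {0..\<tau>0} \<xi>"
    by (rule vector_derivative_curve_continuous, erule \<xi>d)
  then obtain \<eta> where \<eta>: "\<eta> > 0" "\<And>t. t \<in> {0..\<tau>0} \<Longrightarrow> dist t 0 < \<eta> \<Longrightarrow> dist (\<xi> t) (\<xi> 0) < 1/2"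
    using \<tau>0 unfolding continuous_on_iff by (metis atLeastAtMost_iff half_gt_zero order_less_imp_le order_refl zero_less_one)
  define \<tau> where "\<tau> = min (min \<tau>0 \<tau>1) (\<eta>/2)"
  have \<tau>: "\<tau> > 0" "\<tau> \<le> \<tau>0" "\<tau> \<le> \<tau>1" "\<tau> < \<eta>"
    using \<tau>0 \<tau>1 \<eta>(1) by (auto simp: \<tau>_def)
  define C where "C = B * (Q * (exp (L * \<tau>))\<^sup>2) * K * \<tau>"
  have B: "B > 0" by (simp add: B_def add_nonneg_pos)
  have C: "C > 0" using B Q(1) K(2) \<tau>(1) by (simp add: C_def)
  have \<xi>0: "\<xi> 0 = a" "M 0 = mat 1" using \<Gamma>(1) by (simp_all add: \<xi>_def M_def)
  have lin: "norm (flow_map u (- t) w - a - M t *v (w - \<xi> t)) \<le> C * (norm (w - \<xi> t))\<^sup>2"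
    if t: "t \<in> {0..\<tau>}" and w: "norm (w - \<xi> t) \<le> 1/2" for t w
  proof -
    have "dist (\<xi> t) (\<xi> 0) < 1/2" using t \<tau> by (intro \<eta>(2)) auto
    then have "dist a w \<le> 1"
      using w dist_triangle[of a w "\<xi> t"] \<xi>0 by (simp add: dist_norm norm_minus_commute)
    then obtain y where y: "y 0 = w" "integral_curve (\<lambda>x. - u x) \<tau>1 y" "\<And>t. t \<in> {0..\<tau>1} \<Longrightarrow> y t \<in> cball a 2"
      using ex[of w] by auto
    have yt: "integral_curve (\<lambda>x. - u x) t y"
      using integral_curve_subinterval[OF y(2)] t \<tau> by auto
    have fy: "flow_map u (- t) w = y t"
      using flow_map_uminus(1)[OF u flow_eq[OF smooth_minus[OF u] yt]] y(1) by simp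
    have yd: "(y has_vector_derivative - u (y s)) (at s within {0..t})" if "s \<in> {0..t}" for s
      using yt t that by (simp add: integral_curve_nonneg)
    \<comment> \<open>Time is reversed: \<open>y\<close> is the backward trajectory from
      \<open>w\<close>, to be compared with the backward run of \<open>\<xi>\<close> from
      \<open>\<xi> t\<close> to \<open>a\<close>.\<close>
    let ?x = "\<lambda>s. \<xi> (t - s)" and ?M = "\<lambda>s. M (t - s)"
    have rev: "((\<lambda>s. f (t - s)) has_vector_derivative - f') (at s within {0..t})"
      if "s \<in> {0..t}" "(f has_vector_derivative f') (at (t - s) within {0..\<tau>0})"
      for f :: "real \<Rightarrow> 'b::real_normed_vector" and f' s
    proof -
      have "(f \<circ> (\<lambda>s. t - s) has_vector_derivative (-1) *\<^sub>R f') (at s within {0..t})"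
      proof (rule vector_diff_chain_within)
        show "((\<lambda>s. t - s) has_vector_derivative - 1) (at s within {0..t})"
          by (auto simp: has_vector_derivative_def intro!: derivative_eq_intros)
        show "(f has_vector_derivative f') (at (t - s) within (\<lambda>s. t - s) ` {0..t})"
          by (rule has_vector_derivative_within_subset[OF that(2)]) (use t \<tau> in auto)
      qed
      then show ?thesis by (simp add: o_def)
    qed
    have mem: "t - s \<in> {0..\<tau>0}" if "s \<in> {0..t}" for s using that t \<tau> by auto
    have xd: "(?x has_vector_derivative - u (?x s)) (at s within {0..t})" if "s \<in> {0..t}" for s
      by (rule rev[OF that \<xi>d[OF mem[OF that]]])
    have Md': "(?M has_vector_derivative ?M s ** jac_matrix u (?x s)) (at s within {0..t})" if "s \<in> {0..t}" for s
      using rev[OF that Md[OF mem[OF that]]] by simp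
    have inb: "?x s \<in> cball a 2" "y s \<in> cball a 2" if "s \<in> {0..t}" for s
      using \<xi>B[OF mem[OF that]] y(3)[of s] that t \<tau> by auto
    have near: "norm (y s - ?x s) \<le> exp (L * \<tau>) * norm (w - \<xi> t)" if s: "s \<in> {0..t}" for s
    proof -
      have sub: "{0..s} \<subseteq> {0..t}" using s by auto
      have "norm (y s - ?x s) \<le> exp (L * s) * norm (y 0 - ?x 0)"
      proof (rule gronwall[where u="\<lambda>x. - u x"])
        fix r assume r: "r \<in> {0..s}"
        then have r': "r \<in> {0..t}" using sub by blast
        show "(y has_vector_derivative - u (y r)) (at r within {0..s})"
          "(?x has_vector_derivative - u (?x r)) (at r within {0..s})"
          using yd[OF r'] xd[OF r'] sub has_vector_derivative_within_subset by blast+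
        show "norm (- u (y r) - - u (?x r)) \<le> L * norm (y r - ?x r)"
          using L(2)[OF inb(2)[OF r'] inb(1)[OF r']] by (simp add: norm_minus_commute)
      qed (use s in auto)
      also have "\<dots> \<le> exp (L * \<tau>) * norm (y 0 - ?x 0)"
        using s t L(1) by (intro mult_right_mono) auto
      finally show ?thesis using y(1) by simp
    qed
    \<comment> \<open>The terms linear in the deviation cancel in the derivative of
      \<open>?z\<close>, leaving \<open>M\<close> applied to a quadratic Taylor remainder of
      \<open>u\<close>. The end values are \<open>M t *v (w - \<xi> t)\<close> and, because
      \<open>M 0\<close> is the identity, \<open>y t - a\<close>.\<close>
    let ?z = "\<lambda>s. ?M s *v (y s - ?x s)"
    have "norm (?z t - ?z 0) \<le> (B * (Q * (exp (L * \<tau>) * norm (w - \<xi> t))\<^sup>2) * K) * \<bar>t - 0\<bar>"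
    proof (rule curve_bound[where T=t and \<gamma>="?z"])
      fix s assume s: "s \<in> {0..t}"
      have "(?z has_vector_derivative
          ?M s *v (- u (y s) - - u (?x s)) + (?M s ** jac_matrix u (?x s)) *v (y s - ?x s)) (at s within {0..t})"
        by (rule bounded_bilinear.has_vector_derivative[OF bounded_bilinear_matrix_vector Md'[OF s]
              has_vector_derivative_diff[OF yd[OF s] xd[OF s]]])
      then show "(?z has_vector_derivative
          - (?M s *v (u (y s) - u (?x s) - frechet_derivative u (at (?x s)) (y s - ?x s)))) (at s within {0..t})"
        by (simp add: linear_diff[OF has_derivative_linear[OF smooth_has_derivative[OF u]]]
            matrix_vector_mul_assoc[symmetric] jac_matrix_mult[OF u] matrix_vector_mult_diff_distrib
            matrix_vector_right_distrib algebra_simps)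
      have "norm (?M s *v (u (y s) - u (?x s) - frechet_derivative u (at (?x s)) (y s - ?x s))) \<le>
          norm (?M s) * norm (u (y s) - u (?x s) - frechet_derivative u (at (?x s)) (y s - ?x s)) * K"
        by (rule K(1))
      also have "\<dots> \<le> B * (Q * (exp (L * \<tau>) * norm (w - \<xi> t))\<^sup>2) * K"
      proof (intro mult_right_mono mult_mono MB mem s)
        have "norm (u (y s) - u (?x s) - frechet_derivative u (at (?x s)) (y s - ?x s)) \<le> Q * (norm (y s - ?x s))\<^sup>2"
          by (rule Q(2)[OF inb[OF s]])
        also have "\<dots> \<le> Q * (exp (L * \<tau>) * norm (w - \<xi> t))\<^sup>2"
          using near[OF s] Q(1) by (intro mult_left_mono power_mono) auto
        finally show "norm (u (y s) - u (?x s) - frechet_derivative u (at (?x s)) (y s - ?x s)) \<le>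
            Q * (exp (L * \<tau>) * norm (w - \<xi> t))\<^sup>2" .
      qed (use B K in auto)
      finally show "norm (- (?M s *v (u (y s) - u (?x s) - frechet_derivative u (at (?x s)) (y s - ?x s)))) \<le>
          B * (Q * (exp (L * \<tau>) * norm (w - \<xi> t))\<^sup>2) * K" by simp
    qed (use t in auto)
    also have "\<dots> \<le> (B * (Q * (exp (L * \<tau>) * norm (w - \<xi> t))\<^sup>2) * K) * \<tau>"
      using t B Q(1) K(2) by (intro mult_left_mono) auto
    also have "\<dots> = C * (norm (w - \<xi> t))\<^sup>2"
      by (simp add: C_def power_mult_distrib mult_ac)
    finally show ?thesis using \<xi>0 y(1) fy by (simp add: algebra_simps)
  qed
  have "flow_map u t a = \<xi> t" if "t \<in> {0..\<tau>}" for t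
  proof -
    have "integral_curve u \<tau>0 \<xi>" using \<xi>d \<tau>0 by (simp add: integral_curve_nonneg)
    then have "integral_curve u t \<xi>" using integral_curve_subinterval that \<tau> by fastforce
    from flow_eq[OF u this] show ?thesis using \<xi>0 by (simp add: flow_map_def)
  qed
  moreover have "(\<xi> has_vector_derivative u (\<xi> t)) (at t within {0..\<tau>})"
    "(M has_vector_derivative - (M t ** jac_matrix u (\<xi> t))) (at t within {0..\<tau>})" if "t \<in> {0..\<tau>}" for t
    using has_vector_derivative_within_subset[OF \<xi>d, of t "{0..\<tau>}"]
      has_vector_derivative_within_subset[OF Md, of t "{0..\<tau>}"] that \<tau> by auto
  ultimately show ?thesis
    using \<xi>0 lin C \<tau>(1)
    by (intro exI[of _ \<tau>] exI[of _ "1/2"] exI[of _ C] exI[of _ \<xi>] exI[of _ M] conjI) auto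
qed

text \<open>The derivative of \<open>M t *v B (\<xi> t)\<close> is \<open>M t *v [u, B] (\<xi> t)\<close>.\<close>

lemma annihilates_iter_bracket:
  fixes u v :: "real^'n \<Rightarrow> real^'n"
  assumes u: "smooth u" and v: "smooth v" and \<tau>: "\<tau> > 0"
    and \<xi>: "\<And>t. t \<in> {0..\<tau>} \<Longrightarrow> (\<xi> has_vector_derivative u (\<xi> t)) (at t within {0..\<tau>})"
    and M: "\<And>t. t \<in> {0..\<tau>} \<Longrightarrow> (M has_vector_derivative - (M t ** jac_matrix u (\<xi> t))) (at t within {0..\<tau>})"
    and p: "\<And>t. t \<in> {0..\<tau>} \<Longrightarrow> p \<bullet> (M t *v v (\<xi> t)) = 0"
  shows "t \<in> {0..\<tau>} \<Longrightarrow> p \<bullet> (M t *v iter_bracket u v j (\<xi> t)) = 0"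
proof (induction j arbitrary: t)
  case 0
  then show ?case using p by simp
next
  case (Suc j)
  let ?B = "iter_bracket u v j"
  have B: "smooth ?B" using u v by (rule smooth_iter_bracket)
  have "(?B \<circ> \<xi> has_vector_derivative frechet_derivative ?B (at (\<xi> t)) (u (\<xi> t))) (at t within {0..\<tau>})"
    by (rule vector_derivative_diff_chain_within[OF \<xi>[OF Suc.prems]
          has_derivative_at_withinI[OF smooth_has_derivative[OF B]]])
  from bounded_bilinear.has_vector_derivative[OF bounded_bilinear_matrix_vector M[OF Suc.prems] this]
  have "((\<lambda>t. M t *v ?B (\<xi> t)) has_vector_derivative M t *v iter_bracket u v (Suc j) (\<xi> t)) (at t within {0..\<tau>})"
    by (simp add: o_def lie_bracket_def deriv_along_def bounded_bilinear.minus_left[OF bounded_bilinear_matrix_vector] jac_matrix_mult[OF u] matrix_vector_mul_assoc[symmetric]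
        matrix_vector_mult_diff_distrib)
  from bounded_linear.has_vector_derivative[OF bounded_linear_inner_right[of p] this]
  have "((\<lambda>t. p \<bullet> (M t *v ?B (\<xi> t))) has_vector_derivative p \<bullet> (M t *v iter_bracket u v (Suc j) (\<xi> t)))
      (at t within {0..\<tau>})" .
  \<comment> \<open>By the induction hypothesis the differentiated function is identically zero on
    the interval, so its one possible derivative there is 0.\<close>
  then have "((\<lambda>t. 0) has_vector_derivative p \<bullet> (M t *v iter_bracket u v (Suc j) (\<xi> t))) (at t within {0..\<tau>})"
    by (rule has_vector_derivative_transform[OF Suc.prems, rotated]) (use Suc.IH in auto)
  then show ?case
    using vector_derivative_unique_within_closed_interval[of 0 \<tau> t "\<lambda>_. 0"] \<tau> Suc.prems
    by (metis box_real(2) has_vector_derivative_const)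
qed

section \<open>Local controllability\<close>

text \<open>The derivative is the identity in the state variable, so under composition the
  derivatives add and each move contributes its own direction \<open>b\<close>.\<close>

definition steering_move ::
    "('a::euclidean_space \<Rightarrow> 'a \<Rightarrow> bool) \<Rightarrow> 'a \<Rightarrow> 'a \<Rightarrow> (real \<Rightarrow> 'a \<Rightarrow> 'a) \<Rightarrow> bool" where
  "steering_move rch a b \<mu> \<longleftrightarrow> \<mu> 0 a = a \<and>
     (\<exists>r>0. continuous_on ({-r<..<r} \<times> ball a r) (\<lambda>z. \<mu> (fst z) (snd z)) \<and>
       (\<forall>s\<in>{-r<..<r}. \<forall>y\<in>ball a r. rch y (\<mu> s y))) \<and>
     ((\<lambda>z. \<mu> (fst z) (snd z)) has_derivative (\<lambda>z. snd z + fst z *\<^sub>R b)) (at (0, a))"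

lemma steering_move_translation:
  assumes "\<And>s y. rch y (y + s *\<^sub>R d)"
  shows "steering_move rch a d (\<lambda>s y. y + s *\<^sub>R d)"
  unfolding steering_move_def
  by (intro conjI exI[of _ 1])
    (auto intro!: continuous_intros derivative_eq_intros simp: assms)

lemma has_derivative_quadratic:
  assumes l: "bounded_linear f'" and r: "r > 0"
    and rem: "\<And>z. norm (z - x) < r \<Longrightarrow> norm (f z - f x - f' (z - x)) \<le> D * (norm (z - x))\<^sup>2"
  shows "(f has_derivative f') (at x)"
  unfolding has_derivative_at_alt
proof (intro conjI l allI impI)
  fix e :: real assume e: "e > 0"
  define d where "d = min r (e / (\<bar>D\<bar> + 1))"
  have "norm (f z - f x - f' (z - x)) \<le> e * norm (z - x)" if z: "norm (z - x) < d" for z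
  proof -
    have "(\<bar>D\<bar> + 1) * norm (z - x) \<le> (\<bar>D\<bar> + 1) * (e / (\<bar>D\<bar> + 1))"
      using z by (intro mult_left_mono) (auto simp: d_def)
    then have D: "(\<bar>D\<bar> + 1) * norm (z - x) \<le> e" by simp
    have "D * norm (z - x) \<le> (\<bar>D\<bar> + 1) * norm (z - x)" by (intro mult_right_mono) auto
    also note D
    finally have "D * norm (z - x) * norm (z - x) \<le> e * norm (z - x)"
      by (intro mult_right_mono) auto
    then show ?thesis using rem[of z] z by (simp add: d_def power2_eq_square mult.assoc)
  qed
  moreover have "d > 0" using e r by (simp add: d_def)
  ultimately show "\<exists>d>0. \<forall>y. norm (y - x) < d \<longrightarrow> norm (f y - f x - f' (y - x)) \<le> e * norm (y - x)"
    by blast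
qed

text \<open>The move follows \<open>u\<close> for time \<open>t\<close>, then \<open>v\<close> for
  time \<open>s\<close>, then \<open>u\<close> backwards for time \<open>t\<close>; its velocity in
  \<open>s\<close> is \<open>v x\<close> carried back by \<open>M\<close>. The forward flow of
  \<open>u\<close> is expanded indirectly: the backward linearization is applied to its image point,
  which the backward flow returns to the start.\<close>

lemma steering_move_conjugated_flow:
  fixes u v :: "real^'n \<Rightarrow> real^'n"
  assumes u: "smooth u" and v: "smooth v"
    and trans: "\<And>x y z. rch x y \<Longrightarrow> rch y z \<Longrightarrow> rch x z"
    and Ru: "\<And>t x y. flow u t x = Some y \<Longrightarrow> rch x y"
    and Rv: "\<And>t x y. flow v t x = Some y \<Longrightarrow> rch x y"
    and gu: "good_flow u a 4 {-\<tau>..\<tau>} Cu" and Cu: "Cu > 0" "Cu * \<tau> \<le> 1/2"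
    and t: "t \<in> {0..\<tau>}" and x: "flow_map u t a = x" and r0: "r0 > 0"
    and lin: "\<And>w. norm (w - x) \<le> r0 \<Longrightarrow>
        norm (flow_map u (- t) w - a - M *v (w - x)) \<le> C * (norm (w - x))\<^sup>2"
    and C: "C > 0"
  shows "\<exists>\<mu>. steering_move rch a (M *v v x) \<mu>"
proof -
  obtain \<tau>v Cv where \<tau>v: "\<tau>v > 0" and Cv: "Cv > 0" and gv: "good_flow v a 4 {-\<tau>v..\<tau>v} Cv"
    using local_flow[OF v, of 4 a] by auto
  obtain L where L: "L > 0" "\<And>x y. x \<in> cball a 2 \<Longrightarrow> y \<in> cball a 2 \<Longrightarrow> norm (v x - v y) \<le> L * norm (x - y)"
    using smooth_lipschitz_cball[OF v] by blast
  obtain K where K: "\<And>(A::real^'n^'n) h. norm (A *v h) \<le> norm A * norm h * K" "K > 0"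
    using bounded_bilinear.pos_bounded[OF bounded_bilinear_matrix_vector] by blast
  \<comment> \<open>These bounds keep \<open>\<phi> y\<close> within distance 1 of \<open>a\<close>,
    keep the subsequent flow of \<open>v\<close> in the ball of radius 2 where the estimates hold,
    and keep both points within \<open>r0\<close> of \<open>x\<close>, as the linearization
    requires.\<close>
  define r where "r = Min {1, \<tau>v, 1 / (2 * Cu), 1 / (2 * Cv), r0 / (Cu + Cv)}"
  have r: "r > 0" "r \<le> 1" "r \<le> \<tau>v" "r \<le> 1 / (2 * Cu)" "r \<le> 1 / (2 * Cv)" "r \<le> r0 / (Cu + Cv)"
    using \<tau>v Cu Cv r0 by (simp_all add: r_def)
  have rC: "Cu * r \<le> 1/2" "Cv * r \<le> 1/2" "(Cu + Cv) * r \<le> r0"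
    using r(4-6) Cu(1) Cv by (simp_all add: pos_le_divide_eq mult_ac)
  let ?I = "{-r<..<r}"
  have t': "t \<in> {-\<tau>..\<tau>}" "- t \<in> {-\<tau>..\<tau>}" "0 \<in> {-\<tau>..\<tau>}" using t by auto
  have a: "a \<in> cball a (4/2)" by simp
  have ax: "norm (x - a) \<le> 1/2"
  proof -
    have "norm (flow_map u t a - flow_map u 0 a) \<le> Cu * \<bar>t - 0\<bar>"
      by (rule good_flowD(4)[OF gu t'(1) a t'(3)])
    also have "\<dots> \<le> Cu * \<tau>" using t Cu(1) by (intro mult_left_mono) auto
    finally show ?thesis using Cu(2) by (simp add: x flow_0[OF u])
  qed
  define \<phi> where "\<phi> = flow_map u t"
  define \<psi> where "\<psi> = flow_map v"
  define \<mu> where "\<mu> = (\<lambda>s y. flow_map u (- t) (\<psi> s (\<phi> y)))"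
  have yb: "y \<in> cball a (4/2)" if "y \<in> ball a r" for y using that r(2) by auto
  have \<phi>lip: "norm (\<phi> y - \<phi> y') \<le> Cu * norm (y - y')" if "y \<in> ball a r" "y' \<in> ball a r" for y y'
    unfolding \<phi>_def using good_flowD(3)[OF gu t'(1) yb yb] that by blast
  have \<phi>x: "norm (\<phi> y - x) \<le> Cu * norm (y - a)" if "y \<in> ball a r" for y
    using \<phi>lip[OF that, of a] r(1) by (simp add: \<phi>_def x)
  have \<phi>b1: "\<phi> y \<in> cball a 1" if y: "y \<in> ball a r" for y
  proof -
    have "Cu * norm (y - a) \<le> Cu * r"
      using y Cu(1) by (intro mult_left_mono) (auto simp: dist_norm norm_minus_commute)
    then have "norm (\<phi> y - x) \<le> 1/2" using \<phi>x[OF y] rC(1) by linarith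
    then show ?thesis using ax norm_triangle_ineq[of "\<phi> y - x" "x - a"]
      by (simp add: dist_norm norm_minus_commute)
  qed
  then have \<phi>b: "\<phi> y \<in> cball a (4/2)" if "y \<in> ball a r" for y
    using that by fastforce
  have sI: "s \<in> {-\<tau>v..\<tau>v}" if "s \<in> ?I" for s using that r(3) by auto
  have \<psi>0: "\<psi> 0 w = w" for w by (simp add: \<psi>_def flow_0[OF v])
  have \<psi>s: "norm (\<psi> s w - \<psi> s' w) \<le> Cv * \<bar>s - s'\<bar>" if "s \<in> ?I" "s' \<in> ?I" "w \<in> cball a (4/2)" for s s' w
    unfolding \<psi>_def by (rule good_flowD(4)[OF gv sI[OF that(1)] that(3) sI[OF that(2)]])
  have \<psi>w: "norm (\<psi> s w - w) \<le> Cv * \<bar>s\<bar>" if "s \<in> ?I" "w \<in> cball a (4/2)" for s w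
    using \<psi>s[OF that(1) _ that(2), of 0] r(1) by (simp add: \<psi>0)
  have \<psi>b: "\<psi> s (\<phi> y) \<in> cball a (4/2)" if "s \<in> ?I" "y \<in> ball a r" for s y
  proof -
    have "Cv * \<bar>s\<bar> \<le> Cv * r" using that(1) Cv by (intro mult_left_mono) auto
    then have "norm (\<psi> s (\<phi> y) - \<phi> y) \<le> 1/2" using \<psi>w[OF that(1) \<phi>b[OF that(2)]] rC(2) by linarith
    then show ?thesis using \<phi>b1[OF that(2)] norm_triangle_ineq[of "\<psi> s (\<phi> y) - \<phi> y" "\<phi> y - a"]
      by (simp add: dist_norm norm_minus_commute)
  qed
  have \<psi>lip: "norm (\<psi> s w - \<psi> s w') \<le> Cv * norm (w - w')"
    if "s \<in> ?I" "w \<in> cball a (4/2)" "w' \<in> cball a (4/2)" for s w w'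
    unfolding \<psi>_def by (rule good_flowD(3)[OF gv sI[OF that(1)] that(2,3)])
  have undo: "flow_map u (- t) (\<phi> y) = y" if "y \<in> ball a r" for y
    using flow_reverse[OF u good_flowD(1)[OF gu t'(1) yb[OF that]]]
    by (simp add: \<phi>_def flow_map_def)
  have 0: "\<mu> 0 a = a" using undo[of a] r(1) by (simp add: \<mu>_def \<psi>0)
  have "continuous_on (?I \<times> ball a r) (\<lambda>z. \<mu> (fst z) (snd z))"
  proof (rule lipschitz_on_continuous_on)
    show "(Cu * (Cv + Cv * Cu))-lipschitz_on (?I \<times> ball a r) (\<lambda>z. \<mu> (fst z) (snd z))"
    proof (rule lipschitz_onI)
      fix z z' assume z: "z \<in> ?I \<times> ball a r" and z': "z' \<in> ?I \<times> ball a r"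
      obtain s y s' y' where zz: "z = (s, y)" "z' = (s', y')" by (cases z, cases z')
      have m: "s \<in> ?I" "y \<in> ball a r" "s' \<in> ?I" "y' \<in> ball a r" using z z' zz by auto
      have d: "\<bar>s - s'\<bar> \<le> dist z z'" "norm (y - y') \<le> dist z z'"
        using dist_fst_le[of z z'] dist_snd_le[of z z'] by (simp_all add: zz dist_norm)
      have "dist (\<mu> s y) (\<mu> s' y') \<le> Cu * norm (\<psi> s (\<phi> y) - \<psi> s' (\<phi> y'))"
        unfolding \<mu>_def dist_norm by (rule good_flowD(3)[OF gu t'(2) \<psi>b \<psi>b]) (use m in auto)
      also have "\<dots> \<le> Cu * (Cv * dist z z' + Cv * (Cu * dist z z'))"
      proof (rule mult_left_mono)
        have "norm (\<psi> s (\<phi> y) - \<psi> s' (\<phi> y')) \<le>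
            norm (\<psi> s (\<phi> y) - \<psi> s' (\<phi> y)) + norm (\<psi> s' (\<phi> y) - \<psi> s' (\<phi> y'))"
          using norm_triangle_ineq[of "\<psi> s (\<phi> y) - \<psi> s' (\<phi> y)" "\<psi> s' (\<phi> y) - \<psi> s' (\<phi> y')"] by simp
        also have "\<dots> \<le> Cv * \<bar>s - s'\<bar> + Cv * norm (\<phi> y - \<phi> y')"
          using m by (intro add_mono \<psi>s \<psi>lip \<phi>b) auto
        also have "\<dots> \<le> Cv * dist z z' + Cv * (Cu * dist z z')"
        proof (intro add_mono mult_left_mono)
          have "norm (\<phi> y - \<phi> y') \<le> Cu * norm (y - y')" by (rule \<phi>lip[OF m(2,4)])
          also have "\<dots> \<le> Cu * dist z z'" using d(2) Cu(1) by (intro mult_left_mono) auto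
          finally show "norm (\<phi> y - \<phi> y') \<le> Cu * dist z z'" .
        qed (use d Cv in auto)
        finally show "norm (\<psi> s (\<phi> y) - \<psi> s' (\<phi> y')) \<le> Cv * dist z z' + Cv * (Cu * dist z z')" .
      qed (use Cu in auto)
      also have "\<dots> = Cu * (Cv + Cv * Cu) * dist z z'" by (simp add: algebra_simps)
      finally show "dist (\<mu> (fst z) (snd z)) (\<mu> (fst z') (snd z')) \<le> Cu * (Cv + Cv * Cu) * dist z z'"
        by (simp add: zz)
    qed (use Cu Cv in auto)
  qed
  moreover have "rch y (\<mu> s y)" if "s \<in> ?I" "y \<in> ball a r" for s y
  proof -
    have "rch y (\<phi> y)" unfolding \<phi>_def by (rule Ru[OF good_flowD(1)[OF gu t'(1) yb[OF that(2)]]])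
    moreover have "rch (\<phi> y) (\<psi> s (\<phi> y))"
      unfolding \<psi>_def by (rule Rv[OF good_flowD(1)[OF gv sI[OF that(1)] \<phi>b[OF that(2)]]])
    moreover have "rch (\<psi> s (\<phi> y)) (\<mu> s y)"
      unfolding \<mu>_def by (rule Ru[OF good_flowD(1)[OF gu t'(2) \<psi>b[OF that]]])
    ultimately show ?thesis using trans by blast
  qed
  moreover have "((\<lambda>z. \<mu> (fst z) (snd z)) has_derivative (\<lambda>z. snd z + fst z *\<^sub>R (M *v v x))) (at (0, a))"
  proof (rule has_derivative_quadratic[OF _ r(1)])
    show "bounded_linear (\<lambda>z. snd z + fst z *\<^sub>R (M *v v x))"
      by (intro bounded_linear_intros)
    fix z :: "real \<times> (real^'n)" assume "norm (z - (0, a)) < r"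
    moreover obtain s y where z: "z = (s, y)" by (cases z)
    ultimately have nz: "norm (s, y - a) < r" by simp
    define N where "N = norm (s, y - a)"
    have N: "\<bar>s\<bar> \<le> N" "norm (y - a) \<le> N" "0 \<le> N" "N < r"
      using norm_fst_le[of s "y - a"] norm_snd_le[of "y - a" s] nz by (auto simp: N_def)
    have m: "s \<in> ?I" "y \<in> ball a r"
      using N by (auto simp: dist_norm norm_minus_commute)
    let ?q = "\<phi> y" and ?w = "\<psi> s (\<phi> y)"
    have w0: "norm (?q - x) \<le> Cu * N"
      using \<phi>x[OF m(2)] N(2) Cu(1) by (meson mult_left_mono order_less_imp_le order_trans)
    have ww0: "norm (?w - ?q) \<le> Cv * N"
      using \<psi>w[OF m(1) \<phi>b[OF m(2)]] N(1) Cv by (meson mult_left_mono order_less_imp_le order_trans)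
    have wx: "norm (?w - x) \<le> (Cu + Cv) * N"
      using norm_triangle_ineq[of "?w - ?q" "?q - x"] w0 ww0 by (simp add: algebra_simps)
    have Nr: "(Cu + Cv) * N \<le> r0"
    proof -
      have "(Cu + Cv) * N \<le> (Cu + Cv) * r" using N Cu Cv by (intro mult_left_mono) auto
      then show ?thesis using rC(3) by linarith
    qed
    have "Cu * N \<le> (Cu + Cv) * N" using N Cv by (simp add: algebra_simps)
    then have w0r: "norm (?q - x) \<le> r0" using w0 Nr by linarith
    have E1: "norm (\<mu> s y - a - M *v (?w - x)) \<le> C * ((Cu + Cv) * N)\<^sup>2"
    proof -
      have "norm (\<mu> s y - a - M *v (?w - x)) \<le> C * (norm (?w - x))\<^sup>2"
        unfolding \<mu>_def using lin[of ?w] wx Nr by linarith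
      also have "\<dots> \<le> C * ((Cu + Cv) * N)\<^sup>2" using wx C by (intro mult_left_mono power_mono) auto
      finally show ?thesis .
    qed
    have E2: "norm (y - a - M *v (?q - x)) \<le> C * (Cu * N)\<^sup>2"
    proof -
      have "norm (y - a - M *v (?q - x)) \<le> C * (norm (?q - x))\<^sup>2"
        using lin[OF w0r] undo[OF m(2)] by simp
      also have "\<dots> \<le> C * (Cu * N)\<^sup>2" using w0 C by (intro mult_left_mono power_mono) auto
      finally show ?thesis .
    qed
    have E3: "norm (?w - ?q - s *\<^sub>R v x) \<le> (Cv + L * Cu) * N\<^sup>2"
    proof -
      have "norm (?w - ?q - s *\<^sub>R v ?q) \<le> Cv * s\<^sup>2"
        unfolding \<psi>_def by (rule good_flowD(5)[OF gv sI[OF m(1)] \<phi>b[OF m(2)]])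
      also have "\<dots> \<le> Cv * N\<^sup>2"
        using N Cv by (intro mult_left_mono) (auto simp: abs_le_square_iff[symmetric])
      finally have 1: "norm (?w - ?q - s *\<^sub>R v ?q) \<le> Cv * N\<^sup>2" .
      have "x \<in> cball a 2" using ax by (simp add: dist_norm norm_minus_commute)
      then have "norm (v ?q - v x) \<le> L * norm (?q - x)"
        using L(2) \<phi>b[OF m(2)] by simp
      also have "\<dots> \<le> L * (Cu * N)" using w0 L(1) by (intro mult_left_mono) auto
      finally have "\<bar>s\<bar> * norm (v ?q - v x) \<le> N * (L * (Cu * N))"
        using N by (intro mult_mono) auto
      then have 2: "norm (s *\<^sub>R (v ?q - v x)) \<le> L * Cu * N\<^sup>2"
        by (simp add: power2_eq_square mult_ac)
      have "?w - ?q - s *\<^sub>R v x = (?w - ?q - s *\<^sub>R v ?q) + s *\<^sub>R (v ?q - v x)"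
        by (simp add: algebra_simps)
      then show ?thesis using 1 2 norm_triangle_ineq by (smt (verit, best) distrib_right)
    qed
    have ME: "norm (M *v (?w - ?q - s *\<^sub>R v x)) \<le> norm M * ((Cv + L * Cu) * N\<^sup>2) * K"
      using K E3 by (meson mult_left_mono mult_right_mono norm_ge_zero order_less_imp_le order_trans)
    \<comment> \<open>The linearization is applied at \<open>?w\<close> and at \<open>?q\<close> and
      the results are subtracted. What remains is \<open>M\<close> applied to the time expansion of
      the flow of \<open>v\<close>.\<close>
    have eq: "\<mu> s y - a - ((y - a) + s *\<^sub>R (M *v v x)) =
        (\<mu> s y - a - M *v (?w - x)) - (y - a - M *v (?q - x)) + M *v (?w - ?q - s *\<^sub>R v x)"
      by (simp add: matrix_vector_mult_diff_distrib matrix_vector_mult_scaleR algebra_simps)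
    have "norm (\<mu> s y - a - ((y - a) + s *\<^sub>R (M *v v x))) \<le>
        C * ((Cu + Cv) * N)\<^sup>2 + C * (Cu * N)\<^sup>2 + norm M * ((Cv + L * Cu) * N\<^sup>2) * K"
    proof -
      have "norm (A - B + D) \<le> norm A + norm B + norm D" for A B D :: "real^'n"
        using norm_triangle_ineq[of "A - B" D] norm_triangle_ineq4[of A B] by linarith
      then show ?thesis unfolding eq using E1 E2 ME by (meson add_mono order_trans)
    qed
    also have "\<dots> = (C * (Cu + Cv)\<^sup>2 + C * Cu\<^sup>2 + norm M * (Cv + L * Cu) * K) * N\<^sup>2"
      by (simp only: power_mult_distrib) (simp only: distrib_right distrib_left mult_ac)
    finally show "norm (\<mu> (fst z) (snd z) - \<mu> (fst (0, a)) (snd (0, a)) -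
        (snd (z - (0, a)) + fst (z - (0, a)) *\<^sub>R (M *v v x))) \<le>
        (C * (Cu + Cv)\<^sup>2 + C * Cu\<^sup>2 + norm M * (Cv + L * Cu) * K) * (norm (z - (0, a)))\<^sup>2"
      using 0 by (simp add: z N_def)
  qed
  ultimately show ?thesis
    unfolding steering_move_def using 0 r(1) by blast
qed

text \<open>The moves are applied one after another, with coordinates of one vector as times.
  Restricting the sum to \<open>I\<close> keeps the parameter space fixed during the
  induction.\<close>

lemma compose_steering_moves:
  fixes b :: "'i::finite \<Rightarrow> 'a::euclidean_space"
  assumes refl: "\<And>x. rch x x" and trans: "\<And>x y z. rch x y \<Longrightarrow> rch y z \<Longrightarrow> rch x z"
    and mv: "\<And>i. \<exists>\<mu>. steering_move rch a (b i) \<mu>" and "finite I"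
  shows "\<exists>F :: real^'i \<Rightarrow> 'a. \<exists>r>0. F 0 = a \<and> continuous_on (ball 0 r) F \<and> (\<forall>s\<in>ball 0 r. rch a (F s)) \<and>
    (F has_derivative (\<lambda>h. \<Sum>i\<in>I. (h $ i) *\<^sub>R b i)) (at 0)"
  using \<open>finite I\<close>
proof (induction I rule: finite_induct)
  case empty
  show ?case by (rule exI[of _ "\<lambda>_. a"], rule exI[of _ 1]) (simp add: refl)
next
  case (insert i I)
  obtain F :: "real^'i \<Rightarrow> 'a" and r where F: "r > 0" "F 0 = a" "continuous_on (ball 0 r) F"
    "\<And>s. s \<in> ball 0 r \<Longrightarrow> rch a (F s)" "(F has_derivative (\<lambda>h. \<Sum>i\<in>I. (h $ i) *\<^sub>R b i)) (at 0)"
    using insert.IH by blast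
  obtain \<mu> where \<mu>: "steering_move rch a (b i) \<mu>" using mv by blast
  then obtain \<rho> where \<rho>: "\<rho> > 0" "\<mu> 0 a = a"
    "continuous_on ({-\<rho><..<\<rho>} \<times> ball a \<rho>) (\<lambda>z. \<mu> (fst z) (snd z))"
    "\<And>s y. s \<in> {-\<rho><..<\<rho>} \<Longrightarrow> y \<in> ball a \<rho> \<Longrightarrow> rch y (\<mu> s y)"
    "((\<lambda>z. \<mu> (fst z) (snd z)) has_derivative (\<lambda>z. snd z + fst z *\<^sub>R b i)) (at (0, a))"
    unfolding steering_move_def by blast
  have "isCont F 0" using F(5) has_derivative_continuous by blast
  then obtain d where d: "d > 0" "\<And>s. dist s 0 < d \<Longrightarrow> dist (F s) (F 0) < \<rho>"
    using \<rho>(1) unfolding continuous_at_eps_delta by blast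
  define r' where "r' = Min {r, d, \<rho>}"
  have r': "r' > 0" "r' \<le> r" "r' \<le> d" "r' \<le> \<rho>" using F(1) d(1) \<rho>(1) by (auto simp: r'_def)
  have si: "s $ i \<in> {-\<rho><..<\<rho>}" if "s \<in> ball 0 r'" for s :: "real^'i"
    using component_le_norm_cart[of s i] that r' by auto
  have Fs: "F s \<in> ball a \<rho>" if "s \<in> ball 0 r'" for s
    using d(2)[of s] that r' F(2) by (simp add: dist_commute)
  let ?G = "\<lambda>s. \<mu> (s $ i) (F s)"
  have "continuous_on (ball 0 r') (\<lambda>s. (s $ i, F s))"
    using r' by (intro continuous_intros continuous_on_subset[OF F(3)]) auto
  then have "continuous_on (ball 0 r') (\<lambda>s. \<mu> (fst (s $ i, F s)) (snd (s $ i, F s)))"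
    by (rule continuous_on_compose2[OF \<rho>(3)]) (use si Fs in auto)
  then have "continuous_on (ball 0 r') ?G" by simp
  moreover have "rch a (?G s)" if "s \<in> ball 0 r'" for s
    using trans[OF F(4) \<rho>(4)[OF si[OF that] Fs[OF that]]] that r' by auto
  moreover have "(?G has_derivative (\<lambda>h. \<Sum>i\<in>insert i I. (h $ i) *\<^sub>R b i)) (at 0)"
  proof -
    have 1: "((\<lambda>s. (s $ i, F s)) has_derivative (\<lambda>h. (h $ i, \<Sum>i\<in>I. (h $ i) *\<^sub>R b i))) (at 0)"
      by (intro has_derivative_Pair F(5) bounded_linear_imp_has_derivative bounded_linear_vec_nth)
    have "((\<lambda>s. \<mu> (fst (s $ i, F s)) (snd (s $ i, F s))) has_derivative
        (\<lambda>h. snd (h $ i, \<Sum>i\<in>I. (h $ i) *\<^sub>R b i) + fst (h $ i, \<Sum>i\<in>I. (h $ i) *\<^sub>R b i) *\<^sub>R b i)) (at 0)"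
      by (rule has_derivative_compose[OF 1, of "\<lambda>z. \<mu> (fst z) (snd z)" "\<lambda>z. snd z + fst z *\<^sub>R b i"])
        (use \<rho>(5) F(2) in simp)
    then show ?thesis using insert.hyps by (simp add: add.commute)
  qed
  moreover have "?G 0 = a" using F(2) \<rho>(2) by simp
  ultimately show ?case
    using r'(1) by (intro exI[of _ ?G] exI[of _ r'] conjI ballI)
qed

text \<open>Spanning is only assumed infinitesimally, at \<open>a\<close>. A covector killing every
  transported vector for short times also kills their derivatives at time 0, which are the iterated
  brackets. \<open>D\<close> holds extra directions along which any displacement is free.\<close>

theorem local_steering:
  fixes u v :: "real^'n \<Rightarrow> real^'n"
  assumes u: "smooth u" and v: "smooth v"
    and refl: "\<And>x. rch x x" and trans: "\<And>x y z. rch x y \<Longrightarrow> rch y z \<Longrightarrow> rch x z"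
    and Ru: "\<And>t x y. flow u t x = Some y \<Longrightarrow> rch x y"
    and Rv: "\<And>t x y. flow v t x = Some y \<Longrightarrow> rch x y"
    and RD: "\<And>d s y. d \<in> D \<Longrightarrow> rch y (y + s *\<^sub>R d)"
    and span: "\<And>p. (\<And>d. d \<in> D \<Longrightarrow> p \<bullet> d = 0) \<Longrightarrow> (\<And>j. p \<bullet> iter_bracket u v j a = 0) \<Longrightarrow> p = 0"
  shows "\<exists>N. open N \<and> a \<in> N \<and> (\<forall>y\<in>N. rch a y)"
proof -
  obtain \<tau>l r0 C \<xi> M where \<tau>l: "\<tau>l > 0" and r0: "r0 > 0" and C: "C > 0" and \<xi>0: "\<xi> 0 = a" "M 0 = mat 1"
    and lin: "\<And>t. t \<in> {0..\<tau>l} \<Longrightarrow> (\<xi> has_vector_derivative u (\<xi> t)) (at t within {0..\<tau>l}) \<and>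
      (M has_vector_derivative - (M t ** jac_matrix u (\<xi> t))) (at t within {0..\<tau>l}) \<and>
      flow_map u t a = \<xi> t \<and>
      (\<forall>w. norm (w - \<xi> t) \<le> r0 \<longrightarrow>
        norm (flow_map u (- t) w - a - M t *v (w - \<xi> t)) \<le> C * (norm (w - \<xi> t))\<^sup>2)"
    using flow_linearization[OF u, of a] by blast
  obtain \<tau>u Cu where \<tau>u: "\<tau>u > 0" and Cu: "Cu > 0" and gu0: "good_flow u a 4 {-\<tau>u..\<tau>u} Cu"
    using local_flow[OF u, of 4 a] by auto
  define \<tau> where "\<tau> = Min {\<tau>l, \<tau>u, 1 / (2 * Cu)}"
  have \<tau>: "\<tau> > 0" "\<tau> \<le> \<tau>l" "\<tau> \<le> \<tau>u" "\<tau> \<le> 1 / (2 * Cu)" using \<tau>l \<tau>u Cu by (simp_all add: \<tau>_def)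
  have Cu\<tau>: "Cu * \<tau> \<le> 1/2" using \<tau>(4) Cu by (simp add: pos_le_divide_eq mult_ac)
  have gu: "good_flow u a 4 {-\<tau>..\<tau>} Cu" by (rule good_flow_mono[OF gu0]) (use \<tau> in auto)
  \<comment> \<open>All directions for which a steering move at \<open>a\<close> is
    available.\<close>
  define S where "S = D \<union> (\<lambda>t. M t *v v (\<xi> t)) ` {0..\<tau>}"
  have mv: "\<exists>\<mu>. steering_move rch a b \<mu>" if b: "b \<in> S" for b
  proof (cases "b \<in> D")
    case True
    have "steering_move rch a b (\<lambda>s y. y + s *\<^sub>R b)"
      by (rule steering_move_translation) (rule RD[OF True])
    then show ?thesis by blast
  next
    case False
    then obtain t where t: "t \<in> {0..\<tau>}" "b = M t *v v (\<xi> t)" using b unfolding S_def by blast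
    then have tl: "t \<in> {0..\<tau>l}" using \<tau> by auto
    show ?thesis
      unfolding t(2)
      by (rule steering_move_conjugated_flow[OF u v trans Ru Rv gu Cu Cu\<tau> t(1) _ r0 _ C])
        (use lin[OF tl] in auto)
  qed
  have "span S = UNIV"
  proof (rule ccontr)
    assume "span S \<noteq> UNIV"
    then obtain p where p: "p \<noteq> 0" "\<And>x. x \<in> span S \<Longrightarrow> p \<bullet> x = 0"
      using span_not_UNIV_orthogonal by blast
    have pS: "p \<bullet> x = 0" if "x \<in> S" for x using p(2) span_base[OF that] by blast
    have "p \<bullet> (M 0 *v iter_bracket u v j (\<xi> 0)) = 0" for j
    proof (rule annihilates_iter_bracket[OF u v \<tau>(1)])
      fix t assume t: "t \<in> {0..\<tau>}"
      then have tl: "t \<in> {0..\<tau>l}" using \<tau> by auto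
      show "(\<xi> has_vector_derivative u (\<xi> t)) (at t within {0..\<tau>})"
        by (rule has_vector_derivative_within_subset) (use lin[OF tl] \<tau> in auto)
      show "(M has_vector_derivative - (M t ** jac_matrix u (\<xi> t))) (at t within {0..\<tau>})"
        by (rule has_vector_derivative_within_subset) (use lin[OF tl] \<tau> in auto)
      show "p \<bullet> (M t *v v (\<xi> t)) = 0"
        by (rule pS) (use t in \<open>auto simp: S_def\<close>)
    qed (use \<tau> in auto)
    then have "\<And>j. p \<bullet> iter_bracket u v j a = 0" by (simp add: \<xi>0)
    moreover have "\<And>d. d \<in> D \<Longrightarrow> p \<bullet> d = 0" by (rule pS) (simp add: S_def)
    ultimately have "p = 0" by (intro span)
    then show False using p(1) by simp
  qed
  moreover obtain B where B: "B \<subseteq> S" "independent B" "S \<subseteq> span B"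
    using maximal_independent_subset by blast
  ultimately have spB: "span B = UNIV" using span_minimal[OF B(3) subspace_span] by auto
  have finB: "finite B" using B(2) independent_imp_finite by blast
  have "card B = DIM(real^'n)"
    using basis_card_eq_dim[of B UNIV] spB B(2) by (simp add: dim_UNIV)
  then have "card (UNIV :: 'n set) = card B" by simp
  then obtain b where b: "bij_betw b (UNIV :: 'n set) B"
    using finite_same_card_bij[OF finite finB] by blast
  then have bS: "b i \<in> S" for i using B(1) bij_betwE by blast
  have "\<exists>F :: real^'n \<Rightarrow> real^'n. \<exists>r>0. F 0 = a \<and> continuous_on (ball 0 r) F \<and> (\<forall>s\<in>ball 0 r. rch a (F s)) \<and>
    (F has_derivative (\<lambda>h. \<Sum>i\<in>UNIV. (h $ i) *\<^sub>R b i)) (at 0)"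
    by (rule compose_steering_moves[of rch]) (rule refl, erule (1) trans, rule mv[OF bS], simp)
  then obtain F :: "real^'n \<Rightarrow> real^'n" and r where F: "r > 0" "F 0 = a" "continuous_on (ball 0 r) F"
    "\<And>s. s \<in> ball 0 r \<Longrightarrow> rch a (F s)" "(F has_derivative (\<lambda>h. \<Sum>i\<in>UNIV. (h $ i) *\<^sub>R b i)) (at 0)"
    by blast
  let ?T = "\<lambda>h. \<Sum>i\<in>UNIV. (h $ i) *\<^sub>R b i"
  have lT: "linear ?T" using F(5) has_derivative_linear by blast
  have "surj ?T"
  proof -
    have "\<exists>h. y = ?T h" for y
    proof -
      have "y \<in> range (\<lambda>c. \<Sum>x\<in>B. c x *\<^sub>R x)" using span_finite[OF finB] spB by auto
      then obtain c where c: "y = (\<Sum>x\<in>B. c x *\<^sub>R x)" by blast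
      have "?T (\<chi> i. c (b i)) = (\<Sum>x\<in>B. c x *\<^sub>R x)"
        using sum.reindex_bij_betw[OF b, of "\<lambda>x. c x *\<^sub>R x"] by simp
      then show ?thesis using c by metis
    qed
    then show ?thesis unfolding surj_def by blast
  qed
  then obtain g where g: "linear g" "?T \<circ> g = id"
    using linear_surjective_right_inverse[OF lT] by blast
  \<comment> \<open>\<open>F\<close> is continuous near 0 and has a derivative at 0 with right
    inverse \<open>g\<close>; that suffices for a neighbourhood of \<open>F 0\<close> to be
    covered.\<close>
  have "F 0 \<in> interior (F ` ball 0 r)"
    using F(1) by (intro sussmann_open_mapping[OF open_ball F(3) _ F(5) _ g(2)])
      (auto simp: linear_linear g(1))
  then have "a \<in> interior (F ` ball 0 r)" using F(2) by simp
  moreover have "rch a y" if "y \<in> interior (F ` ball 0 r)" for y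
    using that interior_subset F(4) by blast
  ultimately show ?thesis using open_interior by blast
qed

section \<open>Diagonalization\<close>

lemma linear_mat_of: "linear mat_of"
  by (auto simp: linear_iff plus_sym_mat.rep_eq scaleR_sym_mat.rep_eq)

lemma transpose_mat_of: "transpose (mat_of S) = mat_of S"
  using mat_of by blast

text \<open>Symmetrizing gives a total linear map into the type that recovers symmetric matrices
  unchanged, so smoothness transfers through it.\<close>

definition sym_part :: "real^'n^'n \<Rightarrow> 'n::finite sym_mat" where
  "sym_part A = Abs_sym_mat ((1/2) *\<^sub>R (A + transpose A))"

lemma mat_of_sym_part: "mat_of (sym_part A) = (1/2) *\<^sub>R (A + transpose A)"
  unfolding sym_part_def by (rule Abs_sym_mat_inverse) (simp add: transpose_def vec_eq_iff)

lemma mat_of_sym_part_symmetric: "transpose A = A \<Longrightarrow> mat_of (sym_part A) = A"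
  by (simp add: mat_of_sym_part vec_eq_iff)

lemma linear_sym_part: "linear (sym_part :: real^'n^'n \<Rightarrow> 'n::finite sym_mat)"
proof -
  have "mat_of (sym_part (A + B)) = mat_of (sym_part A + sym_part B)"
    "mat_of (sym_part (c *\<^sub>R A)) = mat_of (c *\<^sub>R sym_part A)" for A B :: "real^'n^'n" and c
    by (simp_all add: mat_of_sym_part plus_sym_mat.rep_eq scaleR_sym_mat.rep_eq transpose_def
        vec_eq_iff algebra_simps)
  then show ?thesis by (simp add: linear_iff mat_of_inject)
qed

definition diag :: "real^'n \<Rightarrow> 'n::finite sym_mat" where
  "diag x = sym_part (\<chi> i j. if i = j then x $ i else 0)"

lemma mat_of_diag: "mat_of (diag x) = (\<chi> i j. if i = j then x $ i else 0)"
  unfolding diag_def by (rule mat_of_sym_part_symmetric) (simp add: transpose_def vec_eq_iff)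

lemma linear_diag: "linear (diag :: real^'n \<Rightarrow> 'n::finite sym_mat)"
proof -
  have "mat_of (diag (x + y)) = mat_of (diag x + diag y)" "mat_of (diag (c *\<^sub>R x)) = mat_of (c *\<^sub>R diag x)"
    for x y :: "real^'n" and c
    by (simp_all add: mat_of_diag plus_sym_mat.rep_eq scaleR_sym_mat.rep_eq vec_eq_iff)
  then show ?thesis by (simp add: linear_iff mat_of_inject)
qed

lemma diag_inject: "diag x = diag y \<longleftrightarrow> x = y"
proof
  assume "diag x = diag y"
  then have "mat_of (diag x) $ i $ i = mat_of (diag y) $ i $ i" for i by simp
  then show "x = y" by (simp add: mat_of_diag vec_eq_iff)
qed simp

lemma linear_act: "linear (act P :: 'a::finite sym_mat \<Rightarrow> 'a sym_mat)"
proof -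
  have "mat_of (act P (S + T)) = mat_of (act P S + act P T)"
    "mat_of (act P (c *\<^sub>R S)) = mat_of (c *\<^sub>R act P S)" for S T :: "'a sym_mat" and c
    by (simp_all add: act.rep_eq plus_sym_mat.rep_eq scaleR_sym_mat.rep_eq
        bounded_bilinear.add_left[OF bounded_bilinear_matrix_mul]
        bounded_bilinear.add_right[OF bounded_bilinear_matrix_mul]
        bounded_bilinear.scaleR_left[OF bounded_bilinear_matrix_mul]
        bounded_bilinear.scaleR_right[OF bounded_bilinear_matrix_mul])
  then show ?thesis by (simp add: linear_iff mat_of_inject)
qed

lemma act_act: "act P (act Q S) = act (P ** Q) S"
  by (simp add: mat_of_inject[symmetric] act.rep_eq matrix_transpose_mul matrix_mul_assoc)

lemma act_mat_1: "act (mat 1) S = S"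
  by (simp add: mat_of_inject[symmetric] act.rep_eq transpose_mat)

lemma orthogonal_matrix_mul_transpose:
  "orthogonal_matrix P \<Longrightarrow> transpose P ** P = mat 1"
  "orthogonal_matrix P \<Longrightarrow> P ** transpose P = mat 1"
  by (simp_all add: orthogonal_matrix_def)

lemma act_transpose:
  assumes "orthogonal_matrix P"
  shows "act (transpose P) (act P S) = S" "act P (act (transpose P) S) = S"
  using orthogonal_matrix_mul_transpose[OF assms] by (simp_all add: act_act act_mat_1)

lemma inv_act: "orthogonal_matrix P \<Longrightarrow> inv (act P) = act (transpose P)"
  by (rule inv_equality) (simp_all add: act_transpose)

text \<open>The action of \<open>P\<close> is linear, hence its own derivative, and its inverse is
  the action of the transpose.\<close>

lemma equivariant_iff:
  "equivariant V \<longleftrightarrow> (\<forall>P S. orthogonal_matrix P \<longrightarrow> V (act P S) = act P (V S))"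
proof -
  have "pushforward (act P) V T = act P (V (act (transpose P) T))" if "orthogonal_matrix P" for P T
    using frechet_derivative_at[OF linear_imp_has_derivative[OF linear_act]]
    by (metis inv_act[OF that] pushforward_def)
  then show ?thesis
    unfolding equivariant_def fun_eq_iff by (metis act_transpose)
qed

lemma orbit_act:
  assumes "orthogonal_matrix P"
  shows "orbit (act P S) = orbit S"
proof (intro subset_antisym subsetI)
  fix T assume "T \<in> orbit (act P S)"
  then show "T \<in> orbit S"
    using assms orthogonal_matrix_mul by (force simp: orbit_def act_act)
next
  fix T assume "T \<in> orbit S"
  then obtain Q where Q: "orthogonal_matrix Q" "T = act Q S" by (auto simp: orbit_def)
  then have "T = act (Q ** transpose P) (act P S)"
    using assms by (simp add: act_act[symmetric] act_transpose)
  moreover have "orthogonal_matrix (Q ** transpose P)"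
    using Q(1) assms by (simp add: orthogonal_matrix_mul)
  ultimately show "T \<in> orbit (act P S)" by (auto simp: orbit_def)
qed

lemma orbit_refl: "S \<in> orbit S"
  unfolding orbit_def using act_mat_1[of S] orthogonal_matrix_id by (intro CollectI exI[of _ "mat 1"]) simp

lemma orbitE:
  assumes "T \<in> orbit S"
  obtains P where "orthogonal_matrix P" "T = act P S"
  using assms by (auto simp: orbit_def)

section \<open>Permutation and sign matrices, and equivariance at diagonal matrices\<close>

definition perm_matrix :: "('n \<Rightarrow> 'n) \<Rightarrow> real^'n^'n" where
  "perm_matrix \<sigma> = (\<chi> i j. if j = \<sigma> i then 1 else 0)"

lemma orthogonal_perm_matrix:
  assumes "bij \<sigma>"
  shows "orthogonal_matrix (perm_matrix \<sigma> :: real^'n^'n)"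
proof -
  have "perm_matrix \<sigma> ** transpose (perm_matrix \<sigma>) = (mat 1 :: real^'n^'n)"
    using bij_is_inj[OF assms]
    by (auto simp: perm_matrix_def matrix_matrix_mult_def transpose_def mat_def vec_eq_iff
        if_distrib[of "\<lambda>x. x * _"] cong: if_cong dest: injD)
  then show ?thesis
    by (metis matrix_left_right_inverse orthogonal_matrix_def)
qed

lemma act_perm_matrix: "mat_of (act (perm_matrix \<sigma>) S) $ i $ j = mat_of S $ \<sigma> i $ \<sigma> j"
  by (simp add: act.rep_eq perm_matrix_def matrix_matrix_mult_def transpose_def
      if_distrib[of "\<lambda>x. x * _"] if_distrib[of "\<lambda>x. _ * x"] cong: if_cong)

lemma act_perm_matrix_diag:
  assumes "bij \<sigma>"
  shows "act (perm_matrix \<sigma>) (diag x) = diag (\<chi> i. x $ \<sigma> i)"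
proof -
  have "\<sigma> i = \<sigma> j \<longleftrightarrow> i = j" for i j using bij_is_inj[OF assms] by (auto dest: injD)
  then have "mat_of (act (perm_matrix \<sigma>) (diag x)) = mat_of (diag (\<chi> i. x $ \<sigma> i))"
    by (simp add: vec_eq_iff act_perm_matrix) (simp add: mat_of_diag)
  then show ?thesis by (simp add: mat_of_inject)
qed

definition sign_matrix :: "'n \<Rightarrow> real^'n^'n" where
  "sign_matrix k = (\<chi> i j. if i = j then if i = k then - 1 else 1 else 0)"

lemma orthogonal_sign_matrix: "orthogonal_matrix (sign_matrix k :: real^'n^'n)"
proof -
  have "sign_matrix k ** transpose (sign_matrix k) = (mat 1 :: real^'n^'n)"
    by (auto simp: sign_matrix_def matrix_matrix_mult_def transpose_def mat_def vec_eq_iff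
        if_distrib[of "\<lambda>x. x * _"] cong: if_cong)
  then show ?thesis
    by (metis matrix_left_right_inverse orthogonal_matrix_def)
qed

lemma act_sign_matrix: "mat_of (act (sign_matrix k) S) $ i $ j =
    (if i = k then - 1 else 1) * (if j = k then - 1 else 1) * mat_of S $ i $ j"
  by (simp add: act.rep_eq sign_matrix_def matrix_matrix_mult_def transpose_def
      if_distrib[of "\<lambda>x. x * _"] if_distrib[of "\<lambda>x. _ * x"] cong: if_cong)

text \<open>The value at a diagonal matrix is fixed by the stabilizer, which contains all sign changes
  and the transpositions of equal entries.\<close>

lemma equivariant_diag:
  fixes V :: "'n::finite sym_mat \<Rightarrow> 'n sym_mat"
  assumes "equivariant V"
  shows "\<exists>w. V (diag x) = diag w \<and> (\<forall>i j. x $ i = x $ j \<longrightarrow> w $ i = w $ j)"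
proof -
  define A where "A = mat_of (V (diag x))"
  have eq: "V (act P (diag x)) = act P (V (diag x))" if "orthogonal_matrix P" for P
    using assms that by (simp add: equivariant_iff)
  have off: "A $ i $ j = 0" if "i \<noteq> j" for i j
  proof -
    have "mat_of (act (sign_matrix i) (diag x)) = mat_of (diag x)"
      by (simp add: vec_eq_iff act_sign_matrix) (simp add: mat_of_diag)
    then have "act (sign_matrix i) (V (diag x)) = V (diag x)"
      using eq[OF orthogonal_sign_matrix, of i] by (simp add: mat_of_inject)
    then have "A $ i $ j = - A $ i $ j"
      using act_sign_matrix[of i "V (diag x)" i j] that by (simp add: A_def)
    then show ?thesis by simp
  qed
  have lev: "A $ i $ i = A $ j $ j" if "x $ i = x $ j" for i j
  proof -
    let ?\<sigma> = "id(i := j, j := i)"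
    have "?\<sigma> (?\<sigma> k) = k" for k by simp
    then have b: "bij ?\<sigma>" by (metis involuntory_imp_bij)
    have "(\<chi> k. x $ ?\<sigma> k) = x" using that by (simp add: vec_eq_iff)
    then have "act (perm_matrix ?\<sigma>) (V (diag x)) = V (diag x)"
      using eq[OF orthogonal_perm_matrix[OF b]] act_perm_matrix_diag[OF b, of x] by simp
    then show ?thesis using act_perm_matrix[of ?\<sigma> "V (diag x)" i i] by (simp add: A_def)
  qed
  have "A = mat_of (diag (\<chi> i. A $ i $ i))"
    using off by (simp add: mat_of_diag vec_eq_iff)
  then have eqV: "V (diag x) = diag (\<chi> i. A $ i $ i)"
    unfolding A_def mat_of_inject .
  show ?thesis
  proof (intro exI conjI allI impI)
    show "V (diag x) = diag (\<chi> i. A $ i $ i)" by (rule eqV)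
    fix i j assume "x $ i = x $ j"
    from lev[OF this] show "(\<chi> i. A $ i $ i) $ i = (\<chi> i. A $ i $ i) $ j" by simp
  qed
qed

section \<open>Spectral theorem for real symmetric matrices\<close>

lemma quadratic_nonneg_imp_linear_coeff_0:
  fixes c q :: real
  assumes quad: "\<And>t. 0 \<le> 2 * t * c + t\<^sup>2 * q" and q: "0 \<le> q"
  shows "c = 0"
proof (rule ccontr)
  assume c: "c \<noteq> 0"
  \<comment> \<open>The test value is \<open>- c / (q + 1)\<close>; the shift by 1 keeps the
    denominator positive when \<open>q = 0\<close>.\<close>
  define r where "r = q + 1"
  have r: "r > 0" "q = r - 1" using q by (auto simp: r_def)
  have "2 * (- c / r) * c + (- c / r)\<^sup>2 * q = - (c\<^sup>2 * (r + 1) / r\<^sup>2)"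
    unfolding r(2) using r(1) by (simp add: divide_simps power2_eq_square) (simp add: algebra_simps)
  moreover have "c\<^sup>2 * (r + 1) / r\<^sup>2 > 0" using c r by simp
  ultimately show False using quad[of "- c / r"] by linarith
qed

text \<open>A maximizer of the Rayleigh quotient on an invariant subspace is an eigenvector.\<close>

lemma symmetric_eigenvector_in_subspace:
  fixes A :: "real^'n^'n"
  assumes sym: "transpose A = A" and U: "subspace U" "\<And>x. x \<in> U \<Longrightarrow> A *v x \<in> U" and ne: "U \<noteq> {0}"
  shows "\<exists>v\<in>U. norm v = 1 \<and> (\<exists>l. A *v v = l *\<^sub>R v)"
proof -
  have sa: "x \<bullet> (A *v y) = (A *v x) \<bullet> y" for x y
    by (metis dot_lmul_matrix sym transpose_matrix_vector)
  have cpt: "compact (U \<inter> sphere 0 1)"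
    using closed_subspace[OF U(1)] by (simp add: closed_Int_compact)
  obtain w where w: "w \<in> U" "w \<noteq> 0" using ne subspace_0[OF U(1)] by blast
  then have "(1 / norm w) *\<^sub>R w \<in> U \<inter> sphere 0 1" using U(1) subspace_scale by auto
  then have nempty: "U \<inter> sphere 0 1 \<noteq> {}" by blast
  have "continuous_on (U \<inter> sphere 0 1) (\<lambda>x. x \<bullet> (A *v x))"
    by (intro continuous_intros)
  from continuous_attains_sup[OF cpt nempty this] obtain v where v: "v \<in> U" "norm v = 1"
    and max: "\<And>x. x \<in> U \<Longrightarrow> norm x = 1 \<Longrightarrow> x \<bullet> (A *v x) \<le> v \<bullet> (A *v v)"
    by auto
  define l where "l = v \<bullet> (A *v v)"
  have Q: "0 \<le> l * (y \<bullet> y) - y \<bullet> (A *v y)" if y: "y \<in> U" for y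
  proof (cases "y = 0")
    case False
    let ?z = "(1 / norm y) *\<^sub>R y"
    have "?z \<bullet> (A *v ?z) \<le> l"
      unfolding l_def by (rule max) (use y False U(1) subspace_scale in auto)
    then have "(y \<bullet> (A *v y)) / (norm y)\<^sup>2 \<le> l"
      by (simp add: matrix_vector_mult_scaleR power2_eq_square)
    then show ?thesis using False by (simp add: pos_divide_le_eq dot_square_norm)
  qed simp
  \<comment> \<open>The residual of the eigenvalue equation is itself used as the variation. The
    first-order coefficient \<open>?c\<close> then equals \<open>?w \<bullet> ?w\<close>, so its
    vanishing is the equation.\<close>
  let ?w = "l *\<^sub>R v - A *v v"
  have wU: "?w \<in> U" using U v(1) by (simp add: subspace_diff subspace_scale)
  let ?c = "l * (v \<bullet> ?w) - ?w \<bullet> (A *v v)" and ?q = "l * (?w \<bullet> ?w) - ?w \<bullet> (A *v ?w)"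
  have "0 \<le> 2 * t * ?c + t\<^sup>2 * ?q" for t
  proof -
    have "0 \<le> l * ((v + t *\<^sub>R ?w) \<bullet> (v + t *\<^sub>R ?w)) - (v + t *\<^sub>R ?w) \<bullet> (A *v (v + t *\<^sub>R ?w))"
      by (rule Q) (use U v(1) wU in \<open>simp add: subspace_add subspace_scale\<close>)
    also have "\<dots> = (l * (v \<bullet> v) - v \<bullet> (A *v v)) + 2 * t * ?c + t\<^sup>2 * ?q"
    proof -
      have s: "v \<bullet> (A *v ?w) = ?w \<bullet> (A *v v)" using sa[of v ?w] by (simp add: inner_commute)
      have "(v + t *\<^sub>R ?w) \<bullet> (A *v (v + t *\<^sub>R ?w)) =
          v \<bullet> (A *v v) + t * (?w \<bullet> (A *v v)) + t * (v \<bullet> (A *v ?w)) + t * t * (?w \<bullet> (A *v ?w))"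
        by (simp only: matrix_vector_right_distrib matrix_vector_mult_scaleR inner_add_left inner_add_right
            inner_scaleR_left inner_scaleR_right) (simp only: distrib_left distrib_right mult_ac add_ac)
      moreover have "(v + t *\<^sub>R ?w) \<bullet> (v + t *\<^sub>R ?w) = v \<bullet> v + 2 * t * (v \<bullet> ?w) + t * t * (?w \<bullet> ?w)"
        by (simp only: inner_add_left inner_add_right inner_scaleR_left inner_scaleR_right inner_commute[of ?w v])
          (simp add: distrib_left distrib_right mult_ac)
      moreover have "l * (a + 2 * t * b + t * t * c) - (d + t * e + t * e + t * t * f) =
          (l * a - d) + 2 * t * (l * b - e) + t * t * (l * c - f)" for a b c d e f
        by (simp add: algebra_simps)
      ultimately show ?thesis unfolding s by (simp only: power2_eq_square)
    qed
    also have "l * (v \<bullet> v) - v \<bullet> (A *v v) = 0" using v(2) by (simp add: l_def dot_square_norm)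
    finally show ?thesis by simp
  qed
  note quad = this
  have "?c = 0" by (rule quadratic_nonneg_imp_linear_coeff_0[OF quad Q[OF wU]])
  then have "?w \<bullet> ?w = 0" by (simp add: inner_diff_left inner_commute)
  then have "A *v v = l *\<^sub>R v" by simp
  then show ?thesis using v by blast
qed

text \<open>Symmetry makes the orthogonal complement of an eigenvector inside \<open>U\<close>
  invariant again, so eigenvectors are split off one by one. Stating it for invariant subspaces
  permits induction on the dimension.\<close>

lemma symmetric_orthonormal_eigenbasis:
  fixes A :: "real^'n^'n"
  assumes sym: "transpose A = A"
  shows "subspace U \<Longrightarrow> (\<And>x. x \<in> U \<Longrightarrow> A *v x \<in> U) \<Longrightarrow>
    \<exists>B\<subseteq>U. pairwise orthogonal B \<and> (\<forall>b\<in>B. norm b = 1 \<and> (\<exists>l. A *v b = l *\<^sub>R b)) \<and> U \<subseteq> span B"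
proof (induction "dim U" arbitrary: U rule: less_induct)
  case less
  show ?case
  proof (cases "U = {0}")
    case True
    then show ?thesis by (intro exI[of _ "{}"]) simp
  next
    case False
    obtain v l where v: "v \<in> U" "norm v = 1" "A *v v = l *\<^sub>R v"
      using symmetric_eigenvector_in_subspace[OF sym less.prems False] by blast
    define U' where "U' = {x \<in> U. v \<bullet> x = 0}"
    have sub: "subspace U'"
      using less.prems(1) unfolding U'_def subspace_def by (auto simp: inner_add_right)
    have "v \<bullet> (A *v x) = 0" if "v \<bullet> x = 0" for x
      using that v(3) by (metis dot_lmul_matrix inner_scaleR_left mult_zero_right sym transpose_matrix_vector)
    then have inv: "A *v x \<in> U'" if "x \<in> U'" for x using that less.prems(2) by (auto simp: U'_def)
    have "v \<notin> U'" using v(2) by (simp add: U'_def dot_square_norm)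
    moreover have "U' \<subseteq> U" by (auto simp: U'_def)
    ultimately have "U' \<subset> U" using v(1) by (metis psubsetI)
    then have "dim U' < dim U"
      using dim_psubset[of U' U] by (metis less.prems(1) span_eq_iff sub)
    then obtain B where B: "B \<subseteq> U'" "pairwise orthogonal B"
      "\<forall>b\<in>B. norm b = 1 \<and> (\<exists>l. A *v b = l *\<^sub>R b)" "U' \<subseteq> span B"
      using less.hyps[OF _ sub inv] by blast
    have "pairwise orthogonal (insert v B)"
      using B(1,2) by (auto simp: pairwise_insert orthogonal_def U'_def inner_commute)
    moreover have "U \<subseteq> span (insert v B)"
    proof
      fix y assume y: "y \<in> U"
      have "y - (v \<bullet> y) *\<^sub>R v \<in> U'"
        using y v less.prems(1)
        by (simp add: U'_def subspace_diff subspace_scale inner_diff_right dot_square_norm)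
      then show "y \<in> span (insert v B)" using B(4) by (auto simp: span_insert)
    qed
    ultimately show ?thesis
      using B(1,3) v by (intro exI[of _ "insert v B"]) (auto simp: U'_def)
  qed
qed

theorem diagonalization:
  fixes S :: "'n::finite sym_mat"
  shows "\<exists>P x. orthogonal_matrix P \<and> S = act P (diag x)"
proof -
  let ?A = "mat_of S"
  obtain B where B: "pairwise orthogonal B" "\<And>b. b \<in> B \<Longrightarrow> norm b = 1"
    "\<And>b. b \<in> B \<Longrightarrow> \<exists>l. ?A *v b = l *\<^sub>R b" "UNIV \<subseteq> span B"
    using symmetric_orthonormal_eigenbasis[OF transpose_mat_of[of S] subspace_UNIV] by auto
  have ind: "independent B"
    using pairwise_orthogonal_independent[OF B(1)] B(2) by (metis norm_zero zero_neq_one)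
  have "card B = DIM(real^'n)"
    using basis_card_eq_dim[of B UNIV] B(4) ind by (simp add: dim_UNIV)
  then have "card (UNIV :: 'n set) = card B" by simp
  then obtain b where b: "bij_betw b (UNIV :: 'n set) B"
    using finite_same_card_bij[OF finite independent_imp_finite[OF ind]] by blast
  then have bB: "b i \<in> B" for i by (simp add: bij_betw_apply)
  obtain x where x: "\<And>i. ?A *v b i = x i *\<^sub>R b i" using B(3)[OF bB] by metis
  have on: "b i \<bullet> b j = (if i = j then 1 else 0)" for i j
  proof (cases "i = j")
    case True
    then show ?thesis using B(2)[OF bB] by (simp add: dot_square_norm)
  next
    case False
    then have "b i \<noteq> b j" using b by (auto simp: bij_betw_def dest: injD)
    then show ?thesis using B(1) bB False by (auto simp: pairwise_def orthogonal_def)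
  qed
  define P where "P = (\<chi> i j. b j $ i)"
  have "transpose P ** P = mat 1"
    using on by (simp add: P_def transpose_def matrix_matrix_mult_def mat_def vec_eq_iff inner_vec_def)
  then have oP: "orthogonal_matrix P"
    by (metis matrix_left_right_inverse orthogonal_matrix_def)
  have "(?A ** P) $ i $ j = (P ** mat_of (diag (\<chi> i. x i))) $ i $ j" for i j
  proof -
    have "(?A ** P) $ i $ j = (?A *v b j) $ i"
      by (simp add: P_def matrix_matrix_mult_def matrix_vector_mult_def)
    also have "\<dots> = (P ** mat_of (diag (\<chi> i. x i))) $ i $ j"
      by (simp add: x P_def mat_of_diag matrix_matrix_mult_def if_distrib[of "\<lambda>x. _ * x"] cong: if_cong)
    finally show ?thesis .
  qed
  then have "?A ** P = P ** mat_of (diag (\<chi> i. x i))" by (simp add: vec_eq_iff)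
  then have "?A = P ** mat_of (diag (\<chi> i. x i)) ** transpose P"
    by (metis matrix_mul_assoc matrix_mul_rid orthogonal_matrix_mul_transpose(2)[OF oP])
  then have "S = act P (diag (\<chi> i. x i))" by (simp add: mat_of_inject[symmetric] act.rep_eq)
  then show ?thesis using oP by blast
qed

section \<open>Polynomial fields and invariants\<close>

primrec mat_pow :: "real^'n^'n \<Rightarrow> nat \<Rightarrow> real^'n^'n" where
  "mat_pow A 0 = mat 1"
| "mat_pow A (Suc k) = A ** mat_pow A k"

lemma mat_pow_commute: "mat_pow A k ** A = A ** mat_pow A k"
  by (induction k) (simp_all add: matrix_mul_assoc[symmetric])

lemma transpose_mat_pow: "transpose A = A \<Longrightarrow> transpose (mat_pow A k) = mat_pow A k"
  by (induction k) (simp_all add: transpose_mat matrix_transpose_mul mat_pow_commute)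

lemma mat_pow_diag: "mat_pow (mat_of (diag x)) k = (\<chi> i j. if i = j then x $ i ^ k else 0)"
  by (induction k) (simp_all add: mat_def mat_of_diag matrix_matrix_mult_def vec_eq_iff
      if_distrib[of "\<lambda>x. x * _"] cong: if_cong)

lemma mat_pow_conj:
  assumes "orthogonal_matrix P"
  shows "mat_pow (P ** A ** transpose P) k = P ** mat_pow A k ** transpose P"
proof (induction k)
  case 0
  then show ?case using orthogonal_matrix_mul_transpose(2)[OF assms] by simp
next
  case (Suc k)
  have "P ** A ** transpose P ** (P ** mat_pow A k ** transpose P) =
      P ** A ** (transpose P ** P) ** mat_pow A k ** transpose P"
    by (simp only: matrix_mul_assoc)
  then show ?case using Suc orthogonal_matrix_mul_transpose(1)[OF assms] by (simp add: matrix_mul_assoc)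
qed

lemma smooth_mat_pow: "smooth (\<lambda>S. mat_pow (mat_of S) k)"
  by (induction k)
    (simp_all add: smooth_const smooth_bilinear[OF bounded_bilinear_matrix_mul] smooth_linear linear_mat_of)

text \<open>Powers of the matrix and traces of powers are the building blocks of all perturbations.
  On diagonal matrices they become entrywise powers and power sums.\<close>

definition pow_field :: "nat \<Rightarrow> 'n::finite sym_mat \<Rightarrow> 'n sym_mat" where
  "pow_field k S = sym_part (mat_pow (mat_of S) k)"

definition trace_pow :: "nat \<Rightarrow> 'n::finite sym_mat \<Rightarrow> real" where
  "trace_pow k S = trace (mat_pow (mat_of S) k)"

lemma mat_of_pow_field: "mat_of (pow_field k S) = mat_pow (mat_of S) k"
  unfolding pow_field_def by (rule mat_of_sym_part_symmetric) (simp add: transpose_mat_pow transpose_mat_of)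

lemma pow_field_diag: "pow_field k (diag x) = diag (\<chi> i. x $ i ^ k)"
  by (simp add: mat_of_inject[symmetric] mat_of_pow_field mat_pow_diag) (simp add: mat_of_diag vec_eq_iff)

lemma trace_pow_diag: "trace_pow k (diag x) = (\<Sum>i\<in>UNIV. x $ i ^ k)"
  by (simp add: trace_pow_def mat_pow_diag trace_def)

lemma pow_field_equivariant_fields: "pow_field k \<in> equivariant_fields"
proof -
  have "smooth (pow_field k)"
    using smooth_linear_post[OF linear_sym_part smooth_mat_pow] by (simp add: pow_field_def[abs_def])
  moreover have "equivariant (pow_field k)"
    by (auto simp: equivariant_iff mat_of_inject[symmetric] mat_of_pow_field act.rep_eq mat_pow_conj)
  ultimately show ?thesis by (simp add: equivariant_fields_def)
qed

lemma smooth_trace_pow: "smooth (trace_pow k)"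
proof -
  have "linear (trace :: real^'n^'n \<Rightarrow> real)"
    by (auto simp: linear_iff trace_def sum.distrib sum_distrib_left)
  from smooth_linear_post[OF this smooth_mat_pow] show ?thesis by (simp add: trace_pow_def[abs_def])
qed

lemma trace_pow_act: "orthogonal_matrix P \<Longrightarrow> trace_pow k (act P S) = trace_pow k S"
  by (simp add: trace_pow_def act.rep_eq mat_pow_conj trace_mul_sym[of _ "transpose P"]
      matrix_mul_assoc orthogonal_matrix_mul_transpose)

lemma equivariant_fields_add:
  "V \<in> equivariant_fields \<Longrightarrow> W \<in> equivariant_fields \<Longrightarrow> (\<lambda>S. V S + W S) \<in> equivariant_fields"
  by (simp add: equivariant_fields_def equivariant_iff smooth_add linear_add[OF linear_act])

lemma equivariant_fields_scale:
  assumes "smooth f" "\<And>P S. orthogonal_matrix P \<Longrightarrow> f (act P S) = f S" "V \<in> equivariant_fields"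
  shows "(\<lambda>S. f S *\<^sub>R V S) \<in> equivariant_fields"
  using assms by (simp add: equivariant_fields_def equivariant_iff smooth_scaleR linear_scale[OF linear_act])

lemma equivariant_fields_sum:
  "(\<And>i. i \<in> I \<Longrightarrow> V i \<in> equivariant_fields) \<Longrightarrow> (\<lambda>S. \<Sum>i\<in>I. c i *\<^sub>R V i S) \<in> equivariant_fields"
  by (simp add: equivariant_fields_def equivariant_iff smooth_sum smooth_scaleR smooth_const
      linear_sum[OF linear_act] linear_scale[OF linear_act])

text \<open>Vanishing against all powers means vanishing against all polynomials, in particular
  against one with zeros at all nodes but \<open>x i\<close>.\<close>

lemma power_sums_separate:
  fixes x c :: "'i \<Rightarrow> real"
  assumes fin: "finite J" and inj: "inj_on x J" and z: "\<And>k. (\<Sum>i\<in>J. c i * x i ^ k) = 0" and i: "i \<in> J"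
  shows "c i = 0"
proof -
  define p where "p = (\<Prod>j\<in>J - {i}. [:- x j, 1:])"
  have p0: "poly p (x j) = 0 \<longleftrightarrow> j \<noteq> i" if "j \<in> J" for j
    using fin inj i that by (auto simp: p_def poly_prod inj_on_def)
  have "(\<Sum>j\<in>J. c j * poly p (x j)) = (\<Sum>k\<le>degree p. coeff p k * (\<Sum>j\<in>J. c j * x j ^ k))"
    unfolding poly_altdef sum_distrib_left by (subst sum.swap) (simp add: mult_ac)
  also have "\<dots> = 0" using z by simp
  finally have "0 = (\<Sum>j\<in>J. c j * poly p (x j))" by simp
  also have "\<dots> = (\<Sum>j\<in>J. if j = i then c i * poly p (x i) else 0)"
    by (intro sum.cong) (use p0 in auto)
  also have "\<dots> = c i * poly p (x i)" using fin i by simp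
  finally show ?thesis using p0[OF i] by simp
qed

lemma frechet_derivative_trace_pow:
  "frechet_derivative (trace_pow k) (at (diag x)) (diag w) = (\<Sum>i\<in>UNIV. real k * x $ i ^ (k - 1) * w $ i)"
proof -
  have A: "((\<lambda>y. trace_pow k (diag y)) has_derivative
      (\<lambda>h. frechet_derivative (trace_pow k) (at (diag x)) (diag h))) (at x)"
    by (rule has_derivative_compose[OF linear_imp_has_derivative[OF linear_diag]
          smooth_has_derivative[OF smooth_trace_pow]])
  have B: "((\<lambda>y. trace_pow k (diag y)) has_derivative
      (\<lambda>h. \<Sum>i\<in>UNIV. real k * x $ i ^ (k - 1) * h $ i)) (at x)"
    unfolding trace_pow_diag
    by (auto intro!: derivative_eq_intros bounded_linear_imp_has_derivative bounded_linear_vec_nth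
        simp: mult_ac)
  show ?thesis by (rule fun_cong[OF has_derivative_unique[OF A B]])
qed

text \<open>The derivatives are moments of \<open>w\<close> at the nodes \<open>x $ i\<close>. Equal
  nodes are grouped to make the nodes distinct, and as \<open>w\<close> is constant on each group
  nothing cancels inside it.\<close>

lemma trace_pow_separates:
  assumes "w \<noteq> 0" "\<And>i j. x $ i = x $ j \<Longrightarrow> w $ i = w $ j"
  shows "\<exists>k. frechet_derivative (trace_pow k) (at (diag x)) (diag w) \<noteq> 0"
proof (rule ccontr)
  assume neg: "\<not> ?thesis"
  have "(\<Sum>i\<in>UNIV. w $ i * x $ i ^ k) = 0" for k
  proof -
    have "(\<Sum>i\<in>UNIV. real (Suc k) * x $ i ^ k * w $ i) = 0"
      using neg frechet_derivative_trace_pow[of "Suc k" x w] by simp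
    then have "real (Suc k) * (\<Sum>i\<in>UNIV. w $ i * x $ i ^ k) = 0"
      by (simp only: sum_distrib_left mult_ac)
    then show ?thesis by (simp only: mult_eq_0_iff of_nat_eq_0_iff nat.distinct simp_thms)
  qed
  moreover have "(\<Sum>i\<in>UNIV. w $ i * x $ i ^ k) =
      (\<Sum>l\<in>range (($) x). (\<Sum>i | x $ i = l. w $ i) * l ^ k)" for k
    by (subst sum.image_gen[of UNIV _ "($) x"]) (auto simp: sum_distrib_right intro!: sum.cong)
  ultimately have "(\<Sum>l\<in>range (($) x). (\<Sum>i | x $ i = l. w $ i) * l ^ k) = 0" for k by metis
  then have lev: "(\<Sum>i | x $ i = l. w $ i) = 0" if "l \<in> range (($) x)" for l
    using power_sums_separate[of "range (($) x)" "\<lambda>l. l" "\<lambda>l. \<Sum>i | x $ i = l. w $ i" l] that by simp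
  have "w $ j = 0" for j
  proof -
    have "(\<Sum>i | x $ i = x $ j. w $ i) = (\<Sum>i | x $ i = x $ j. w $ j)"
      by (intro sum.cong refl) (metis assms(2) mem_Collect_eq)
    then have "real (card {i. x $ i = x $ j}) * w $ j = 0" using lev[of "x $ j"] by simp
    moreover have "card {i. x $ i = x $ j} \<noteq> 0" by auto
    ultimately show ?thesis by simp
  qed
  then show False using assms(1) by (simp add: vec_eq_iff)
qed

section \<open>Fields and flows on the orbit space\<close>

definition invariant :: "('n::finite sym_mat \<Rightarrow> 'b) \<Rightarrow> bool" where
  "invariant f \<longleftrightarrow> (\<forall>P S. orthogonal_matrix P \<longrightarrow> f (act P S) = f S)"

definition orbit_function :: "('n::finite sym_mat \<Rightarrow> real) \<Rightarrow> 'n sym_mat set \<Rightarrow> real" where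
  "orbit_function f = (\<lambda>Q\<in>orbit_space. the_elem (f ` Q))"

lemma invariant_image_orbit: "invariant f \<Longrightarrow> f ` orbit S = {f S}"
  using orbit_refl[of S] by (auto simp: invariant_def orbit_def)

lemma orbit_in_orbit_space: "orbit S \<in> orbit_space"
  by (simp add: orbit_space_def)

lemma orbit_function_orbit: "invariant f \<Longrightarrow> orbit_function f \<circ> orbit = f"
  by (auto simp: orbit_function_def orbit_in_orbit_space invariant_image_orbit)

lemma orbit_function_smooth:
  "smooth f \<Longrightarrow> invariant f \<Longrightarrow> orbit_function f \<in> smooth_orbit_functions"
  by (simp add: smooth_orbit_functions_def orbit_function_orbit) (simp add: orbit_function_def)

lemma frechet_derivative_invariant:
  assumes f: "smooth f" "invariant f" and P: "orthogonal_matrix P"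
  shows "frechet_derivative f (at (act P S)) (act P H) = frechet_derivative f (at S) H"
proof -
  have "((\<lambda>S. f (act P S)) has_derivative (\<lambda>H. frechet_derivative f (at (act P S)) (act P H))) (at S)"
    by (rule has_derivative_compose[OF linear_imp_has_derivative[OF linear_act] smooth_has_derivative[OF f(1)]])
  then have d: "(f has_derivative (\<lambda>H. frechet_derivative f (at (act P S)) (act P H))) (at S)"
    using f(2) P by (simp add: invariant_def)
  show ?thesis by (rule fun_cong[OF has_derivative_unique[OF d smooth_has_derivative[OF f(1)]]])
qed

lemma induced_field_orbit_function:
  assumes V: "V \<in> equivariant_fields" and f: "smooth f" "invariant f"
  shows "induced_field V (orbit_function f) (orbit S) = frechet_derivative f (at S) (V S)"
proof -
  have "invariant (\<lambda>S. frechet_derivative f (at S) (V S))"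
    using V frechet_derivative_invariant[OF f]
    by (simp add: invariant_def equivariant_fields_def equivariant_iff)
  then show ?thesis
    by (simp add: induced_field_def orbit_function_smooth[OF f] orbit_in_orbit_space
        orbit_function_orbit[OF f(2)] invariant_image_orbit)
qed

lemma equivariant_eqI:
  fixes V V' :: "'n::finite sym_mat \<Rightarrow> 'n sym_mat"
  assumes "equivariant V" "equivariant V'" "\<And>x. V (diag x) = V' (diag x)"
  shows "V = V'"
proof
  fix S :: "'n sym_mat"
  obtain P x where "orthogonal_matrix P" "S = act P (diag x)" using diagonalization by blast
  then show "V S = V' S" using assms by (simp add: equivariant_iff)
qed

text \<open>The traces of powers already determine an equivariant field.\<close>

lemma inj_on_induced_field: "inj_on induced_field (equivariant_fields :: ('n::finite sym_mat \<Rightarrow> 'n sym_mat) set)"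
proof (rule inj_onI)
  fix V V' :: "'n sym_mat \<Rightarrow> 'n sym_mat"
  assume V: "V \<in> equivariant_fields" and V': "V' \<in> equivariant_fields" and eq: "induced_field V = induced_field V'"
  have e: "equivariant V" "equivariant V'" using V V' by (auto simp: equivariant_fields_def)
  have inv: "invariant (trace_pow k :: 'n sym_mat \<Rightarrow> real)" for k
    by (simp add: invariant_def trace_pow_act)
  show "V = V'"
  proof (rule equivariant_eqI[OF e])
    fix x :: "real^'n"
    obtain w where w: "V (diag x) = diag w" "\<And>i j. x $ i = x $ j \<Longrightarrow> w $ i = w $ j"
      using equivariant_diag[OF e(1)] by blast
    obtain w' where w': "V' (diag x) = diag w'" "\<And>i j. x $ i = x $ j \<Longrightarrow> w' $ i = w' $ j"
      using equivariant_diag[OF e(2)] by blast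
    have "frechet_derivative (trace_pow k) (at (diag x)) (diag (w - w')) = 0" for k
    proof -
      have l: "linear (frechet_derivative (trace_pow k) (at (diag x)))"
        using smooth_has_derivative[OF smooth_trace_pow] has_derivative_linear by blast
      have "frechet_derivative (trace_pow k) (at (diag x)) (diag w) =
          frechet_derivative (trace_pow k) (at (diag x)) (diag w')"
        using induced_field_orbit_function[OF V smooth_trace_pow inv, of k "diag x"]
          induced_field_orbit_function[OF V' smooth_trace_pow inv, of k "diag x"] eq w(1) w'(1) by simp
      then show ?thesis by (simp add: linear_diff[OF linear_diag] linear_diff[OF l])
    qed
    moreover have "(w - w') $ i = (w - w') $ j" if "x $ i = x $ j" for i j
      using w(2)[OF that] w'(2)[OF that] by simp
    ultimately have "w - w' = 0" using trace_pow_separates[of "w - w'" x] by blast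
    then show "V (diag x) = V' (diag x)" using w(1) w'(1) by simp
  qed
qed

text \<open>An injective quotient map is a homeomorphism. Open dense sets can therefore be
  constructed among equivariant fields.\<close>

lemma homeomorphic_map_induced_field:
  "homeomorphic_map smooth_topology (induced_fields_topology :: 'n::finite orbit_field topology) induced_field"
  unfolding homeomorphic_map_def induced_fields_topology_def
  by (simp add: quotient_map_quotient_topology topspace_smooth_topology inj_on_induced_field)

lemma integral_curve_linear:
  fixes L :: "'a::real_normed_vector \<Rightarrow> 'b::real_normed_vector"
  assumes "integral_curve u t \<gamma>" "bounded_linear L" "\<And>x. V (L x) = L (u x)"
  shows "integral_curve V t (\<lambda>s. L (\<gamma> s))"
  using assms bounded_linear.has_vector_derivative[OF assms(2)] by (simp add: integral_curve_def)

text \<open>A linear map intertwining two fields carries trajectories to trajectories. It is used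
  for the orthogonal action and for the embedding of a stratum.\<close>

lemma flow_linear:
  fixes L :: "'a::euclidean_space \<Rightarrow> 'b::euclidean_space"
  assumes "smooth u" "smooth V" "linear L" "\<And>x. V (L x) = L (u x)" "flow u t x = Some y"
  shows "flow V t (L x) = Some (L y)"
proof -
  obtain \<gamma> where \<gamma>: "integral_curve u t \<gamma>" "\<gamma> 0 = x" "\<gamma> t = y" by (rule flowE[OF assms(1,5)])
  have "integral_curve V t (\<lambda>s. L (\<gamma> s))"
    using integral_curve_linear[OF \<gamma>(1)] assms(3,4) linear_linear by blast
  from flow_eq[OF assms(2) this] show ?thesis using \<gamma> by simp
qed

text \<open>By injectivity \<open>V\<close> is the only field inducing the given one, and
  equivariance transports its trajectory to every other representative. The set under
  \<open>the_elem\<close> is thus a singleton.\<close>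

lemma orbit_flow_orbit:
  assumes V: "V \<in> equivariant_fields" and fl: "flow V t S = Some T"
  shows "orbit_flow (induced_field V) t (orbit S) = Some (orbit T)"
proof -
  have sm: "smooth V" "equivariant V" using V by (auto simp: equivariant_fields_def)
  have val: "map_option orbit (flow V' t S') = Some (orbit T)"
    if *: "V' \<in> equivariant_fields" "induced_field V' = induced_field V" "S' \<in> orbit S" for V' S'
  proof -
    have "V' = V" using inj_on_induced_field V *(1,2) by (auto dest: inj_onD)
    moreover obtain P where P: "orthogonal_matrix P" "S' = act P S" by (rule orbitE[OF *(3)])
    moreover have "flow V t (act P S) = Some (act P T)"
      using sm(2) P(1) by (intro flow_linear[OF sm(1) sm(1) linear_act _ fl]) (simp add: equivariant_iff)
    ultimately show ?thesis by (simp add: orbit_act)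
  qed
  have "{map_option orbit (flow V' t S') | V' S'.
     V' \<in> equivariant_fields \<and> induced_field V' = induced_field V \<and> S' \<in> orbit S} = {Some (orbit T)}"
    (is "?A = _")
  proof (rule subset_antisym)
    show "?A \<subseteq> {Some (orbit T)}" using val by auto
    have "Some (orbit T) = map_option orbit (flow V t S)" by (simp add: fl)
    then show "{Some (orbit T)} \<subseteq> ?A" using V orbit_refl[of S] by blast
  qed
  then show ?thesis by (simp add: orbit_flow_def)
qed

section \<open>Strata of diagonal matrices\<close>

text \<open>An idempotent map \<open>\<rho>\<close> on the indices encodes a partition into blocks with representatives
  \<open>\<rho> i = i\<close>. The entries of \<open>y\<close> at the other indices are dummies, so that strata of all
  dimensions are parametrized by the same vector space.\<close>

definition spread :: "('n \<Rightarrow> 'n) \<Rightarrow> real^'n \<Rightarrow> real^'n" where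
  "spread \<rho> y = (\<chi> i. y $ \<rho> i)"

text \<open>The dummy components are 0, so the dummy coordinates stay constant along the
  flow.\<close>

definition rep_field :: "('n \<Rightarrow> 'n) \<Rightarrow> ('n::finite sym_mat \<Rightarrow> 'n sym_mat) \<Rightarrow> real^'n \<Rightarrow> real^'n" where
  "rep_field \<rho> V y = (\<chi> i. if \<rho> i = i then mat_of (V (diag (spread \<rho> y))) $ i $ i else 0)"

lemma linear_diag_spread: "linear (\<lambda>y. diag (spread \<rho> y))"
proof -
  have "linear (spread \<rho>)" by (auto simp: linear_iff spread_def vec_eq_iff)
  from linear_compose[OF this linear_diag] show ?thesis by (simp add: o_def)
qed

lemma linear_representative_entries:
  "linear (\<lambda>S :: 'n::finite sym_mat. (\<chi> i. if \<rho> i = i then mat_of S $ i $ i else 0) :: real^'n)"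
  by (auto simp: linear_iff vec_eq_iff plus_sym_mat.rep_eq scaleR_sym_mat.rep_eq)

lemma rep_field_alt:
  "rep_field \<rho> V = (\<lambda>y. (\<lambda>S. \<chi> i. if \<rho> i = i then mat_of S $ i $ i else 0) (V ((\<lambda>y. diag (spread \<rho> y)) y)))"
  by (simp add: rep_field_def[abs_def])

lemma smooth_rep_field: "smooth V \<Longrightarrow> smooth (rep_field \<rho> V)"
  unfolding rep_field_alt by (rule smooth_linear_comp[OF linear_representative_entries linear_diag_spread])

lemma smooth_lim_rep_field: "smooth_lim F V W \<Longrightarrow> smooth_lim F (\<lambda>i. rep_field \<rho> (V i)) (rep_field \<rho> W)"
  unfolding rep_field_alt by (rule smooth_lim_linear_comp[OF linear_representative_entries linear_diag_spread])

lemma rep_field_dummy: "\<rho> i \<noteq> i \<Longrightarrow> rep_field \<rho> V y $ i = 0"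
  by (simp add: rep_field_def)

text \<open>On a stratum the value of an equivariant field is constant on blocks and so determined
  by its representative entries. The embedding of the stratum therefore intertwines the two
  fields.\<close>

lemma diag_spread_rep_field:
  assumes V: "equivariant V" and \<rho>: "\<And>i. \<rho> (\<rho> i) = \<rho> i"
  shows "V (diag (spread \<rho> y)) = diag (spread \<rho> (rep_field \<rho> V y))"
proof -
  obtain w where w: "V (diag (spread \<rho> y)) = diag w"
    "\<And>i j. spread \<rho> y $ i = spread \<rho> y $ j \<Longrightarrow> w $ i = w $ j"
    using equivariant_diag[OF V] by blast
  have "w $ i = spread \<rho> (rep_field \<rho> V y) $ i" for i
  proof -
    have "w $ i = w $ \<rho> i" by (rule w(2)) (simp add: spread_def \<rho>)
    also have "w $ \<rho> i = rep_field \<rho> V y $ \<rho> i" by (simp add: rep_field_def \<rho> w(1) mat_of_diag)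
    finally show ?thesis by (simp add: spread_def)
  qed
  then show ?thesis using w(1) by (simp add: vec_eq_iff diag_inject)
qed

lemma flow_rep_field:
  assumes V: "V \<in> equivariant_fields" and \<rho>: "\<And>i. \<rho> (\<rho> i) = \<rho> i" and "flow (rep_field \<rho> V) t y = Some z"
  shows "flow V t (diag (spread \<rho> y)) = Some (diag (spread \<rho> z))"
proof (rule flow_linear[OF _ _ linear_diag_spread _ assms(3)])
  show "smooth (rep_field \<rho> V)" "smooth V" using V smooth_rep_field by (auto simp: equivariant_fields_def)
  show "V (diag (spread \<rho> x)) = diag (spread \<rho> (rep_field \<rho> V x))" for x
    using V by (intro diag_spread_rep_field \<rho>) (simp add: equivariant_fields_def)
qed

section \<open>Reachability inside a stratum\<close>

definition steer_step ::
    "('n::finite sym_mat \<Rightarrow> 'n sym_mat) \<Rightarrow> ('n sym_mat \<Rightarrow> 'n sym_mat) \<Rightarrow> 'n sym_mat \<Rightarrow> 'n sym_mat \<Rightarrow> bool" where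
  "steer_step V W S T \<longleftrightarrow> (\<exists>t. flow V t S = Some T \<or> flow W t S = Some T)"

definition steers ::
    "('n::finite sym_mat \<Rightarrow> 'n sym_mat) \<Rightarrow> ('n sym_mat \<Rightarrow> 'n sym_mat) \<Rightarrow> 'n sym_mat \<Rightarrow> 'n sym_mat \<Rightarrow> bool" where
  "steers V W = (steer_step V W)\<^sup>*\<^sup>*"

lemma steers_trans: "steers V W S T \<Longrightarrow> steers V W T U \<Longrightarrow> steers V W S U"
  by (auto simp: steers_def)

lemma steers_flow: "flow V t S = Some T \<Longrightarrow> steers V W S T" "flow W t S = Some T \<Longrightarrow> steers V W S T"
  unfolding steers_def by (auto simp: steer_step_def intro!: r_into_rtranclp)

lemma steers_sym:
  assumes "smooth V" "smooth W" "steers V W S T"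
  shows "steers V W T S"
  using assms(3) unfolding steers_def
proof (induction rule: rtranclp_induct)
  case (step T U)
  then have "steer_step V W U T"
    using flow_reverse assms(1,2) unfolding steer_step_def by blast
  from this step.IH show ?case by (rule converse_rtranclp_into_rtranclp)
qed simp

text \<open>Spanning is expressed by covectors. Those supported on the representatives are the right
  ones because the dummy axes are supplied separately as free directions.\<close>

definition bracket_spanning :: "('n \<Rightarrow> 'n) \<Rightarrow> (real^'n \<Rightarrow> real^'n) \<Rightarrow> (real^'n \<Rightarrow> real^'n) \<Rightarrow> real^'n \<Rightarrow> bool" where
  "bracket_spanning \<rho> u v y \<longleftrightarrow>
     (\<forall>p. (\<forall>i. \<rho> i \<noteq> i \<longrightarrow> p $ i = 0) \<longrightarrow> (\<forall>j. p \<bullet> iter_bracket u v j y = 0) \<longrightarrow> p = 0)"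

text \<open>A dummy index is outside the range of the idempotent \<open>\<rho>\<close>, so
  \<open>spread\<close> never reads it: displacing that coordinate leaves the matrix unchanged, and
  its axis may be put into \<open>D\<close>.\<close>

lemma local_steering_rep_field:
  fixes V W :: "'n::finite sym_mat \<Rightarrow> 'n sym_mat"
  assumes V: "V \<in> equivariant_fields" and W: "W \<in> equivariant_fields" and \<rho>: "\<And>i. \<rho> (\<rho> i) = \<rho> i"
    and span: "bracket_spanning \<rho> (rep_field \<rho> V) (rep_field \<rho> W) a"
  shows "\<exists>N. open N \<and> a \<in> N \<and> (\<forall>y\<in>N. steers V W (diag (spread \<rho> a)) (diag (spread \<rho> y)))"
proof (rule local_steering[where u="rep_field \<rho> V" and v="rep_field \<rho> W" and D="(\<lambda>i. axis i 1) ` {i. \<rho> i \<noteq> i}"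
      and rch="\<lambda>x y. steers V W (diag (spread \<rho> x)) (diag (spread \<rho> y))"])
  show "smooth (rep_field \<rho> V)" "smooth (rep_field \<rho> W)"
    using V W smooth_rep_field by (auto simp: equivariant_fields_def)
  show "steers V W (diag (spread \<rho> x)) (diag (spread \<rho> x))" for x by (simp add: steers_def)
  show "steers V W (diag (spread \<rho> x)) (diag (spread \<rho> z))"
    if "steers V W (diag (spread \<rho> x)) (diag (spread \<rho> y))" "steers V W (diag (spread \<rho> y)) (diag (spread \<rho> z))"
    for x y z using that by (rule steers_trans)
  show "steers V W (diag (spread \<rho> x)) (diag (spread \<rho> y))" if "flow (rep_field \<rho> V) t x = Some y" for t x y
    using flow_rep_field[OF V \<rho> that] by (rule steers_flow)
  show "steers V W (diag (spread \<rho> x)) (diag (spread \<rho> y))" if "flow (rep_field \<rho> W) t x = Some y" for t x y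
    using flow_rep_field[OF W \<rho> that] by (rule steers_flow)
  show "steers V W (diag (spread \<rho> y)) (diag (spread \<rho> (y + s *\<^sub>R d)))"
    if d: "d \<in> (\<lambda>i. axis i 1) ` {i. \<rho> i \<noteq> i}" for d s y
  proof -
    obtain i where i: "\<rho> i \<noteq> i" "d = axis i 1" using d by blast
    have "\<rho> k \<noteq> i" for k using \<rho> i(1) by metis
    then have "spread \<rho> (y + s *\<^sub>R d) = spread \<rho> y" by (simp add: spread_def vec_eq_iff i(2) axis_def)
    then show ?thesis by (simp add: steers_def)
  qed
  show "p = 0" if "\<And>d. d \<in> (\<lambda>i. axis i 1) ` {i. \<rho> i \<noteq> i} \<Longrightarrow> p \<bullet> d = 0"
    "\<And>j. p \<bullet> iter_bracket (rep_field \<rho> V) (rep_field \<rho> W) j a = 0" for p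
    using span[unfolded bracket_spanning_def, rule_format, of p] that by (force simp: inner_axis)
qed

lemma steers_commute: "steers V W = steers W V"
  by (simp add: steers_def steer_step_def[abs_def] disj_commute)

lemma steers_same_order_pattern:
  fixes V W :: "'n::finite sym_mat \<Rightarrow> 'n sym_mat" and x z :: "real^'n"
  assumes V: "V \<in> equivariant_fields" and W: "W \<in> equivariant_fields"
    and good: "\<And>\<rho> y. (\<And>i. \<rho> (\<rho> i) = \<rho> i) \<Longrightarrow> (\<And>i j. \<rho> i = i \<Longrightarrow> \<rho> j = j \<Longrightarrow> i \<noteq> j \<Longrightarrow> y $ i \<noteq> y $ j) \<Longrightarrow>
       bracket_spanning \<rho> (rep_field \<rho> V) (rep_field \<rho> W) y \<or> bracket_spanning \<rho> (rep_field \<rho> W) (rep_field \<rho> V) y"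
    and pat: "\<And>i j. x $ i < x $ j \<longleftrightarrow> z $ i < z $ j"
  shows "steers V W (diag x) (diag z)"
proof -
  \<comment> \<open>The choice depends only on the value \<open>x $ i\<close>, so equal entries
    receive the same representative and \<open>\<rho>\<close> is idempotent.\<close>
  define \<rho> where "\<rho> = (\<lambda>i. SOME j. x $ j = x $ i)"
  have x\<rho>: "x $ \<rho> i = x $ i" for i unfolding \<rho>_def by (rule someI_ex) blast
  have \<rho>eq: "\<rho> i = \<rho> j" if "x $ i = x $ j" for i j using that by (simp add: \<rho>_def)
  have \<rho>: "\<rho> (\<rho> i) = \<rho> i" for i using \<rho>eq x\<rho> by blast
  have "z $ \<rho> i = z $ i" for i using pat x\<rho> by (metis linorder_less_linear less_irrefl)
  then have sp: "spread \<rho> x = x" "spread \<rho> z = z" by (simp_all add: spread_def vec_eq_iff x\<rho>)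
  \<comment> \<open>Strict inequalities are imposed between representatives only. The set they
    define is an intersection of half-spaces containing \<open>x\<close> and \<open>z\<close>, and
    its points have pairwise distinct representative entries.\<close>
  define I where "I = {(i, j). \<rho> i = i \<and> \<rho> j = j \<and> x $ i < x $ j}"
  define Om where "Om = (\<Inter>(i, j)\<in>I. {y :: real^'n. y $ i < y $ j})"
  have "convex {y :: real^'n. y $ i < y $ j}" for i j
  proof -
    have "{y :: real^'n. y $ i < y $ j} = {y. (axis i 1 - axis j 1) \<bullet> y < 0}"
      by (auto simp: inner_diff_left inner_axis')
    then show ?thesis using convex_halfspace_lt[of "axis i 1 - axis j 1" 0] by simp
  qed
  then have "convex Om" unfolding Om_def by (intro convex_INT) auto
  then have conn: "connected Om" by (rule convex_connected)
  have dist: "y $ i \<noteq> y $ j" if y: "y \<in> Om" and ij: "\<rho> i = i" "\<rho> j = j" "i \<noteq> j" for y i j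
  proof -
    have "x $ i \<noteq> x $ j" using \<rho>eq ij by metis
    then have "(i, j) \<in> I \<or> (j, i) \<in> I" using ij by (auto simp: I_def)
    then show ?thesis using y by (force simp: Om_def)
  qed
  have "x \<in> Om" "z \<in> Om" using pat by (auto simp: Om_def I_def)
  then have "steers V W (diag (spread \<rho> x)) (diag (spread \<rho> z))"
  proof (rule connected_equivalence_relation[OF conn])
    show "steers V W (diag (spread \<rho> b)) (diag (spread \<rho> a))" if "steers V W (diag (spread \<rho> a)) (diag (spread \<rho> b))" for a b
      using V W by (intro steers_sym[OF _ _ that]) (auto simp: equivariant_fields_def)
    show "steers V W (diag (spread \<rho> a)) (diag (spread \<rho> c))"
      if "steers V W (diag (spread \<rho> a)) (diag (spread \<rho> b))" "steers V W (diag (spread \<rho> b)) (diag (spread \<rho> c))" for a b c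
      using that by (rule steers_trans)
    fix a assume a: "a \<in> Om"
    have "\<exists>N. open N \<and> a \<in> N \<and> (\<forall>y\<in>N. steers V W (diag (spread \<rho> a)) (diag (spread \<rho> y)))"
      using good[OF \<rho> dist[OF a]] local_steering_rep_field[OF V W \<rho>] local_steering_rep_field[OF W V \<rho>]
      by (metis steers_commute)
    then obtain N where N: "open N" "a \<in> N" "\<forall>y\<in>N. steers V W (diag (spread \<rho> a)) (diag (spread \<rho> y))"
      by blast
    then show "\<exists>T. openin (top_of_set Om) T \<and> a \<in> T \<and> (\<forall>y\<in>T. steers V W (diag (spread \<rho> a)) (diag (spread \<rho> y)))"
      using a by (intro exI[of _ "Om \<inter> N"]) auto
  qed
  then show ?thesis by (simp add: sp)
qed

section \<open>Genericity\<close>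

subsection \<open>Solutions of parametrized linear systems\<close>

lemma smooth_prod_real: "(\<And>i. i \<in> I \<Longrightarrow> smooth (f i)) \<Longrightarrow> smooth (\<lambda>x. \<Prod>i\<in>I. f i x :: real)"
  by (induction I rule: infinite_finite_induct) (simp_all add: smooth_const smooth_mult)

lemma smooth_det:
  fixes A :: "'a::euclidean_space \<Rightarrow> real^'m^'m"
  assumes "\<And>i j. smooth (\<lambda>z. A z $ i $ j)"
  shows "smooth (\<lambda>z. det (A z))"
  unfolding det_def by (intro smooth_sum smooth_mult smooth_const smooth_prod_real assms)

text \<open>By Cramer's rule the solution is a quotient of determinants. This exhibits the bad
  parameters as a differentiable image.\<close>

lemma parametrized_solution:
  fixes A :: "'a::euclidean_space \<Rightarrow> real^'m^'m" and c :: "'a \<Rightarrow> real^'m"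
  assumes A: "\<And>i j. smooth (\<lambda>z. A z $ i $ j)" and c: "\<And>i. smooth (\<lambda>z. c z $ i)"
  shows "\<exists>s. s differentiable_on {z. det (A z) \<noteq> 0} \<and> (\<forall>z q. det (A z) \<noteq> 0 \<longrightarrow> A z *v q = c z \<longrightarrow> q = s z)"
proof -
  define d where "d = (\<lambda>k z. det (\<chi> i j. if j = k then c z $ i else A z $ i $ j))"
  define s where "s = (\<lambda>z. (\<chi> k. d k z / det (A z)))"
  have sd: "smooth (d k)" for k
  proof -
    have "smooth (\<lambda>z. if j = k then c z $ i else A z $ i $ j)" for i j
      by (cases "j = k") (simp_all add: A c)
    then show ?thesis unfolding d_def by (intro smooth_det) simp
  qed
  have "s differentiable (at z)" if "det (A z) \<noteq> 0" for z
  proof -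
    have "(\<lambda>z. d k z / det (A z)) differentiable (at z)" for k
      using that by (intro differentiable_divide smooth_differentiable sd smooth_det A)
    then have "(\<lambda>z. \<Sum>k\<in>UNIV. (d k z / det (A z)) *\<^sub>R axis k (1::real)) differentiable (at z)"
      by (intro differentiable_sum differentiable_scaleR) auto
    moreover have "s = (\<lambda>z. \<Sum>k\<in>UNIV. (d k z / det (A z)) *\<^sub>R axis k (1::real))"
      by (auto simp: s_def vec_eq_iff axis_def if_distrib[of "\<lambda>x. _ * x"] cong: if_cong)
    ultimately show ?thesis by simp
  qed
  then have "s differentiable_on {z. det (A z) \<noteq> 0}"
    by (simp add: differentiable_on_def differentiable_at_withinI)
  moreover have "q = s z" if "det (A z) \<noteq> 0" "A z *v q = c z" for z q
    using cramer[OF that(1), of q "c z"] that(2) by (simp add: s_def d_def)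
  ultimately show ?thesis by blast
qed

lemma ex_near_not_negligible:
  fixes N :: "'a::euclidean_space set"
  assumes "open U" "U \<noteq> {}" "negligible N"
  shows "\<exists>q\<in>U. q \<notin> N"
  using open_not_negligible[OF assms(1,2)] negligible_subset[OF assms(3)] by blast

text \<open>The parameters that keep the perturbed field in \<open>U\<close> form an open
  neighbourhood of 0, which no negligible set can fill.\<close>

lemma perturbation_parameters:
  fixes W :: "'n::finite sym_mat \<Rightarrow> 'n sym_mat" and P :: "'m::finite \<Rightarrow> 'n sym_mat \<Rightarrow> 'n sym_mat"
  assumes U: "openin smooth_topology U" and W: "W \<in> U" and P: "\<And>b. P b \<in> equivariant_fields"
  shows "open {q :: real^'m. (\<lambda>S. W S + (\<Sum>b\<in>UNIV. (q $ b) *\<^sub>R P b S)) \<in> U}"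
    "0 \<in> {q :: real^'m. (\<lambda>S. W S + (\<Sum>b\<in>UNIV. (q $ b) *\<^sub>R P b S)) \<in> U}"
proof -
  have "W \<in> equivariant_fields"
    using openin_subset[OF U] W topspace_smooth_topology by blast
  then show "open {q :: real^'m. (\<lambda>S. W S + (\<Sum>b\<in>UNIV. (q $ b) *\<^sub>R P b S)) \<in> U}"
    by (intro openin_lincomb_parameters[OF U _ P] equivariant_fields_add equivariant_fields_sum P)
  show "0 \<in> {q :: real^'m. (\<lambda>S. W S + (\<Sum>b\<in>UNIV. (q $ b) *\<^sub>R P b S)) \<in> U}"
    using W by simp
qed

lemma rep_field_lincomb:
  "rep_field \<rho> (\<lambda>S. W S + (\<Sum>b\<in>I. c b *\<^sub>R P b S)) =
     (\<lambda>y. rep_field \<rho> W y + (\<Sum>b\<in>I. c b *\<^sub>R rep_field \<rho> (P b) y))"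
proof -
  have "mat_of (\<Sum>b\<in>I. c b *\<^sub>R P b S) = (\<Sum>b\<in>I. c b *\<^sub>R mat_of (P b S))" for S
    by (simp add: linear_sum[OF linear_mat_of] linear_scale[OF linear_mat_of])
  then show ?thesis
    by (auto simp: fun_eq_iff vec_eq_iff rep_field_def plus_sym_mat.rep_eq intro!: sum.cong)
qed

text \<open>The factor \<open>topspace X\<close> takes care of the empty family, whose intersection
  is the whole type.\<close>

lemma dense_open_finite_Inter:
  assumes "finite \<U>" "\<And>U. U \<in> \<U> \<Longrightarrow> openin X U \<and> X closure_of U = topspace X"
  shows "openin X (topspace X \<inter> \<Inter>\<U>) \<and> X closure_of (topspace X \<inter> \<Inter>\<U>) = topspace X"
  using assms
proof (induction \<U> rule: finite_induct)
  case empty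
  then show ?case by simp
next
  case (insert U \<U>)
  let ?I = "topspace X \<inter> \<Inter>\<U>"
  have I: "openin X ?I" "X closure_of ?I = topspace X" and U: "openin X U" "X closure_of U = topspace X"
    using insert by auto
  have eq: "topspace X \<inter> \<Inter>(insert U \<U>) = U \<inter> ?I" by auto
  have "U \<inter> ?I \<inter> T \<noteq> {}" if T: "openin X T" "T \<noteq> {}" for T
  proof -
    have "?I \<inter> T \<noteq> {}" using I(2) T unfolding dense_intersects_open by blast
    moreover have "openin X (?I \<inter> T)" using I(1) T(1) by blast
    ultimately have "U \<inter> (?I \<inter> T) \<noteq> {}" using U(2) unfolding dense_intersects_open by blast
    then show ?thesis by blast
  qed
  then show ?case unfolding eq dense_intersects_open using U(1) I(1) by blast
qed

subsection \<open>The bracket condition\<close>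

text \<open>Treating the covector as a second variable makes bad points and bad covectors the zeros
  of smooth functions of one pair, ready for compactness and dimension counting.\<close>

definition bracket_pairing ::
    "('n \<Rightarrow> 'n) \<Rightarrow> ('n::finite sym_mat \<Rightarrow> 'n sym_mat) \<Rightarrow> ('n sym_mat \<Rightarrow> 'n sym_mat) \<Rightarrow> nat \<Rightarrow>
     (real^'n) \<times> (real^'n) \<Rightarrow> real" where
  "bracket_pairing \<rho> V W j z = snd z \<bullet> iter_bracket (rep_field \<rho> V) (rep_field \<rho> W) j (fst z)"

lemma smooth_bracket_pairing:
  assumes "smooth V" "smooth W"
  shows "smooth (bracket_pairing \<rho> V W j)"
  unfolding bracket_pairing_def[abs_def] using assms
  by (intro smooth_inner smooth_linear[OF linear_snd] smooth_linear_pre[OF linear_fst]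
      smooth_iter_bracket smooth_rep_field)

lemma smooth_lim_linear_pre:
  fixes m :: "'c::euclidean_space \<Rightarrow> 'a::euclidean_space" and g :: "'a \<Rightarrow> 'b::euclidean_space"
  assumes "linear m" "smooth_lim F f g"
  shows "smooth_lim F (\<lambda>i x. f i (m x)) (\<lambda>x. g (m x))"
  by (rule smooth_lim_linear_comp[OF _ assms(1) assms(2), where l="\<lambda>y. y"]) (simp add: linear_iff)

lemma smooth_lim_bracket_pairing:
  assumes "smooth_lim F V V0" "smooth_lim F W W0"
  shows "smooth_lim F (\<lambda>i. bracket_pairing \<rho> (V i) (W i) j) (bracket_pairing \<rho> V0 W0 j)"
  unfolding bracket_pairing_def[abs_def] using assms
  by (intro smooth_lim_bilinear[OF bounded_bilinear_inner] smooth_lim_const smooth_linear[OF linear_snd]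
      smooth_lim_linear_pre[OF linear_fst] smooth_lim_iter_bracket smooth_lim_rep_field)

lemma smooth_lim_Pair:
  fixes g :: "'a::euclidean_space \<Rightarrow> 'b::euclidean_space" and g' :: "'a \<Rightarrow> 'c::euclidean_space"
  assumes "smooth_lim F f g" "smooth_lim F f' g'"
  shows "smooth_lim F (\<lambda>i x. (f i x, f' i x)) (\<lambda>x. (g x, g' x))"
proof -
  have l: "linear (\<lambda>y::'b. (y, 0::'c))" "linear (\<lambda>y::'c. (0::'b, y))" "linear (\<lambda>x::'a. x)"
    by (auto simp: linear_iff)
  from smooth_lim_add[OF smooth_lim_linear_comp[OF l(1,3) assms(1)] smooth_lim_linear_comp[OF l(2,3) assms(2)]]
  show ?thesis by simp
qed

text \<open>The disjunction becomes membership in an open subset of the plane: one coordinate is the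
  squared speed, the other the sum of the squared pairings.\<close>

lemma bracket_condition_stable:
  assumes V: "smooth_lim F V V0" and W: "smooth_lim F W W0" and Z: "compact Z"
    and good: "\<And>z. z \<in> Z \<Longrightarrow> rep_field \<rho> V0 (fst z) \<bullet> rep_field \<rho> V0 (fst z) < d \<or>
       (\<exists>j\<in>J. bracket_pairing \<rho> V0 W0 j z \<noteq> 0)" and J: "finite J"
  shows "\<forall>\<^sub>F i in F. \<forall>z\<in>Z. rep_field \<rho> (V i) (fst z) \<bullet> rep_field \<rho> (V i) (fst z) < d \<or>
       (\<exists>j\<in>J. bracket_pairing \<rho> (V i) (W i) j z \<noteq> 0)"
proof -
  define H where "H = (\<lambda>V W z. (rep_field \<rho> V (fst z) \<bullet> rep_field \<rho> V (fst z),
      \<Sum>j\<in>J. bracket_pairing \<rho> V W j z * bracket_pairing \<rho> V W j z))"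
  have lim: "smooth_lim F (\<lambda>i. H (V i) (W i)) (H V0 W0)"
    unfolding H_def using V W
    by (intro smooth_lim_Pair smooth_lim_bilinear[OF bounded_bilinear_inner] smooth_lim_sum
        smooth_lim_bilinear[OF bounded_bilinear_mult] smooth_lim_bracket_pairing
        smooth_lim_linear_pre[OF linear_fst] smooth_lim_rep_field)
  let ?U = "{ab :: real \<times> real. fst ab < d \<or> 0 < snd ab}"
  have mem: "H V W z \<in> ?U \<longleftrightarrow> rep_field \<rho> V (fst z) \<bullet> rep_field \<rho> V (fst z) < d \<or>
       (\<exists>j\<in>J. bracket_pairing \<rho> V W j z \<noteq> 0)" for V W z
  proof -
    have "0 \<le> (\<Sum>j\<in>J. bracket_pairing \<rho> V W j z * bracket_pairing \<rho> V W j z)"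
      by (intro sum_nonneg) simp
    then have "0 < (\<Sum>j\<in>J. bracket_pairing \<rho> V W j z * bracket_pairing \<rho> V W j z) \<longleftrightarrow>
        (\<Sum>j\<in>J. bracket_pairing \<rho> V W j z * bracket_pairing \<rho> V W j z) \<noteq> 0"
      by auto
    also have "\<dots> \<longleftrightarrow> (\<exists>j\<in>J. bracket_pairing \<rho> V W j z \<noteq> 0)"
      using J by (simp add: sum_nonneg_eq_0_iff)
    finally show ?thesis by (simp add: H_def)
  qed
  have op: "open ?U"
    by (intro open_Collect_disj open_Collect_less continuous_intros)
  have "\<forall>\<^sub>F i in F. \<forall>z\<in>Z. H (V i) (W i) z \<in> ?U"
    by (rule uniform_limit_compact_open[OF Z smooth_continuous_on[OF smooth_limD(1)[OF lim]]
          smooth_limD(3)[OF lim Z] op]) (use good mem in blast)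
  then show ?thesis by (simp only: mem)
qed

lemma rep_field_pow_field:
  "rep_field \<rho> (pow_field a) y = (\<chi> i. if \<rho> i = i then y $ i ^ a else 0)"
  by (simp add: rep_field_def pow_field_diag mat_of_diag spread_def vec_eq_iff)

lemma rep_field_scale:
  "rep_field \<rho> (\<lambda>S. f S *\<^sub>R V S) = (\<lambda>y. f (diag (spread \<rho> y)) *\<^sub>R rep_field \<rho> V y)"
  by (auto simp: rep_field_def vec_eq_iff fun_eq_iff scaleR_sym_mat.rep_eq)

lemma deriv_along_diag_spread:
  assumes f: "smooth f" and V: "equivariant V" and \<rho>: "\<And>i. \<rho> (\<rho> i) = \<rho> i"
  shows "deriv_along (rep_field \<rho> V) (\<lambda>y. f (diag (spread \<rho> y))) y =
     frechet_derivative f (at (diag (spread \<rho> y))) (diag (spread \<rho> (rep_field \<rho> V y)))"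
proof -
  have "((\<lambda>y. f (diag (spread \<rho> y))) has_derivative
      (\<lambda>h. frechet_derivative f (at (diag (spread \<rho> y))) (diag (spread \<rho> h)))) (at y)"
    by (rule has_derivative_compose[OF linear_imp_has_derivative[OF linear_diag_spread] smooth_has_derivative[OF f]])
  from frechet_derivative_at[OF this] show ?thesis by (simp add: deriv_along_def fun_eq_iff)
qed

text \<open>For \<open>f\<close>, a trace of a power is shifted to vanish at the point; its
  derivative along the nonzero block-constant direction is nonzero for some exponent. For
  \<open>a\<close>, the representative entries of \<open>y\<close> are distinct nodes, so the
  moments of \<open>p\<close> cannot all vanish.\<close>

lemma separating_function_and_field:
  fixes V :: "'n::finite sym_mat \<Rightarrow> 'n sym_mat"
  assumes V: "V \<in> equivariant_fields" and \<rho>: "\<And>i. \<rho> (\<rho> i) = \<rho> i"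
    and dist: "\<And>i j. \<rho> i = i \<Longrightarrow> \<rho> j = j \<Longrightarrow> i \<noteq> j \<Longrightarrow> y $ i \<noteq> y $ j"
    and V0: "rep_field \<rho> V y \<noteq> 0" and p: "\<And>i. \<rho> i \<noteq> i \<Longrightarrow> p $ i = 0" "p \<noteq> 0"
  shows "\<exists>f a. smooth f \<and> invariant f \<and> f (diag (spread \<rho> y)) = (0::real) \<and>
     deriv_along (rep_field \<rho> V) (\<lambda>y. f (diag (spread \<rho> y))) y \<noteq> 0 \<and> p \<bullet> rep_field \<rho> (pow_field a) y \<noteq> 0"
proof -
  have e: "equivariant V" using V by (simp add: equivariant_fields_def)
  let ?x = "spread \<rho> y" and ?w = "spread \<rho> (rep_field \<rho> V y)"
  obtain i where i: "rep_field \<rho> V y $ i \<noteq> 0" using V0 by (auto simp: vec_eq_iff)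
  then have "\<rho> i = i" using rep_field_dummy by metis
  then have "?w $ i \<noteq> 0" using i by (simp add: spread_def)
  then have w0: "?w \<noteq> 0" by auto
  have lev: "?w $ i = ?w $ j" if "?x $ i = ?x $ j" for i j
  proof -
    have "\<rho> i = \<rho> j" using dist[of "\<rho> i" "\<rho> j"] that \<rho> by (auto simp: spread_def)
    then show ?thesis by (simp add: spread_def)
  qed
  obtain k where k: "frechet_derivative (trace_pow k) (at (diag ?x)) (diag ?w) \<noteq> 0"
    using trace_pow_separates[OF w0 lev] by blast
  define f where "f = (\<lambda>S :: 'n sym_mat. trace_pow k S - trace_pow k (diag ?x))"
  have f: "smooth f" "invariant f"
    unfolding f_def by (auto intro!: smooth_diff smooth_trace_pow smooth_const simp: invariant_def trace_pow_act)
  have "(f has_derivative frechet_derivative (trace_pow k) (at S)) (at S)" for S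
    unfolding f_def using has_derivative_diff[OF smooth_has_derivative[OF smooth_trace_pow] has_derivative_const]
    by simp
  from frechet_derivative_at[OF this]
  have df: "frechet_derivative f (at S) = frechet_derivative (trace_pow k) (at S)" for S by simp
  have "\<exists>a. p \<bullet> rep_field \<rho> (pow_field a) y \<noteq> 0"
  proof (rule ccontr)
    assume neg: "\<not> ?thesis"
    have "(\<Sum>i | \<rho> i = i. p $ i * y $ i ^ a) = 0" for a
    proof -
      have "p \<bullet> rep_field \<rho> (pow_field a) y = (\<Sum>i\<in>UNIV. if \<rho> i = i then p $ i * y $ i ^ a else 0)"
        by (auto simp: rep_field_pow_field inner_vec_def intro!: sum.cong)
      then show ?thesis using neg by (simp add: sum.If_cases)
    qed
    moreover have "inj_on (($) y) {i. \<rho> i = i}" using dist by (auto simp: inj_on_def)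
    ultimately have "p $ i = 0" if "\<rho> i = i" for i
      using power_sums_separate[of "{i. \<rho> i = i}" "($) y" "($) p" i] that by simp
    then show False using p by (auto simp: vec_eq_iff)
  qed
  then obtain a where a: "p \<bullet> rep_field \<rho> (pow_field a) y \<noteq> 0" by blast
  have "deriv_along (rep_field \<rho> V) (\<lambda>y. f (diag (spread \<rho> y))) y \<noteq> 0"
    using deriv_along_diag_spread[OF f(1) e \<rho>, of y] k by (simp add: df)
  moreover have "f (diag ?x) = 0" by (simp add: f_def)
  ultimately show ?thesis using f a by blast
qed

text \<open>At the base point the matrix is triangular with respect to the order given by \<open>e\<close>.\<close>

lemma bracket_matrix_invertible:
  fixes e :: "'m::finite \<Rightarrow> nat" and X Z :: "real^'n \<Rightarrow> real^'n"
  assumes e: "inj e" and f: "smooth f" and X: "smooth X" and Z: "smooth Z"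
    and f0: "f y = 0" and df: "deriv_along X f y \<noteq> 0" and p: "p \<bullet> Z y \<noteq> 0"
  shows "det (\<chi> j b. p \<bullet> iter_bracket X (\<lambda>y. f y ^ e b *\<^sub>R Z y) (e j) y :: real^'m^'m) \<noteq> 0"
proof -
  let ?A = "(\<chi> j b. p \<bullet> iter_bracket X (\<lambda>y. f y ^ e b *\<^sub>R Z y) (e j) y) :: real^'m^'m"
  have upper: "?A $ j $ b = 0" if lt: "e j < e b" for j b
  proof -
    obtain d where d: "e b = e j + Suc d" using less_imp_Suc_add[OF lt] by auto
    obtain h where "iter_bracket X (\<lambda>y. f y ^ (e j + Suc d) *\<^sub>R Z y) (e j) = (\<lambda>y. f y ^ Suc d *\<^sub>R h y)"
      using iter_bracket_power_scaleR[OF f X Z, of "e j" "Suc d"] by blast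
    then show ?thesis using f0 by (simp add: d)
  qed
  have diagonal: "?A $ j $ j \<noteq> 0" for j
  proof -
    obtain h c where h: "c > 0" "\<forall>x. f x = 0 \<longrightarrow> h x = (c * deriv_along X f x ^ e j) *\<^sub>R Z x"
      "iter_bracket X (\<lambda>y. f y ^ (e j + 0) *\<^sub>R Z y) (e j) = (\<lambda>y. f y ^ 0 *\<^sub>R h y)"
      using iter_bracket_power_scaleR[OF f X Z, of "e j" 0] by blast
    then have "?A $ j $ j = (c * deriv_along X f y ^ e j) * (p \<bullet> Z y)"
      using f0 by simp
    then show ?thesis using h(1) df p by simp
  qed
  have "q = 0" if q: "?A *v q = 0" for q
  proof -
    have "q $ b = 0" for b
    \<comment> \<open>Forward substitution: row \<open>b\<close> involves the unknowns already shown
      to be 0 and the diagonal one.\<close>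
    proof (induction "e b" arbitrary: b rule: less_induct)
      case less
      have "0 = (?A *v q) $ b" using q by simp
      also have "\<dots> = (\<Sum>b'\<in>UNIV. ?A $ b $ b' * q $ b')"
        by (simp add: matrix_vector_mult_def)
      also have "\<dots> = (\<Sum>b'\<in>UNIV. if b' = b then ?A $ b $ b * q $ b else 0)"
      proof (rule sum.cong[OF refl])
        fix b'
        consider "b' = b" | "e b' < e b" | "e b < e b'" using e by (metis injD linorder_less_linear)
        then show "?A $ b $ b' * q $ b' = (if b' = b then ?A $ b $ b * q $ b else 0)"
        proof cases
          case 2
          then show ?thesis using less[of b'] by auto
        next
          case 3
          then show ?thesis using upper[OF 3] by auto
        qed simp
      qed
      also have "\<dots> = ?A $ b $ b * q $ b" by simp
      finally show ?case using diagonal[of b] by simp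
    qed
    then show ?thesis by (simp add: vec_eq_iff)
  qed
  then have "invertible ?A"
    unfolding invertible_left_inverse matrix_left_invertible_ker by blast
  then show ?thesis by (simp add: invertible_det_nz)
qed

text \<open>The matrix \<open>A\<close> involves only \<open>V\<close> and the perturbing fields, so
  \<open>\<epsilon>\<close> is fixed before any \<open>W\<close> or open set is given; this is what
  allows a finite cover later. The hypothesis on cardinalities makes the parameter space larger than
  the space of pairs of points and covectors.\<close>

lemma bracket_condition_locally_dense:
  fixes V :: "'n::finite sym_mat \<Rightarrow> 'n sym_mat" and e :: "'m::finite \<Rightarrow> nat"
  assumes e: "inj e" and card: "2 * CARD('n) < CARD('m)"
    and V: "V \<in> equivariant_fields" and \<rho>: "\<And>i. \<rho> (\<rho> i) = \<rho> i"
    and dist: "\<And>i j. \<rho> i = i \<Longrightarrow> \<rho> j = j \<Longrightarrow> i \<noteq> j \<Longrightarrow> y0 $ i \<noteq> y0 $ j"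
    and V0: "rep_field \<rho> V y0 \<noteq> 0" and p: "\<And>i. \<rho> i \<noteq> i \<Longrightarrow> p0 $ i = 0" "p0 \<noteq> 0"
  shows "\<exists>\<epsilon>>0. smooth_topology closure_of {W \<in> equivariant_fields.
      \<forall>z\<in>cball (y0, p0) \<epsilon>. \<exists>j\<in>range e. bracket_pairing \<rho> V W j z \<noteq> 0} = topspace smooth_topology"
proof -
  obtain f a where f: "smooth f" "invariant f" "f (diag (spread \<rho> y0)) = (0::real)"
    "deriv_along (rep_field \<rho> V) (\<lambda>y. f (diag (spread \<rho> y))) y0 \<noteq> 0" "p0 \<bullet> rep_field \<rho> (pow_field a) y0 \<noteq> 0"
    using separating_function_and_field[OF V \<rho> dist V0 p] by blast
  have sV: "smooth V" "smooth (rep_field \<rho> V)" using V smooth_rep_field by (auto simp: equivariant_fields_def)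
  define P where "P = (\<lambda>b :: 'm. \<lambda>S. f S ^ e b *\<^sub>R pow_field a S)"
  have P: "P b \<in> equivariant_fields" for b
    unfolding P_def using f(1,2)
    by (intro equivariant_fields_scale smooth_power pow_field_equivariant_fields) (auto simp: invariant_def)
  then have sP: "smooth (P b)" for b by (simp add: equivariant_fields_def)
  have rP: "rep_field \<rho> (P b) = (\<lambda>y. f (diag (spread \<rho> y)) ^ e b *\<^sub>R rep_field \<rho> (pow_field a) y)" for b
    unfolding P_def by (rule rep_field_scale)
  define A where "A = (\<lambda>z. (\<chi> j b. bracket_pairing \<rho> V (P b) (e j) z) :: real^'m^'m)"
  have sA: "smooth (\<lambda>z. A z $ j $ b)" for j b
    unfolding A_def using smooth_bracket_pairing[OF sV(1) sP] by simp
  have "smooth (rep_field \<rho> (pow_field a))"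
    using pow_field_equivariant_fields smooth_rep_field by (auto simp: equivariant_fields_def)
  then have "det (A (y0, p0)) \<noteq> 0"
    unfolding A_def bracket_pairing_def rP fst_conv snd_conv
    by (intro bracket_matrix_invertible e smooth_linear_pre[OF linear_diag_spread] f sV)
  moreover have "isCont (\<lambda>z. det (A z)) (y0, p0)"
    using smooth_continuous_on[OF smooth_det[OF sA], of UNIV] by (simp add: continuous_on_eq_continuous_at)
  ultimately obtain \<epsilon>' where \<epsilon>': "\<epsilon>' > 0" "\<And>z. dist (y0, p0) z < \<epsilon>' \<Longrightarrow> det (A z) \<noteq> 0"
    using continuous_at_avoid[of "(y0, p0)" "\<lambda>z. det (A z)" 0] by blast
  have "\<exists>W\<in>U. W \<in> equivariant_fields \<and> (\<forall>z\<in>cball (y0, p0) (\<epsilon>'/2). \<exists>j\<in>range e. bracket_pairing \<rho> V W j z \<noteq> 0)"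
    if U: "openin smooth_topology U" "U \<noteq> {}" for U
  proof -
    obtain W where W: "W \<in> U" using U(2) by blast
    then have WE: "W \<in> equivariant_fields" using openin_subset[OF U(1)] topspace_smooth_topology by blast
    then have sW: "smooth W" by (simp add: equivariant_fields_def)
    \<comment> \<open>The sign is chosen so that all pairings of the perturbed field vanish at
      \<open>z\<close> exactly when \<open>A z *v q = c z\<close>.\<close>
    define c where "c = (\<lambda>z. (\<chi> j. - bracket_pairing \<rho> V W (e j) z) :: real^'m)"
    have sc: "smooth (\<lambda>z. c z $ j)" for j
      unfolding c_def using smooth_minus[OF smooth_bracket_pairing[OF sV(1) sW]] by simp
    obtain s where s: "s differentiable_on {z. det (A z) \<noteq> 0}"
      "\<And>z q. det (A z) \<noteq> 0 \<Longrightarrow> A z *v q = c z \<Longrightarrow> q = s z"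
      using parametrized_solution[of A c, OF sA sc] by blast
    have neg: "negligible (s ` {z. det (A z) \<noteq> 0})"
      by (rule negligible_differentiable_image_lowdim[OF _ s(1)]) (use card in simp)
    define Q where "Q = {q :: real^'m. (\<lambda>S. W S + (\<Sum>b\<in>UNIV. (q $ b) *\<^sub>R P b S)) \<in> U}"
    have "open Q" "0 \<in> Q" unfolding Q_def by (rule perturbation_parameters[OF U(1) W P])+
    then have "\<exists>q\<in>Q. q \<notin> s ` {z. det (A z) \<noteq> 0}"
      by (intro ex_near_not_negligible[OF _ _ neg]) auto
    then obtain q where q: "(\<lambda>S. W S + (\<Sum>b\<in>UNIV. (q $ b) *\<^sub>R P b S)) \<in> U" "q \<notin> s ` {z. det (A z) \<noteq> 0}"
      unfolding Q_def by blast
    let ?W = "\<lambda>S. W S + (\<Sum>b\<in>UNIV. (q $ b) *\<^sub>R P b S)"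
    have "\<exists>j\<in>range e. bracket_pairing \<rho> V ?W j z \<noteq> 0" if z: "z \<in> cball (y0, p0) (\<epsilon>'/2)" for z
    proof (rule ccontr)
      assume neg: "\<not> ?thesis"
      have dz: "det (A z) \<noteq> 0" by (rule \<epsilon>'(2)) (use z \<epsilon>'(1) in auto)
      have "(A z *v q) $ j = c z $ j" for j
      proof -
        have "0 = bracket_pairing \<rho> V ?W (e j) z" using neg by simp
        also have "\<dots> = bracket_pairing \<rho> V W (e j) z + (\<Sum>b\<in>UNIV. q $ b * bracket_pairing \<rho> V (P b) (e j) z)"
          unfolding bracket_pairing_def rep_field_lincomb
          by (subst iter_bracket_add, (intro sV smooth_rep_field sW smooth_sum smooth_scaleR smooth_const sP)+,
              subst iter_bracket_sum, (intro sV smooth_rep_field sP)+, simp add: inner_add_right inner_sum_right)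
        finally show ?thesis by (simp add: A_def c_def matrix_vector_mult_def mult.commute)
      qed
      then have "A z *v q = c z" by (simp add: vec_eq_iff)
      then show False using s(2)[OF dz] q(2) dz by blast
    qed
    moreover have "?W \<in> equivariant_fields"
      using openin_subset[OF U(1)] q(1) topspace_smooth_topology by blast
    ultimately show ?thesis using q(1) by blast
  qed
  then have "smooth_topology closure_of {W \<in> equivariant_fields.
      \<forall>z\<in>cball (y0, p0) (\<epsilon>'/2). \<exists>j\<in>range e. bracket_pairing \<rho> V W j z \<noteq> 0} = topspace smooth_topology"
    unfolding dense_intersects_open by blast
  then show ?thesis using \<epsilon>'(1) by (intro exI[of _ "\<epsilon>'/2"]) auto
qed

text \<open>A compact exhaustion of the points with distinct representative entries. It prescribes
  no order among them, so one partition serves all orderings; the dummies are bounded along with the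
  rest.\<close>

definition stratum_piece :: "('n \<Rightarrow> 'n) \<Rightarrow> nat \<Rightarrow> (real^'n) set" where
  "stratum_piece \<rho> l = {y. norm y \<le> real l \<and>
     (\<forall>i j. \<rho> i = i \<longrightarrow> \<rho> j = j \<longrightarrow> i \<noteq> j \<longrightarrow> \<bar>y $ i - y $ j\<bar> \<ge> 1 / real (Suc l))}"

lemma compact_stratum_piece: "compact (stratum_piece \<rho> l :: (real^'n) set)"
proof -
  have "stratum_piece \<rho> l = cball 0 (real l) \<inter>
      (\<Inter>(i, j)\<in>{(i, j). \<rho> i = i \<and> \<rho> j = j \<and> i \<noteq> j}. {y :: real^'n. 1 / real (Suc l) \<le> \<bar>y $ i - y $ j\<bar>})"
    by (auto simp: stratum_piece_def)
  moreover have "closed {y :: real^'n. 1 / real (Suc l) \<le> \<bar>y $ i - y $ j\<bar>}" for i j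
    by (intro closed_Collect_le continuous_intros)
  ultimately show ?thesis by (auto intro!: compact_Int_closed closed_INT)
qed

lemma stratum_piece_distinct:
  "y \<in> stratum_piece \<rho> l \<Longrightarrow> \<rho> i = i \<Longrightarrow> \<rho> j = j \<Longrightarrow> i \<noteq> j \<Longrightarrow> y $ i \<noteq> y $ j"
  unfolding stratum_piece_def by (fastforce simp: divide_simps)

definition rep_sphere :: "('n::finite \<Rightarrow> 'n) \<Rightarrow> (real^'n) set" where
  "rep_sphere \<rho> = {p. (\<forall>i. \<rho> i \<noteq> i \<longrightarrow> p $ i = 0) \<and> norm p = 1}"

lemma compact_rep_sphere:
  fixes \<rho> :: "'n::finite \<Rightarrow> 'n"
  shows "compact (rep_sphere \<rho>)"
proof -
  have "rep_sphere \<rho> = sphere 0 1 \<inter> (\<Inter>i\<in>{i. \<rho> i \<noteq> i}. {p :: real^'n. p $ i = 0})"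
    by (auto simp: rep_sphere_def)
  moreover have "closed {p :: real^'n. p $ i = 0}" for i
    by (intro closed_Collect_eq continuous_intros)
  ultimately show ?thesis by (auto intro!: compact_Int_closed closed_INT)
qed

text \<open>Slow points of the first field are exempted with a margin that shrinks as
  \<open>l\<close> grows. The strict inequality keeps the region open, and the intersection over
  \<open>l\<close> covers every nonzero of the field. Orders up to \<open>2 * CARD('n)\<close> give
  one equation more than the dimension of the pairs.\<close>

definition bracket_region ::
    "('n \<Rightarrow> 'n) \<Rightarrow> nat \<Rightarrow> (('n::finite sym_mat \<Rightarrow> 'n sym_mat) \<times> ('n sym_mat \<Rightarrow> 'n sym_mat)) set" where
  "bracket_region \<rho> l = {X \<in> equivariant_fields \<times> equivariant_fields. \<forall>z\<in>stratum_piece \<rho> l \<times> rep_sphere \<rho>.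
     rep_field \<rho> (fst X) (fst z) \<bullet> rep_field \<rho> (fst X) (fst z) < 1 / real (Suc l) \<or>
     (\<exists>j\<in>{..2 * CARD('n)}. bracket_pairing \<rho> (fst X) (snd X) j z \<noteq> 0)}"

lemma bracket_region_iff:
  fixes V W :: "'n::finite sym_mat \<Rightarrow> 'n sym_mat"
  shows "(V, W) \<in> bracket_region \<rho> l \<longleftrightarrow> V \<in> equivariant_fields \<and> W \<in> equivariant_fields \<and>
     (\<forall>z\<in>stratum_piece \<rho> l \<times> rep_sphere \<rho>. rep_field \<rho> V (fst z) \<bullet> rep_field \<rho> V (fst z) < 1 / real (Suc l) \<or>
       (\<exists>j\<in>{..2 * CARD('n)}. bracket_pairing \<rho> V W j z \<noteq> 0))"
  unfolding bracket_region_def mem_Collect_eq mem_Times_iff fst_conv snd_conv by blast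

section \<open>Neighbourhood filters of fields and of pairs of fields\<close>

lemma smooth_lim_filterlim:
  assumes "smooth_lim G f g" "filterlim h G F"
  shows "smooth_lim F (\<lambda>i. f (h i)) g"
  using assms(1) unfolding smooth_lim_def smooth_lim_upto_def
  by (auto intro: filterlim_compose[OF _ assms(2)] elim: eventually_compose_filterlim[OF _ assms(2)])

lemma filterlim_nhdsin:
  assumes "continuous_map X Y h" "x \<in> topspace X"
  shows "filterlim h (nhdsin Y (h x)) (nhdsin X x)"
  unfolding filterlim_iff
proof (intro allI impI)
  fix P assume P: "eventually P (nhdsin Y (h x))"
  have "h x \<in> topspace Y" using assms continuous_map_image_subset_topspace by blast
  then obtain S where S: "openin Y S" "h x \<in> S" "\<forall>y\<in>S. P y"
    using P unfolding eventually_nhdsin by blast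
  have "openin X {x \<in> topspace X. h x \<in> S}" by (rule openin_continuous_map_preimage[OF assms(1) S(1)])
  then show "\<forall>\<^sub>F x in nhdsin X x. P (h x)"
    unfolding eventually_nhdsin using S assms(2) by blast
qed

lemma openin_if_eventually_nhdsin:
  assumes "U \<subseteq> topspace X" "\<And>x. x \<in> U \<Longrightarrow> \<forall>\<^sub>F y in nhdsin X x. y \<in> U"
  shows "openin X U"
proof (subst openin_subopen, intro ballI)
  fix x assume x: "x \<in> U"
  then show "\<exists>T. openin X T \<and> x \<in> T \<and> T \<subseteq> U"
    using assms(2)[OF x, unfolded eventually_nhdsin] assms(1) by blast
qed

lemma eventually_nhdsin_topspace: "\<forall>\<^sub>F y in nhdsin X x. y \<in> topspace X"
  unfolding eventually_nhdsin by blast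

abbreviation pair_topology ::
    "(('n::finite sym_mat \<Rightarrow> 'n sym_mat) \<times> ('n sym_mat \<Rightarrow> 'n sym_mat)) topology" where
  "pair_topology \<equiv> prod_topology smooth_topology smooth_topology"

lemma topspace_pair_topology: "topspace pair_topology = equivariant_fields \<times> equivariant_fields"
  by (simp add: topspace_smooth_topology)

lemma smooth_lim_pair:
  assumes "V \<in> equivariant_fields" "W \<in> equivariant_fields"
  shows "smooth_lim (nhdsin pair_topology (V, W)) fst V" "smooth_lim (nhdsin pair_topology (V, W)) snd W"
  using smooth_lim_filterlim[OF smooth_lim_nhdsin[OF assms(1)] filterlim_nhdsin[OF continuous_map_fst, of "(V, W)", simplified]]
    smooth_lim_filterlim[OF smooth_lim_nhdsin[OF assms(2)] filterlim_nhdsin[OF continuous_map_snd, of "(V, W)", simplified]]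
    assms by (simp_all add: topspace_smooth_topology)

lemma openin_bracket_region: "openin pair_topology (bracket_region \<rho> l)"
proof (rule openin_if_eventually_nhdsin)
  show "bracket_region \<rho> l \<subseteq> topspace pair_topology"
    by (auto simp: bracket_region_def topspace_smooth_topology)
  fix VW :: "('a sym_mat \<Rightarrow> 'a sym_mat) \<times> ('a sym_mat \<Rightarrow> 'a sym_mat)"
  assume VW: "VW \<in> bracket_region \<rho> l"
  obtain V W where eq: "VW = (V, W)" by (cases VW)
  have E: "V \<in> equivariant_fields" "W \<in> equivariant_fields" using VW by (auto simp: bracket_region_def eq)
  have ev: "\<forall>\<^sub>F X in nhdsin pair_topology VW. \<forall>z\<in>stratum_piece \<rho> l \<times> rep_sphere \<rho>.
      rep_field \<rho> (fst X) (fst z) \<bullet> rep_field \<rho> (fst X) (fst z) < 1 / real (Suc l) \<or>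
        (\<exists>j\<in>{..2 * CARD('a)}. bracket_pairing \<rho> (fst X) (snd X) j z \<noteq> 0)"
    unfolding eq
    by (rule bracket_condition_stable[OF smooth_lim_pair[OF E] compact_Times[OF compact_stratum_piece compact_rep_sphere]])
      (use VW[unfolded eq bracket_region_iff] in blast, simp)
  show "\<forall>\<^sub>F X in nhdsin pair_topology VW. X \<in> bracket_region \<rho> l"
    using ev eventually_nhdsin_topspace
    by eventually_elim (simp only: bracket_region_def topspace_pair_topology mem_Collect_eq)
qed

text \<open>\<open>V\<close> is left alone and only \<open>W\<close> is moved. The points where
  \<open>V\<close> is not slow form a compact set, on which the local result yields finitely many
  dense open conditions on \<open>W\<close>.\<close>

lemma dense_bracket_region:
  fixes \<rho> :: "'n::finite \<Rightarrow> 'n"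
  assumes \<rho>: "\<And>i. \<rho> (\<rho> i) = \<rho> i"
  shows "pair_topology closure_of bracket_region \<rho> l = topspace pair_topology"
proof -
  let ?J = "{..2 * CARD('n)}"
  \<comment> \<open>This type has \<open>2 * CARD('n) + 1\<close> elements, one for each bracket
    order in \<open>?J\<close>.\<close>
  obtain e :: "('n + 'n) option \<Rightarrow> nat" where e: "bij_betw e UNIV ?J"
    using ex_bij_betw_finite_nat[of "UNIV :: ('n + 'n) option set"]
    by (auto simp: atLeast0LessThan lessThan_Suc_atMost mult_2)
  then have e': "inj e" "range e = ?J" by (auto simp: bij_betw_def)
  have card: "2 * CARD('n) < CARD(('n + 'n) option)" by simp
  have "bracket_region \<rho> l \<inter> T \<noteq> {}" if T: "openin pair_topology T" "T \<noteq> {}" for T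
  proof -
    obtain V W where VW: "(V, W) \<in> T" using T(2) by fastforce
    obtain T1 T2 where T12: "openin smooth_topology T1" "openin smooth_topology T2" "V \<in> T1" "W \<in> T2" "T1 \<times> T2 \<subseteq> T"
      using T(1) VW unfolding openin_prod_topology_alt by metis
    have VE: "V \<in> equivariant_fields" using openin_subset[OF T12(1)] T12(3) topspace_smooth_topology by blast
    then have sV: "smooth V" by (simp add: equivariant_fields_def)
    define Z where "Z = (stratum_piece \<rho> l \<inter> {y. 1 / real (Suc l) \<le> rep_field \<rho> V y \<bullet> rep_field \<rho> V y}) \<times> rep_sphere \<rho>"
    have "continuous_on UNIV (rep_field \<rho> V)" using smooth_continuous_on[OF smooth_rep_field[OF sV]] .
    then have "closed {y. 1 / real (Suc l) \<le> rep_field \<rho> V y \<bullet> rep_field \<rho> V y}"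
      by (intro closed_Collect_le continuous_intros)
    then have Z: "compact Z"
      unfolding Z_def by (intro compact_Times compact_Int_closed compact_stratum_piece compact_rep_sphere)
    define G where "G = (\<lambda>z \<epsilon>. {W \<in> equivariant_fields. \<forall>z'\<in>cball z \<epsilon>. \<exists>j\<in>?J. bracket_pairing \<rho> V W j z' \<noteq> 0})"
    have "\<exists>\<epsilon>>0. smooth_topology closure_of (G z \<epsilon>) = topspace smooth_topology" if z: "z \<in> Z" for z
    proof -
      obtain y p where zeq: "z = (y, p)" by (cases z)
      have y: "y \<in> stratum_piece \<rho> l" "1 / real (Suc l) \<le> rep_field \<rho> V y \<bullet> rep_field \<rho> V y"
        and p: "\<And>i. \<rho> i \<noteq> i \<Longrightarrow> p $ i = 0" "norm p = 1" using z by (auto simp: Z_def zeq rep_sphere_def)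
      have "(0::real) < 1 / real (Suc l)" by simp
      then have "rep_field \<rho> V y \<noteq> 0" using y(2) by (metis inner_zero_left not_le)
      moreover have "p \<noteq> 0" using p(2) by auto
      ultimately show ?thesis
        using bracket_condition_locally_dense[OF e'(1) card VE \<rho> stratum_piece_distinct[OF y(1)] _ p(1)]
        unfolding G_def zeq e'(2) by blast
    qed
    then obtain \<epsilon> where \<epsilon>: "\<And>z. z \<in> Z \<Longrightarrow> \<epsilon> z > 0"
      "\<And>z. z \<in> Z \<Longrightarrow> smooth_topology closure_of (G z (\<epsilon> z)) = topspace smooth_topology"
      by metis
    obtain D where D: "D \<subseteq> Z" "finite D" "Z \<subseteq> (\<Union>z\<in>D. ball z (\<epsilon> z))"
      using compactE_image[OF Z, of Z "\<lambda>z. ball z (\<epsilon> z)"] \<epsilon>(1) by force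
    have Gopen: "openin smooth_topology (G z \<delta>)" for z \<delta>
    proof (rule openin_if_eventually_nhdsin)
      show "G z \<delta> \<subseteq> topspace smooth_topology" by (auto simp: G_def topspace_smooth_topology)
      fix W assume W: "W \<in> G z \<delta>"
      \<comment> \<open>With threshold 0 the alternative of a small squared speed is impossible, so
        the stability lemma with constant \<open>V\<close> gives the pairing condition
        alone.\<close>
      have ev: "\<forall>\<^sub>F X in nhdsin smooth_topology W. \<forall>z'\<in>cball z \<delta>.
          rep_field \<rho> V (fst z') \<bullet> rep_field \<rho> V (fst z') < 0 \<or> (\<exists>j\<in>?J. bracket_pairing \<rho> V X j z' \<noteq> 0)"
        by (rule bracket_condition_stable[OF smooth_lim_const[OF sV] smooth_lim_nhdsin compact_cball])
          (use W in \<open>auto simp: G_def\<close>)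
      show "\<forall>\<^sub>F X in nhdsin smooth_topology W. X \<in> G z \<delta>"
        using ev eventually_nhdsin_topspace
      proof eventually_elim
        case (elim X)
        have "\<not> rep_field \<rho> V y \<bullet> rep_field \<rho> V y < 0" for y by (simp add: not_less)
        then show ?case using elim by (simp add: G_def topspace_smooth_topology)
      qed
    qed
    let ?I = "topspace smooth_topology \<inter> \<Inter>((\<lambda>z. G z (\<epsilon> z)) ` D)"
    have "smooth_topology closure_of ?I = topspace smooth_topology"
      using dense_open_finite_Inter[of "(\<lambda>z. G z (\<epsilon> z)) ` D" smooth_topology] D(1,2) Gopen \<epsilon>(2) by blast
    then have "?I \<inter> T2 \<noteq> {}"
      unfolding dense_intersects_open using T12(2,4) by blast
    then obtain W' where W': "W' \<in> T2" "W' \<in> ?I" by blast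
    have "rep_field \<rho> V (fst z) \<bullet> rep_field \<rho> V (fst z) < 1 / real (Suc l) \<or>
        (\<exists>j\<in>?J. bracket_pairing \<rho> V W' j z \<noteq> 0)" if z: "z \<in> stratum_piece \<rho> l \<times> rep_sphere \<rho>" for z
    proof (cases "rep_field \<rho> V (fst z) \<bullet> rep_field \<rho> V (fst z) < 1 / real (Suc l)")
      case False
      then have "z \<in> Z" using z by (auto simp: Z_def mem_Times_iff)
      then obtain w where w: "w \<in> D" "z \<in> ball w (\<epsilon> w)" using D(3) by blast
      then have "W' \<in> G w (\<epsilon> w)" "z \<in> cball w (\<epsilon> w)" using W'(2) ball_subset_cball by blast+
      then show ?thesis unfolding G_def by blast
    qed simp
    moreover have "W' \<in> equivariant_fields" using W'(2) topspace_smooth_topology by blast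
    ultimately have "(V, W') \<in> bracket_region \<rho> l" using VE unfolding bracket_region_iff by blast
    then show ?thesis using T12(3,5) W'(1) by blast
  qed
  then show ?thesis unfolding dense_intersects_open by blast
qed

subsection \<open>Common zeros\<close>

definition nonvanishing_region ::
    "('n \<Rightarrow> 'n) \<Rightarrow> (real^'n) set \<Rightarrow> (('n::finite sym_mat \<Rightarrow> 'n sym_mat) \<times> ('n sym_mat \<Rightarrow> 'n sym_mat)) set" where
  "nonvanishing_region \<rho> K = {X \<in> equivariant_fields \<times> equivariant_fields.
     \<forall>y\<in>K. rep_field \<rho> (fst X) y \<noteq> 0 \<or> rep_field \<rho> (snd X) y \<noteq> 0}"

lemma openin_nonvanishing_region:
  fixes \<rho> :: "'n::finite \<Rightarrow> 'n"
  assumes K: "compact K"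
  shows "openin pair_topology (nonvanishing_region \<rho> K)"
proof (rule openin_if_eventually_nhdsin)
  show "nonvanishing_region \<rho> K \<subseteq> topspace pair_topology"
    by (auto simp: nonvanishing_region_def topspace_smooth_topology)
  fix X0 :: "('n sym_mat \<Rightarrow> 'n sym_mat) \<times> ('n sym_mat \<Rightarrow> 'n sym_mat)"
  assume X0: "X0 \<in> nonvanishing_region \<rho> K"
  obtain V W where eq: "X0 = (V, W)" by (cases X0)
  have E: "V \<in> equivariant_fields" "W \<in> equivariant_fields" using X0 by (auto simp: nonvanishing_region_def eq)
  \<comment> \<open>Common zeros are the zeros of this sum of squares, which is otherwise
    positive.\<close>
  define H where "H = (\<lambda>V W y. rep_field \<rho> V y \<bullet> rep_field \<rho> V y + rep_field \<rho> W y \<bullet> rep_field \<rho> W y)"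
  have lim: "smooth_lim (nhdsin pair_topology (V, W)) (\<lambda>X. H (fst X) (snd X)) (H V W)"
    unfolding H_def
    by (intro smooth_lim_add smooth_lim_bilinear[OF bounded_bilinear_inner] smooth_lim_rep_field smooth_lim_pair[OF E])
  have pos: "H V W y \<in> {0<..} \<longleftrightarrow> rep_field \<rho> V y \<noteq> 0 \<or> rep_field \<rho> W y \<noteq> 0" for V W y
    unfolding H_def by (simp add: add_pos_nonneg add_nonneg_pos less_le)
      (metis add_nonneg_eq_0_iff inner_eq_zero_iff inner_ge_zero)
  have "\<forall>\<^sub>F X in nhdsin pair_topology (V, W). \<forall>y\<in>K. H (fst X) (snd X) y \<in> {0<..}"
    by (rule uniform_limit_compact_open[OF K smooth_continuous_on[OF smooth_limD(1)[OF lim]]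
          smooth_limD(3)[OF lim K] open_greaterThan])
      (use X0 pos in \<open>auto simp: nonvanishing_region_def eq\<close>)
  then have ev: "\<forall>\<^sub>F X in nhdsin pair_topology X0. \<forall>y\<in>K. rep_field \<rho> (fst X) y \<noteq> 0 \<or> rep_field \<rho> (snd X) y \<noteq> 0"
    unfolding eq pos .
  show "\<forall>\<^sub>F X in nhdsin pair_topology X0. X \<in> nonvanishing_region \<rho> K"
    using ev eventually_nhdsin_topspace
    by eventually_elim (simp only: nonvanishing_region_def topspace_pair_topology mem_Collect_eq)
qed

lemma smooth_poly: "smooth f \<Longrightarrow> smooth (\<lambda>x. poly P (f x) :: real)"
  unfolding poly_altdef by (intro smooth_sum smooth_mult smooth_const smooth_power)

lemma linear_vec_nth: "linear (\<lambda>v :: real^'n. v $ i)"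
  by (simp add: linear_iff)

definition poly_field :: "real poly \<Rightarrow> 'n::finite sym_mat \<Rightarrow> 'n sym_mat" where
  "poly_field P S = (\<Sum>k\<le>degree P. coeff P k *\<^sub>R pow_field k S)"

lemma poly_field_equivariant_fields: "poly_field P \<in> equivariant_fields"
  unfolding poly_field_def[abs_def] by (intro equivariant_fields_sum pow_field_equivariant_fields)

lemma rep_field_poly_field: "rep_field \<rho> (poly_field P) y $ i = (if \<rho> i = i then poly P (y $ i) else 0)"
proof -
  have "rep_field \<rho> (poly_field P) y =
      rep_field \<rho> (\<lambda>S. 0) y + (\<Sum>k\<le>degree P. coeff P k *\<^sub>R rep_field \<rho> (pow_field k) y)"
    using fun_cong[OF rep_field_lincomb[where \<rho>=\<rho> and W="\<lambda>S. 0" and I="{..degree P}" and c="coeff P" and P=pow_field], of y]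
    by (simp add: poly_field_def[abs_def])
  also have "rep_field \<rho> (\<lambda>S. 0) y = 0" by (simp add: rep_field_def vec_eq_iff zero_sym_mat.rep_eq)
  finally show ?thesis by (simp add: rep_field_pow_field poly_altdef)
qed

lemma rep_field_cong_spread: "spread \<rho> x = spread \<rho> y \<Longrightarrow> rep_field \<rho> V x = rep_field \<rho> V y"
  by (simp add: rep_field_def cong: if_cong)

text \<open>Both fields are perturbed by fields that interpolate on the representatives. The dummy entries
  are used to make the linear system for the bad parameters square; the solutions are then
  parametrized by a hyperplane.\<close>

lemma nonvanishing_locally_dense:
  fixes \<rho> :: "'n::finite \<Rightarrow> 'n"
  assumes \<rho>: "\<And>i. \<rho> (\<rho> i) = \<rho> i"
    and dist: "\<And>i j. \<rho> i = i \<Longrightarrow> \<rho> j = j \<Longrightarrow> i \<noteq> j \<Longrightarrow> y0 $ i \<noteq> y0 $ j"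
  shows "\<exists>\<epsilon>>0. pair_topology closure_of nonvanishing_region \<rho> (cball y0 \<epsilon>) = topspace pair_topology"
proof -
  \<comment> \<open>Up to normalization these are the Lagrange polynomials for the representative
    entries of \<open>y0\<close>, so the representative rows of \<open>M y0\<close> are
    diagonal.\<close>
  define ip where "ip = (\<lambda>b. if \<rho> b = b then (\<Prod>c\<in>{c. \<rho> c = c} - {b}. [:- y0 $ c, 1:]) else 0)"
  define M where "M = (\<lambda>x. (\<chi> i b. if \<rho> i = i then poly (ip b) (x $ i) else if i = b then 1 else 0) :: real^'n^'n)"
  have ip0: "poly (ip b) (y0 $ i) = 0 \<longleftrightarrow> i \<noteq> b" if "\<rho> i = i" for i b
    using that dist by (auto simp: ip_def poly_prod)
  have "det (M y0) = (\<Prod>i\<in>UNIV. M y0 $ i $ i)"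
    by (rule det_diagonal) (simp add: M_def ip0)
  then have "det (M y0) \<noteq> 0" by (simp add: M_def ip0)
  moreover have sM: "smooth (\<lambda>x. M x $ i $ b)" for i b
    by (cases "\<rho> i = i"; cases "i = b")
      (simp_all add: M_def smooth_poly smooth_linear linear_vec_nth smooth_const)
  then have "isCont (\<lambda>x. det (M x)) y0"
    using smooth_continuous_on[OF smooth_det[of M], of UNIV] by (simp add: continuous_on_eq_continuous_at)
  ultimately obtain \<epsilon>' where \<epsilon>': "\<epsilon>' > 0" "\<And>x. dist y0 x < \<epsilon>' \<Longrightarrow> det (M x) \<noteq> 0"
    using continuous_at_avoid[of y0 "\<lambda>x. det (M x)" 0] by blast
  let ?P = "\<lambda>b. poly_field (ip b) :: 'n sym_mat \<Rightarrow> 'n sym_mat"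
  have "nonvanishing_region \<rho> (cball y0 (\<epsilon>'/2)) \<inter> T \<noteq> {}" if T: "openin pair_topology T" "T \<noteq> {}" for T
  proof -
    obtain V W where VW: "(V, W) \<in> T" using T(2) by fastforce
    obtain T1 T2 where T12: "openin smooth_topology T1" "openin smooth_topology T2" "V \<in> T1" "W \<in> T2" "T1 \<times> T2 \<subseteq> T"
      using T(1) VW unfolding openin_prod_topology_alt by metis
    have sVW: "smooth V" "smooth W"
      using openin_subset[OF T12(1)] T12(3) openin_subset[OF T12(2)] T12(4) topspace_smooth_topology
      by (auto simp: equivariant_fields_def)
    define A where "A = (\<lambda>z :: (real^'n) \<times> (real^'n). M (fst z))"
    \<comment> \<open>The dummy rows of \<open>M\<close> are identity rows, so their right-hand
      sides must supply the dummy entries of the parameters: those of the first are stored in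
      \<open>fst z\<close>, those of the second in \<open>snd z\<close>.\<close>
    define c1 where "c1 = (\<lambda>z :: (real^'n) \<times> (real^'n). (\<chi> i. if \<rho> i = i then - rep_field \<rho> V (fst z) $ i else fst z $ i))"
    define c2 where "c2 = (\<lambda>z :: (real^'n) \<times> (real^'n). (\<chi> i. if \<rho> i = i then - rep_field \<rho> W (fst z) $ i else snd z $ i))"
    have sA: "smooth (\<lambda>z. A z $ i $ b)" for i b
      unfolding A_def using smooth_linear_pre[OF linear_fst sM] .
    have sentry: "smooth (\<lambda>z. - rep_field \<rho> U (fst z) $ i)" if "smooth U" for U i
      using smooth_minus[OF smooth_linear_comp[OF linear_vec_nth linear_fst smooth_rep_field[OF that]]] .
    have sc: "smooth (\<lambda>z. c1 z $ i)" "smooth (\<lambda>z. c2 z $ i)" for i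
    proof -
      show "smooth (\<lambda>z. c1 z $ i)"
        using sentry[OF sVW(1), of i] smooth_linear_post[OF linear_vec_nth smooth_linear[OF linear_fst], of i]
        unfolding c1_def by (cases "\<rho> i = i") simp_all
      show "smooth (\<lambda>z. c2 z $ i)"
        using sentry[OF sVW(2), of i] smooth_linear_post[OF linear_vec_nth smooth_linear[OF linear_snd], of i]
        unfolding c2_def by (cases "\<rho> i = i") simp_all
    qed
    obtain s1 where s1: "s1 differentiable_on {z. det (A z) \<noteq> 0}"
      "\<And>z q. det (A z) \<noteq> 0 \<Longrightarrow> A z *v q = c1 z \<Longrightarrow> q = s1 z"
      using parametrized_solution[of A c1, OF sA sc(1)] by blast
    obtain s2 where s2: "s2 differentiable_on {z. det (A z) \<noteq> 0}"
      "\<And>z q. det (A z) \<noteq> 0 \<Longrightarrow> A z *v q = c2 z \<Longrightarrow> q = s2 z"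
      using parametrized_solution[of A c2, OF sA sc(2)] by blast
    \<comment> \<open>The representative entries of \<open>snd z\<close> do not enter the systems,
      so one of them may be pinned to 0. That confines \<open>z\<close> to a hyperplane, one
      dimension below the space of parameter pairs. A fixed index exists since every value of
      \<open>\<rho>\<close> is one.\<close>
    obtain j0 where j0: "\<rho> j0 = j0" using \<rho> by blast
    define S where "S = {z. det (A z) \<noteq> 0} \<inter> {z. snd z $ j0 = 0}"
    define s where "s = (\<lambda>z. (s1 z, s2 z))"
    have "s differentiable_on S"
      unfolding s_def differentiable_on_def
    proof (intro ballI differentiable_Pair)
      fix z assume "z \<in> S"
      then have "z \<in> {z. det (A z) \<noteq> 0}" "S \<subseteq> {z. det (A z) \<noteq> 0}" by (auto simp: S_def)
      then show "s1 differentiable at z within S" "s2 differentiable at z within S"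
        using s1(1) s2(1) unfolding differentiable_on_def by (meson differentiable_within_subset)+
    qed
    moreover have "negligible S"
    proof (rule negligible_subset)
      show "negligible {z :: (real^'n) \<times> (real^'n). (0, axis j0 1) \<bullet> z = 0}"
        by (rule negligible_hyperplane) (simp add: axis_eq_0_iff zero_prod_def)
      show "S \<subseteq> {z. (0, axis j0 1) \<bullet> z = 0}" by (auto simp: S_def inner_axis')
    qed
    ultimately have neg: "negligible (s ` S)"
      by (intro negligible_differentiable_image_negligible) simp_all
    define Q1 where "Q1 = {q :: real^'n. (\<lambda>S. V S + (\<Sum>b\<in>UNIV. (q $ b) *\<^sub>R ?P b S)) \<in> T1}"
    define Q2 where "Q2 = {q :: real^'n. (\<lambda>S. W S + (\<Sum>b\<in>UNIV. (q $ b) *\<^sub>R ?P b S)) \<in> T2}"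
    have "open Q1" "0 \<in> Q1" "open Q2" "0 \<in> Q2"
      unfolding Q1_def Q2_def
      by (rule perturbation_parameters[OF T12(1,3) poly_field_equivariant_fields]
          perturbation_parameters[OF T12(2,4) poly_field_equivariant_fields])+
    then have "\<exists>q\<in>Q1 \<times> Q2. q \<notin> s ` S"
      by (intro ex_near_not_negligible[OF _ _ neg]) (auto simp: open_Times)
    then obtain q1 q2 where q: "q1 \<in> Q1" "q2 \<in> Q2" "(q1, q2) \<notin> s ` S" by blast
    let ?V = "\<lambda>S. V S + (\<Sum>b\<in>UNIV. (q1 $ b) *\<^sub>R ?P b S)" and ?W = "\<lambda>S. W S + (\<Sum>b\<in>UNIV. (q2 $ b) *\<^sub>R ?P b S)"
    have T': "?V \<in> T1" "?W \<in> T2" using q(1,2) by (simp_all add: Q1_def Q2_def)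
    have "rep_field \<rho> ?V y \<noteq> 0 \<or> rep_field \<rho> ?W y \<noteq> 0" if y: "y \<in> cball y0 (\<epsilon>'/2)" for y
    proof (rule ccontr)
      assume neg: "\<not> ?thesis"
      \<comment> \<open>A common zero \<open>y\<close> is re-encoded: \<open>x\<close> keeps its
        representative entries and stores the dummies of \<open>q1\<close>, while \<open>z\<close>
        stores those of \<open>q2\<close> and is 0 elsewhere, hence lies on the hyperplane. The
        fields and \<open>M\<close> do not see the change of dummies.\<close>
      define x where "x = (\<chi> i. if \<rho> i = i then y $ i else q1 $ i)"
      define z where "z = (\<chi> i. if \<rho> i = i then 0 else q2 $ i)"
      have My: "M x = M y" by (simp add: M_def x_def vec_eq_iff)
      have dz: "det (A (x, z)) \<noteq> 0"
        unfolding A_def fst_conv My by (rule \<epsilon>'(2)) (use y \<epsilon>'(1) in auto)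
      have rx: "rep_field \<rho> U x = rep_field \<rho> U y" for U
        by (rule rep_field_cong_spread) (simp add: spread_def x_def \<rho>)
      have sol: "(M y *v q) $ i = - rep_field \<rho> U y $ i"
        if "\<rho> i = i" "rep_field \<rho> (\<lambda>S. U S + (\<Sum>b\<in>UNIV. (q $ b) *\<^sub>R ?P b S)) y = 0" for q U i
      proof -
        have "0 = (rep_field \<rho> U y + (\<Sum>b\<in>UNIV. (q $ b) *\<^sub>R rep_field \<rho> (?P b) y)) $ i"
          using that(2) unfolding rep_field_lincomb by simp
        then show ?thesis
          using that(1) by (simp add: rep_field_poly_field M_def matrix_vector_mult_def mult.commute)
      qed
      have sol': "(M y *v q) $ i = q $ i" if "\<rho> i \<noteq> i" for q i
        using that by (simp add: M_def matrix_vector_mult_def if_distrib[of "\<lambda>x. x * _"] cong: if_cong)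
      have "A (x, z) *v q1 = c1 (x, z)"
        using neg sol[of _ V q1] sol'[of _ q1]
        by (simp add: vec_eq_iff A_def My c1_def rx) (simp add: x_def)
      then have 1: "q1 = s1 (x, z)" by (rule s1(2)[OF dz])
      have "A (x, z) *v q2 = c2 (x, z)"
        using neg sol[of _ W q2] sol'[of _ q2]
        by (simp add: vec_eq_iff A_def My c2_def rx) (simp add: z_def)
      then have 2: "q2 = s2 (x, z)" by (rule s2(2)[OF dz])
      have "(x, z) \<in> S" using dz j0 by (simp add: S_def z_def)
      then show False using q(3) 1 2 unfolding s_def by blast
    qed
    moreover have "?V \<in> equivariant_fields" "?W \<in> equivariant_fields"
      using openin_subset[OF T12(1)] openin_subset[OF T12(2)] T' topspace_smooth_topology by blast+
    ultimately have "(?V, ?W) \<in> nonvanishing_region \<rho> (cball y0 (\<epsilon>'/2))"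
      by (simp add: nonvanishing_region_def)
    then show ?thesis using T12(5) T' by blast
  qed
  then have "pair_topology closure_of nonvanishing_region \<rho> (cball y0 (\<epsilon>'/2)) = topspace pair_topology"
    unfolding dense_intersects_open by blast
  then show ?thesis using \<epsilon>'(1) by (intro exI[of _ "\<epsilon>'/2"]) auto
qed

lemma dense_nonvanishing_region:
  fixes \<rho> :: "'n::finite \<Rightarrow> 'n"
  assumes \<rho>: "\<And>i. \<rho> (\<rho> i) = \<rho> i"
  shows "pair_topology closure_of nonvanishing_region \<rho> (stratum_piece \<rho> l) = topspace pair_topology"
proof -
  let ?K = "stratum_piece \<rho> l"
  have "\<exists>\<epsilon>>0. pair_topology closure_of nonvanishing_region \<rho> (cball y \<epsilon>) = topspace pair_topology"
    if "y \<in> ?K" for y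
    by (rule nonvanishing_locally_dense[OF \<rho> stratum_piece_distinct[OF that]])
  then obtain \<epsilon> where \<epsilon>: "\<And>y. y \<in> ?K \<Longrightarrow> \<epsilon> y > 0"
    "\<And>y. y \<in> ?K \<Longrightarrow> pair_topology closure_of nonvanishing_region \<rho> (cball y (\<epsilon> y)) = topspace pair_topology"
    by metis
  obtain D where D: "D \<subseteq> ?K" "finite D" "?K \<subseteq> (\<Union>y\<in>D. ball y (\<epsilon> y))"
    using compactE_image[OF compact_stratum_piece[of \<rho> l], of ?K "\<lambda>y. ball y (\<epsilon> y)"] \<epsilon>(1) by force
  let ?\<U> = "(\<lambda>y. nonvanishing_region \<rho> (cball y (\<epsilon> y))) ` D"
  have dense: "pair_topology closure_of (topspace pair_topology \<inter> \<Inter>?\<U>) = topspace pair_topology"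
    using dense_open_finite_Inter[of ?\<U> pair_topology] D(1,2) \<epsilon>(2) openin_nonvanishing_region[OF compact_cball]
    by blast
  have "topspace pair_topology \<inter> \<Inter>?\<U> \<subseteq> nonvanishing_region \<rho> ?K"
  proof
    fix X assume X: "X \<in> topspace pair_topology \<inter> \<Inter>?\<U>"
    have "rep_field \<rho> (fst X) y \<noteq> 0 \<or> rep_field \<rho> (snd X) y \<noteq> 0" if y: "y \<in> ?K" for y
    proof -
      obtain c where c: "c \<in> D" "y \<in> ball c (\<epsilon> c)" using D(3) y by blast
      then have "X \<in> nonvanishing_region \<rho> (cball c (\<epsilon> c))" using X by blast
      then show ?thesis using c(2) by (auto simp: nonvanishing_region_def)
    qed
    then show "X \<in> nonvanishing_region \<rho> ?K"
      using X by (simp add: nonvanishing_region_def topspace_smooth_topology)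
  qed
  then show ?thesis
    using dense unfolding dense_intersects_open by blast
qed

section \<open>Residual sets of tuples\<close>

text \<open>Density is checked on slices: two coordinates of a point of the given open set are
  varied through \<open>h\<close> and the others are frozen, which turns that set into a nonempty
  open set of pairs.\<close>

lemma product_pair_preimage:
  assumes hom: "homeomorphic_maps T T' h g" and ab: "a \<in> I" "b \<in> I" "a \<noteq> b"
    and U: "openin (prod_topology T T) U" "prod_topology T T closure_of U = topspace (prod_topology T T)"
  defines "PT \<equiv> product_topology (\<lambda>_. T') I"
  shows "openin PT {X \<in> topspace PT. (g (X a), g (X b)) \<in> U}"
    "PT closure_of {X \<in> topspace PT. (g (X a), g (X b)) \<in> U} = topspace PT"
proof -
  have h: "continuous_map T T' h" and g: "continuous_map T' T g" and gh: "\<And>x. x \<in> topspace T \<Longrightarrow> g (h x) = x"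
    and hg: "\<And>y. y \<in> topspace T' \<Longrightarrow> h (g y) = y"
    using hom by (auto simp: homeomorphic_maps_def)
  have proj: "continuous_map PT T (\<lambda>X. g (X c))" if "c \<in> I" for c
    using continuous_map_compose[OF continuous_map_product_projection[OF that, of "\<lambda>_. T'"] g]
    by (simp add: PT_def o_def)
  have "continuous_map PT (prod_topology T T) (\<lambda>X. (g (X a), g (X b)))"
    using proj[OF ab(1)] proj[OF ab(2)] by (simp add: continuous_map_pairwise o_def)
  from openin_continuous_map_preimage[OF this U(1)]
  show "openin PT {X \<in> topspace PT. (g (X a), g (X b)) \<in> U}" .
  have "{X \<in> topspace PT. (g (X a), g (X b)) \<in> U} \<inter> B \<noteq> {}" if B: "openin PT B" "B \<noteq> {}" for B
  proof -
    obtain X where X: "X \<in> B" using B(2) by blast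
    then have Xt: "X \<in> topspace PT" using openin_subset[OF B(1)] by blast
    then have Xc: "X c \<in> topspace T'" if "c \<in> I" for c using that by (auto simp: PT_def)
    \<comment> \<open>The slice through \<open>X\<close> in the directions \<open>a\<close> and
      \<open>b\<close>.\<close>
    define \<iota> where "\<iota> = (\<lambda>p. \<lambda>c\<in>I. if c = a then h (fst p) else if c = b then h (snd p) else X c)"
    have \<iota>: "continuous_map (prod_topology T T) PT \<iota>"
      unfolding PT_def continuous_map_componentwise
    proof (intro conjI ballI)
      show "\<iota> ` topspace (prod_topology T T) \<subseteq> extensional I" by (auto simp: \<iota>_def)
      fix c assume c: "c \<in> I"
      have "continuous_map (prod_topology T T) T' (\<lambda>p. h (fst p))" "continuous_map (prod_topology T T) T' (\<lambda>p. h (snd p))"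
        using continuous_map_compose[OF continuous_map_fst h] continuous_map_compose[OF continuous_map_snd h]
        by (simp_all add: o_def)
      then show "continuous_map (prod_topology T T) T' (\<lambda>p. \<iota> p c)"
        using c Xc[OF c] by (simp add: \<iota>_def)
    qed
    have "\<iota> (g (X a), g (X b)) = X"
    proof
      fix c show "\<iota> (g (X a), g (X b)) c = X c"
        using Xt hg Xc ab by (auto simp: \<iota>_def PT_def PiE_def extensional_def)
    qed
    moreover have "(g (X a), g (X b)) \<in> topspace (prod_topology T T)"
      using Xc ab(1,2) continuous_map_image_subset_topspace[OF g] by auto
    ultimately have "(g (X a), g (X b)) \<in> {p \<in> topspace (prod_topology T T). \<iota> p \<in> B}"
      using X by (simp only: mem_Collect_eq)
    then have "{p \<in> topspace (prod_topology T T). \<iota> p \<in> B} \<noteq> {}" by blast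
    moreover have "openin (prod_topology T T) {p \<in> topspace (prod_topology T T). \<iota> p \<in> B}"
      by (rule openin_continuous_map_preimage[OF \<iota> B(1)])
    ultimately have "U \<inter> {p \<in> topspace (prod_topology T T). \<iota> p \<in> B} \<noteq> {}"
      using U(2) unfolding dense_intersects_open by blast
    then obtain p where p: "p \<in> U" "p \<in> topspace (prod_topology T T)" "\<iota> p \<in> B" by blast
    have "g (\<iota> p a) = fst p" "g (\<iota> p b) = snd p" using p(2) ab gh by (auto simp: \<iota>_def)
    then have "\<iota> p \<in> {X \<in> topspace PT. (g (X a), g (X b)) \<in> U}"
      using p(1) openin_subset[OF B(1)] p(3) by auto
    then show ?thesis using p(3) by blast
  qed
  then show "PT closure_of {X \<in> topspace PT. (g (X a), g (X b)) \<in> U} = topspace PT"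
    unfolding dense_intersects_open by blast
qed

section \<open>Ordered multiplicities\<close>

lemma eigenspace_act:
  assumes P: "orthogonal_matrix P"
  shows "eigenspace (act P S) l = (*v) P ` eigenspace S l"
proof -
  note o = orthogonal_matrix_mul_transpose[OF P]
  have sub: "(*v) P ` eigenspace S l \<subseteq> eigenspace (act P S) l" if "orthogonal_matrix P" for P S
  proof (intro subsetI, elim imageE)
    fix v w assume w: "w \<in> eigenspace S l" "v = P *v w"
    have "mat_of (act P S) *v v = P *v (mat_of S *v ((transpose P ** P) *v w))"
      by (simp add: w(2) act.rep_eq matrix_vector_mul_assoc matrix_mul_assoc)
    also have "\<dots> = l *\<^sub>R v"
      using w orthogonal_matrix_mul_transpose(1)[OF that]
      by (simp add: eigenspace_def matrix_vector_mult_scaleR)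
    finally show "v \<in> eigenspace (act P S) l" by (simp add: eigenspace_def)
  qed
  have "v \<in> (*v) P ` eigenspace S l" if v: "v \<in> eigenspace (act P S) l" for v
  proof -
    have "transpose P *v v \<in> eigenspace S l"
      using sub[of "transpose P" "act P S"] P v by (auto simp: act_transpose orthogonal_matrix_transpose)
    moreover have "v = P *v (transpose P *v v)"
      by (simp only: matrix_vector_mul_assoc o matrix_vector_mul_lid)
    ultimately show ?thesis by blast
  qed
  then show ?thesis using sub[OF P] by blast
qed

lemma dim_eigenspace_act:
  assumes P: "orthogonal_matrix P"
  shows "dim (eigenspace (act P S) l) = dim (eigenspace S l)"
    "l \<in> eigenvalues (act P S) \<longleftrightarrow> l \<in> eigenvalues S"
proof -
  have inj: "inj ((*v) P)"
    by (rule inj_on_inverseI[where g="(*v) (transpose P)"])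
      (simp add: matrix_vector_mul_assoc orthogonal_matrix_mul_transpose[OF P])
  show "dim (eigenspace (act P S) l) = dim (eigenspace S l)"
    unfolding eigenspace_act[OF P]
    by (rule dim_image_eq[OF matrix_vector_mul_linear]) (use inj in \<open>auto intro: inj_on_subset\<close>)
  have "P *v v \<noteq> 0 \<longleftrightarrow> v \<noteq> 0" for v
    using injD[OF inj, of v 0] by auto
  then show "l \<in> eigenvalues (act P S) \<longleftrightarrow> l \<in> eigenvalues S"
    unfolding eigenvalues_def eigenspace_act[OF P] by auto
qed

lemma ordered_multiplicities_orbit:
  fixes S :: "'n::finite sym_mat"
  shows "ordered_multiplicities (orbit S) = ordered_multiplicities_of S"
proof -
  have "invariant (ordered_multiplicities_of :: 'n sym_mat \<Rightarrow> nat list)"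
    unfolding invariant_def
  proof (intro allI impI)
    fix P :: "real^'n^'n" and S :: "'n sym_mat"
    assume P: "orthogonal_matrix P"
    have "eigenvalues (act P S) = eigenvalues S" using dim_eigenspace_act(2)[OF P] by blast
    then show "ordered_multiplicities_of (act P S) = ordered_multiplicities_of S"
      by (simp add: ordered_multiplicities_of_def dim_eigenspace_act(1)[OF P])
  qed
  then show ?thesis by (simp add: ordered_multiplicities_def invariant_image_orbit)
qed

lemma mat_of_diag_mult: "mat_of (diag x) *v v = (\<chi> i. x $ i * v $ i)"
  by (simp add: mat_of_diag matrix_vector_mult_def vec_eq_iff if_distrib[of "\<lambda>x. x * _"] cong: if_cong)

lemma eigenspace_diag: "eigenspace (diag x) l = {v. \<forall>i. i \<notin> {i. x $ i = l} \<longrightarrow> v $ i = 0}"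
  by (auto simp: eigenspace_def mat_of_diag_mult vec_eq_iff)

lemma eigenvalues_diag: "eigenvalues (diag x) = range (($) x)"
proof (intro set_eqI iffI)
  fix l assume "l \<in> eigenvalues (diag x)"
  then obtain v where v: "v \<in> eigenspace (diag x) l" "v \<noteq> 0" by (auto simp: eigenvalues_def)
  then obtain i where "v $ i \<noteq> 0" by (auto simp: vec_eq_iff)
  then have "l = x $ i" using v(1) by (auto simp: eigenspace_diag)
  then show "l \<in> range (($) x)" by simp
next
  fix l assume "l \<in> range (($) x)"
  then obtain i where i: "l = x $ i" by blast
  have "axis i 1 \<in> eigenspace (diag x) l" by (auto simp: eigenspace_diag i axis_def)
  moreover have "axis i (1::real) \<noteq> 0" by (simp add: axis_eq_0_iff)
  ultimately show "l \<in> eigenvalues (diag x)" unfolding eigenvalues_def by blast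
qed

lemma ordered_multiplicities_of_diag:
  "ordered_multiplicities_of (diag x) =
     map (\<lambda>l. card {i. x $ i = l}) (sorted_list_of_set (range (($) x)))"
proof -
  have "dim (eigenspace (diag x) l) = card {i. x $ i = l}" for l
    unfolding eigenspace_diag dim_vec_eq[symmetric] by (rule dim_substandard_cart)
  then show ?thesis by (simp add: ordered_multiplicities_of_def eigenvalues_diag)
qed

text \<open>The level sets of the k-th smallest values of \<open>x\<close> and \<open>z\<close> have
  equal size. Arbitrary bijections between corresponding level sets glue to a permutation, and
  comparisons depend only on the ranks \<open>k\<close>.\<close>

lemma ex_order_matching_permutation:
  fixes x z :: "'n::finite \<Rightarrow> real"
  assumes eq: "map (\<lambda>l. card {i. x i = l}) (sorted_list_of_set (range x)) =
     map (\<lambda>l. card {i. z i = l}) (sorted_list_of_set (range z))"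
  shows "\<exists>\<sigma>. bij \<sigma> \<and> (\<forall>i j. x i < x j \<longleftrightarrow> z (\<sigma> i) < z (\<sigma> j))"
proof -
  define L where "L = sorted_list_of_set (range x)"
  define M where "M = sorted_list_of_set (range z)"
  have L: "sorted_wrt (<) L" "set L = range x" and M: "sorted_wrt (<) M" "set M = range z"
    by (simp_all add: L_def M_def)
  have len: "length L = length M" using eq by (metis L_def M_def length_map)
  have "card {i. x i = L ! k} = card {i. z i = M ! k}" if "k < length L" for k
    using arg_cong[OF eq, of "\<lambda>xs. xs ! k"] that len by (simp add: L_def[symmetric] M_def[symmetric])
  then have "\<exists>g. bij_betw g {i. x i = L ! k} {i. z i = M ! k}" if "k < length L" for k
    using that by (intro finite_same_card_bij) auto
  then obtain g where g: "\<And>k. k < length L \<Longrightarrow> bij_betw (g k) {i. x i = L ! k} {i. z i = M ! k}"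
    by metis
  have "\<exists>k<length L. L ! k = x i" for i using L(2) by (metis in_set_conv_nth rangeI)
  then obtain \<kappa> where \<kappa>: "\<And>i. \<kappa> i < length L" "\<And>i. L ! \<kappa> i = x i" by metis
  define \<sigma> where "\<sigma> = (\<lambda>i. g (\<kappa> i) i)"
  have z\<sigma>: "z (\<sigma> i) = M ! \<kappa> i" for i
    using bij_betw_apply[OF g[OF \<kappa>(1)[of i]], of i] \<kappa>(2)[of i] by (simp add: \<sigma>_def)
  have nth: "N ! a < N ! b \<longleftrightarrow> a < b" if N: "sorted_wrt (<) N" "a < length N" "b < length N"
    for N :: "real list" and a b
    using sorted_wrt_nth_less[OF N(1), of a b] sorted_wrt_nth_less[OF N(1), of b a] N(2,3)
    by (metis linorder_less_linear order_less_asym order_less_irrefl)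
  have lt: "x i < x j \<longleftrightarrow> z (\<sigma> i) < z (\<sigma> j)" for i j
    using nth[OF L(1) \<kappa>(1) \<kappa>(1), of i j] nth[OF M(1), of "\<kappa> i" "\<kappa> j"] \<kappa> len by (simp add: z\<sigma>)
  have "inj \<sigma>"
  proof (rule injI)
    fix i j assume e: "\<sigma> i = \<sigma> j"
    then have xe: "x i = x j" using lt by (metis linorder_less_linear order_less_irrefl)
    have "\<kappa> i = \<kappa> j"
      using nth[OF L(1) \<kappa>(1) \<kappa>(1), of i j] nth[OF L(1) \<kappa>(1) \<kappa>(1), of j i] xe \<kappa>(2) by auto
    then have "g (\<kappa> i) i = g (\<kappa> i) j" using e by (simp add: \<sigma>_def)
    then show "i = j"
      using bij_betw_imp_inj_on[OF g[OF \<kappa>(1)[of i]]] xe \<kappa>(2)[of i] by (auto dest: inj_onD)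
  qed
  then have "bij \<sigma>" by (simp add: bij_def finite_UNIV_inj_surj)
  then show ?thesis using lt by blast
qed

section \<open>Steering on the orbit space\<close>

text \<open>In the fold the smallest index is applied last. A new final step therefore takes index 1
  and the earlier ones are shifted up.\<close>

lemma steers_imp_orbit_flow_chain:
  fixes V W :: "'n::finite sym_mat \<Rightarrow> 'n sym_mat" and X :: "nat \<Rightarrow> 'n orbit_field"
  assumes V: "V \<in> equivariant_fields" "X a = induced_field V" and W: "W \<in> equivariant_fields" "X b = induced_field W"
    and ab: "a \<in> {1..k}" "b \<in> {1..k}" and st: "steers V W S T"
  shows "\<exists>(m::nat) (t :: nat \<Rightarrow> real) (i :: nat \<Rightarrow> nat). (\<forall>j\<in>{1..m}. i j \<in> {1..k}) \<and>
     foldr (\<lambda>j F. orbit_flow (X (i j)) (t j) \<circ>\<^sub>m F) [1..<Suc m] Some (orbit S) = Some (orbit T)"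
  using st unfolding steers_def
proof (induction rule: rtranclp_induct)
  case base
  show ?case by (intro exI[of _ 0]) simp
next
  case (step T U)
  obtain m t i where IH: "\<forall>j\<in>{1..m}. i j \<in> {1..k}"
    "foldr (\<lambda>j F. orbit_flow (X (i j)) (t j) \<circ>\<^sub>m F) [1..<Suc m] Some (orbit S) = Some (orbit T)"
    using step.IH by blast
  obtain c \<tau> where c: "c \<in> {1..k}" "orbit_flow (X c) \<tau> (orbit T) = Some (orbit U)"
    using step.hyps(2) orbit_flow_orbit[OF V(1)] orbit_flow_orbit[OF W(1)] V(2) W(2) ab
    unfolding steer_step_def by metis
  define t' where "t' = (\<lambda>j. if j = 1 then \<tau> else t (j - 1))"
  define i' where "i' = (\<lambda>j. if j = 1 then c else i (j - 1))"
  have up: "[1..<Suc (Suc m)] = 1 # map Suc [1..<Suc m]"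
    by (simp add: map_Suc_upt upt_conv_Cons del: upt_Suc)
  have "foldr (\<lambda>j F. orbit_flow (X (i' j)) (t' j) \<circ>\<^sub>m F) (map Suc [1..<Suc m]) Some =
      foldr (\<lambda>j F. orbit_flow (X (i j)) (t j) \<circ>\<^sub>m F) [1..<Suc m] Some"
    unfolding foldr_map by (rule foldr_cong) (auto simp: i'_def t'_def)
  then have "foldr (\<lambda>j F. orbit_flow (X (i' j)) (t' j) \<circ>\<^sub>m F) [1..<Suc (Suc m)] Some (orbit S) = Some (orbit U)"
    unfolding up using IH(2) c(2) by (simp add: i'_def t'_def map_comp_def del: upt_Suc)
  moreover have "\<forall>j\<in>{1..Suc m}. i' j \<in> {1..k}"
  proof
    fix j assume "j \<in> {1..Suc m}"
    then have "j = 1 \<or> j - 1 \<in> {1..m}" by auto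
    then show "i' j \<in> {1..k}" using IH(1) c(1) unfolding i'_def by metis
  qed
  ultimately show ?case by blast
qed

text \<open>Finitely many positive gaps have a positive minimum. The extra bound \<open>d\<close>
  lets the same \<open>l\<close> also undercut the squared speed at \<open>y\<close>.\<close>

lemma ex_stratum_piece:
  fixes y :: "real^'n" and \<rho> :: "'n::finite \<Rightarrow> 'n"
  assumes "\<And>i j. \<rho> i = i \<Longrightarrow> \<rho> j = j \<Longrightarrow> i \<noteq> j \<Longrightarrow> y $ i \<noteq> y $ j" and "d > 0"
  shows "\<exists>l. y \<in> stratum_piece \<rho> l \<and> 1 / real (Suc l) \<le> d"
proof -
  let ?E = "insert d ((\<lambda>(i, j). \<bar>y $ i - y $ j\<bar>) ` {(i, j). \<rho> i = i \<and> \<rho> j = j \<and> i \<noteq> j})"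
  define e where "e = Min ?E"
  have fin: "finite ?E" by simp
  have "e > 0" unfolding e_def using fin assms by (subst Min_gr_iff) auto
  then obtain N where N: "1 / real (Suc N) < e" using nat_approx_posE by blast
  define l where "l = max N (nat \<lceil>norm y\<rceil>)"
  have le: "1 / real (Suc l) \<le> e"
  proof -
    have "1 / real (Suc l) \<le> 1 / real (Suc N)" by (intro divide_left_mono) (auto simp: l_def)
    then show ?thesis using N by linarith
  qed
  have ee: "e \<le> r" if "r \<in> ?E" for r unfolding e_def using fin that by (rule Min_le)
  have "norm y \<le> real l" unfolding l_def using real_nat_ceiling_ge[of "norm y"] by linarith
  moreover have "1 / real (Suc l) \<le> \<bar>y $ i - y $ j\<bar>" if "\<rho> i = i" "\<rho> j = j" "i \<noteq> j" for i j
    using le ee[of "\<bar>y $ i - y $ j\<bar>"] that by force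
  moreover have "1 / real (Suc l) \<le> d" using le ee[of d] by simp
  ultimately show ?thesis unfolding stratum_piece_def by blast
qed

lemma bracket_region_imp_spanning:
  fixes V W :: "'n::finite sym_mat \<Rightarrow> 'n sym_mat"
  assumes reg: "\<And>l. (V, W) \<in> bracket_region \<rho> l"
    and dist: "\<And>i j. \<rho> i = i \<Longrightarrow> \<rho> j = j \<Longrightarrow> i \<noteq> j \<Longrightarrow> y $ i \<noteq> y $ j" and V: "rep_field \<rho> V y \<noteq> 0"
  shows "bracket_spanning \<rho> (rep_field \<rho> V) (rep_field \<rho> W) y"
  unfolding bracket_spanning_def
proof (intro allI impI)
  fix p assume p: "\<forall>i. \<rho> i \<noteq> i \<longrightarrow> p $ i = 0" "\<forall>j. p \<bullet> iter_bracket (rep_field \<rho> V) (rep_field \<rho> W) j y = 0"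
  have "rep_field \<rho> V y \<bullet> rep_field \<rho> V y > 0" using V by simp
  then obtain l where l: "y \<in> stratum_piece \<rho> l" "1 / real (Suc l) \<le> rep_field \<rho> V y \<bullet> rep_field \<rho> V y"
    using ex_stratum_piece[OF dist] by blast
  show "p = 0"
  proof (rule ccontr)
    assume "p \<noteq> 0"
    then have "(1 / norm p) *\<^sub>R p \<in> rep_sphere \<rho>" using p(1) by (simp add: rep_sphere_def)
    then have "(y, (1 / norm p) *\<^sub>R p) \<in> stratum_piece \<rho> l \<times> rep_sphere \<rho>" using l(1) by simp
    then obtain j where "bracket_pairing \<rho> V W j (y, (1 / norm p) *\<^sub>R p) \<noteq> 0"
      using reg[of l, unfolded bracket_region_iff] l(2) by (metis fst_conv not_le)
    then show False using p(2) by (simp add: bracket_pairing_def)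
  qed
qed

theorem corollary2p2:
  fixes k :: nat
  assumes "2 \<le> k"
  shows "\<exists>R :: (nat \<Rightarrow> 'n::finite orbit_field) set.
    residual_in (product_topology (\<lambda>_. induced_fields_topology) {1..k}) R \<and>
    (\<forall>X\<in>R. \<forall>S\<in>orbit_space. \<forall>S'\<in>orbit_space.
       ordered_multiplicities S = ordered_multiplicities S' \<longrightarrow>
       (\<exists>(m::nat) (t :: nat \<Rightarrow> real) (i :: nat \<Rightarrow> nat).
          (\<forall>j\<in>{1..m}. i j \<in> {1..k}) \<and>
          foldr (\<lambda>j F. orbit_flow (X (i j)) (t j) \<circ>\<^sub>m F) [1..<Suc m] Some S = Some S'))"
proof -
  let ?T = "smooth_topology :: ('n sym_mat \<Rightarrow> 'n sym_mat) topology"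
  let ?T' = "induced_fields_topology :: 'n orbit_field topology"
  let ?PT = "product_topology (\<lambda>_::nat. ?T') {1..k}"
  obtain g where hom: "homeomorphic_maps ?T ?T' induced_field g"
    using homeomorphic_map_induced_field homeomorphic_map_maps by blast
  define pre where "pre = (\<lambda>a b U. {X \<in> topspace ?PT. (g (X a), g (X b)) \<in> U})"
  define N where "N = (\<lambda>(\<rho> :: 'n \<Rightarrow> 'n, l). nonvanishing_region \<rho> (stratum_piece \<rho> l))"
  define B where "B = (\<lambda>(\<rho> :: 'n \<Rightarrow> 'n, l). bracket_region \<rho> l)"
  define I where "I = {\<rho> :: 'n \<Rightarrow> 'n. \<forall>i. \<rho> (\<rho> i) = \<rho> i} \<times> (UNIV :: nat set)"
  \<comment> \<open>The bracket condition is imposed for both orders of the first two fields,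
    together with the absence of common zeros. There are finitely many partitions and countably many
    pieces, so the family is countable.\<close>
  define \<U> where "\<U> = (\<lambda>x. pre 1 2 (B x)) ` I \<union> (\<lambda>x. pre 2 1 (B x)) ` I \<union> (\<lambda>x. pre 1 2 (N x)) ` I"
  have od: "openin pair_topology (B x)" "pair_topology closure_of B x = topspace pair_topology"
    "openin pair_topology (N x)" "pair_topology closure_of N x = topspace pair_topology" if "x \<in> I" for x
    using that
    by (auto simp: B_def N_def I_def openin_bracket_region dense_bracket_region
        openin_nonvanishing_region compact_stratum_piece dense_nonvanishing_region)
  have k: "1 \<in> {1..k}" "2 \<in> {1..k}" "(1::nat) \<noteq> 2" "(2::nat) \<noteq> 1" using assms by auto
  have open_dense: "openin ?PT U \<and> ?PT closure_of U = topspace ?PT" if "U \<in> \<U>" for U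
  proof -
    obtain x where x: "x \<in> I" "U = pre 1 2 (B x) \<or> U = pre 2 1 (B x) \<or> U = pre 1 2 (N x)"
      using \<open>U \<in> \<U>\<close> by (auto simp: \<U>_def)
    note pre12 = product_pair_preimage[OF hom k(1,2,3)] and pre21 = product_pair_preimage[OF hom k(2,1,4)]
    from x(2) show ?thesis
      using pre12[OF od(1,2)[OF x(1)]] pre21[OF od(1,2)[OF x(1)]] pre12[OF od(3,4)[OF x(1)]]
      unfolding pre_def by (elim disjE) simp_all
  qed
  have "finite {\<rho> :: 'n \<Rightarrow> 'n. \<forall>i. \<rho> (\<rho> i) = \<rho> i}" by (rule finite_subset[OF subset_UNIV]) simp
  then have "countable I" unfolding I_def by (intro countable_SIGMA countable_finite[of "Collect _"]) simp_all
  then have count: "countable \<U>" unfolding \<U>_def by (intro countable_Un countable_image)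
  define R where "R = topspace ?PT \<inter> \<Inter>\<U>"
  have "residual_in ?PT R"
    unfolding residual_in_def using count open_dense R_def by blast
  moreover have "\<exists>(m::nat) (t :: nat \<Rightarrow> real) (i :: nat \<Rightarrow> nat).
      (\<forall>j\<in>{1..m}. i j \<in> {1..k}) \<and>
      foldr (\<lambda>j F. orbit_flow (X (i j)) (t j) \<circ>\<^sub>m F) [1..<Suc m] Some S = Some S'"
    if X: "X \<in> R" and S: "S \<in> orbit_space" "S' \<in> orbit_space" "ordered_multiplicities S = ordered_multiplicities S'"
    for X S S'
  proof -
    define V where "V = g (X 1)"
    define W where "W = g (X 2)"
    have Xt: "X 1 \<in> topspace ?T'" "X 2 \<in> topspace ?T'" using X k by (auto simp: R_def)
    have V: "V \<in> equivariant_fields" "X 1 = induced_field V" and W: "W \<in> equivariant_fields" "X 2 = induced_field W"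
      using hom Xt topspace_smooth_topology[where 'n='n] continuous_map_image_subset_topspace[of ?T' ?T g]
      by (auto simp: V_def W_def homeomorphic_maps_def)
    have reg: "(V, W) \<in> bracket_region \<rho> l" "(W, V) \<in> bracket_region \<rho> l"
      "(V, W) \<in> nonvanishing_region \<rho> (stratum_piece \<rho> l)" if "\<And>i. \<rho> (\<rho> i) = \<rho> i" for \<rho> l
    proof -
      have I: "(\<rho>, l) \<in> I" using that by (simp add: I_def)
      have "X \<in> pre 1 2 (B (\<rho>, l))" "X \<in> pre 2 1 (B (\<rho>, l))" "X \<in> pre 1 2 (N (\<rho>, l))"
        using X I unfolding R_def \<U>_def by blast+
      then show "(V, W) \<in> bracket_region \<rho> l" "(W, V) \<in> bracket_region \<rho> l"
        "(V, W) \<in> nonvanishing_region \<rho> (stratum_piece \<rho> l)"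
        by (simp_all add: pre_def B_def N_def V_def W_def)
    qed
    have good: "bracket_spanning \<rho> (rep_field \<rho> V) (rep_field \<rho> W) y \<or> bracket_spanning \<rho> (rep_field \<rho> W) (rep_field \<rho> V) y"
      if \<rho>: "\<And>i. \<rho> (\<rho> i) = \<rho> i" and dist: "\<And>i j. \<rho> i = i \<Longrightarrow> \<rho> j = j \<Longrightarrow> i \<noteq> j \<Longrightarrow> y $ i \<noteq> y $ j" for \<rho> y
    proof -
      obtain l where "y \<in> stratum_piece \<rho> l" using ex_stratum_piece[OF dist zero_less_one] by blast
      then have "rep_field \<rho> V y \<noteq> 0 \<or> rep_field \<rho> W y \<noteq> 0"
        using reg(3)[OF \<rho>, of l] by (auto simp: nonvanishing_region_def)
      then show ?thesis
        using bracket_region_imp_spanning[OF reg(1)[OF \<rho>] dist] bracket_region_imp_spanning[OF reg(2)[OF \<rho>] dist]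
        by blast
    qed
    obtain S0 S0' where S0: "S = orbit S0" "S' = orbit S0'" using S(1,2) by (auto simp: orbit_space_def)
    obtain P x where P: "orthogonal_matrix P" "S0 = act P (diag x)" using diagonalization by blast
    obtain P' z where P': "orthogonal_matrix P'" "S0' = act P' (diag z)" using diagonalization by blast
    have SS: "S = orbit (diag x)" "S' = orbit (diag z)" using S0 P P' by (simp_all add: orbit_act)
    obtain \<sigma> where \<sigma>: "bij \<sigma>" "\<And>i j. x $ i < x $ j \<longleftrightarrow> z $ \<sigma> i < z $ \<sigma> j"
      using ex_order_matching_permutation[of "($) x" "($) z"] S(3)
      by (auto simp: SS ordered_multiplicities_orbit ordered_multiplicities_of_diag)
    \<comment> \<open>Relabelling \<open>z\<close> by \<open>\<sigma>\<close> stays in its orbit, as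
      permutation matrices are orthogonal, and puts both diagonals into one connected component of
      one stratum.\<close>
    have "steers V W (diag x) (diag (\<chi> i. z $ \<sigma> i))"
      by (rule steers_same_order_pattern[OF V(1) W(1) good]) (use \<sigma>(2) in auto)
    moreover have "S' = orbit (diag (\<chi> i. z $ \<sigma> i))"
      using orbit_act[OF orthogonal_perm_matrix[OF \<sigma>(1)], of "diag z"] act_perm_matrix_diag[OF \<sigma>(1), of z]
      by (simp add: SS)
    ultimately show ?thesis
      using steers_imp_orbit_flow_chain[OF V W k(1,2)] SS(1) by blast
  qed
  ultimately show ?thesis by blast
qed

end
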